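(* There is an $O(1)$-approximation algorithm for Robust Facility Location, in the explicit metric setting, that can be implemented in the Massively Parallel Computation (MPC) model with $\tilde O(n)$ words of memory per machine in $O(\log\log\log n)$ rounds with high probability.
   Context: Robust Facility Location: the input is a set $F$ of facilities with opening costs $f_i\ge 0$, a set $C$ of clients, a metric $d$ on $F\cup C$, and an integer $0\le p\le |C|$. A feasible solution is $(C',F')$ with $F'\subseteq F$, $C'\subseteq C$, $|C'|\ge p$; its cost is $\sum_{i\in F'}f_i+\sum_{j\in C'}d(j,F')$ with $d(j,F')=\min_{i\in F'}d(i,j)$. An $\alpha$-approximation algorithm outputs a feasible solution of cost at most $\alpha$ times the minimum cost. Assume $|F|=|C|=n$ and that every individual number in the input can be represented in $O(\log n)$ bits. Explicit metric setting: the distances are given explicitly (total input size $\Theta(n^2)$); the input is distributed in a vertex-centric fashion: each vertex $v\in F\cup C$ is hosted by a machine, which knows $d(u,v)$ for all $u\in F\cup C$, and $f_v$ if $v$ is a facility. MPC model: there are $\tilde O(n)$ machines, each with $S=\tilde O(n)$ words of memory. In each synchronous round each machine performs local computation and sends and receives a total of $O(S)$ words. The algorithm is randomized; "with high probability" means with probability at least $1-1/\mathrm{poly}(n)$; $\tilde O(g(n))=O(g(n)\cdot\mathrm{poly}(\log n))$. *)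

theory Defs
  imports "HOL-Probability.Probability" "HOL-Library.Landau_Symbols"
begin

section \<open>Robust facility location\<close>

text \<open>Vertices (facilities and clients, possibly overlapping) are named by natural numbers.\<close>

record rfl_instance =
  facilities :: "nat set"
  clients :: "nat set"
  opening_cost :: "nat \<Rightarrow> real"
  distance :: "nat \<Rightarrow> nat \<Rightarrow> real"
  coverage :: nat

abbreviation vertices :: "rfl_instance \<Rightarrow> nat set" where
  "vertices I \<equiv> facilities I \<union> clients I"

text \<open>A number is written in \<open>b\<close> bits as a fraction with \<open>b\<close>-bit numerator and denominator;
  this covers integers and fixed-point numbers.\<close>

definition representable :: "nat \<Rightarrow> real \<Rightarrow> bool" where
  "representable b x \<longleftrightarrow> (\<exists>p q :: nat. p < 2 ^ b \<and> 0 < q \<and> q < 2 ^ b \<and> x = real p / real q)"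

text \<open>Since there are at most \<open>2 * n\<close> vertices, naming them by numbers below \<open>2 * n\<close> loses no
  generality.\<close>

definition valid_instance :: "nat \<Rightarrow> nat \<Rightarrow> rfl_instance \<Rightarrow> bool" where
  "valid_instance n b I \<longleftrightarrow>
     vertices I \<subseteq> {..<2 * n} \<and>
     card (facilities I) = n \<and> card (clients I) = n \<and>
     Metric_space (vertices I) (distance I) \<and>
     (\<forall>i\<in>facilities I. 0 \<le> opening_cost I i) \<and>
     coverage I \<le> card (clients I) \<and>
     (\<forall>i\<in>facilities I. representable b (opening_cost I i)) \<and>
     (\<forall>u\<in>vertices I. \<forall>v\<in>vertices I. representable b (distance I u v))"

definition feasible :: "rfl_instance \<Rightarrow> nat set \<Rightarrow> nat set \<Rightarrow> bool" where
  "feasible I C' F' \<longleftrightarrow> F' \<subseteq> facilities I \<and> C' \<subseteq> clients I \<and> coverage I \<le> card C'"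

text \<open>The minimum over the empty set is \<open>\<infinity>\<close>: a client can only be served by an open facility,
  but with coverage requirement 0 it is feasible to open nothing at cost 0.\<close>

definition dist_to :: "rfl_instance \<Rightarrow> nat \<Rightarrow> nat set \<Rightarrow> ereal" where
  "dist_to I j F' = (if F' = {} then \<infinity> else ereal (Min ((\<lambda>i. distance I i j) ` F')))"

definition cost :: "rfl_instance \<Rightarrow> nat set \<Rightarrow> nat set \<Rightarrow> ereal" where
  "cost I C' F' = ereal (\<Sum>i\<in>F'. opening_cost I i) + (\<Sum>j\<in>C'. dist_to I j F')"

definition min_cost :: "rfl_instance \<Rightarrow> ereal" where
  "min_cost I = Min {cost I C' F' | C' F'. feasible I C' F'}"

definition approx_solution :: "real \<Rightarrow> rfl_instance \<Rightarrow> nat set \<Rightarrow> nat set \<Rightarrow> bool" where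
  "approx_solution \<alpha> I C' F' \<longleftrightarrow> feasible I C' F' \<and> cost I C' F' \<le> ereal \<alpha> * min_cost I"

section \<open>Massively parallel computation\<close>

text \<open>Memory contents and messages are lists of words. Local computation is not restricted, and
  every machine has its own independent source of randomness. In a round, every machine sends the
  messages \<open>mpc_send i m j\<close> (from \<open>i\<close> with memory \<open>m\<close> to \<open>j\<close>), then replaces its memory using
  the messages received from each machine. A machine announces its output by making
  \<open>mpc_output\<close> different from \<open>None\<close>.\<close>

type_synonym words = "nat list"

type_synonym config = "nat \<Rightarrow> words"

record ('i, 'o) mpc_protocol =
  mpc_init :: "nat \<Rightarrow> 'i \<Rightarrow> words pmf"
  mpc_send :: "nat \<Rightarrow> words \<Rightarrow> nat \<Rightarrow> words"
  mpc_update :: "nat \<Rightarrow> words \<Rightarrow> (nat \<Rightarrow> words) \<Rightarrow> words pmf"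
  mpc_output :: "nat \<Rightarrow> words \<Rightarrow> 'o option"

text \<open>Below, \<open>M\<close> is the number of machines, \<open>S\<close> the memory per machine in words, and \<open>w\<close> the
  word length in bits.\<close>

definition mpc_halted :: "('i, 'o) mpc_protocol \<Rightarrow> nat \<Rightarrow> config \<Rightarrow> bool" where
  "mpc_halted P M c \<longleftrightarrow> (\<forall>i<M. mpc_output P i (c i) \<noteq> None)"

definition mpc_round :: "('i, 'o) mpc_protocol \<Rightarrow> nat \<Rightarrow> config \<Rightarrow> config pmf" where
  "mpc_round P M c =
     (if mpc_halted P M c then return_pmf c
      else Pi_pmf {..<M} []
        (\<lambda>i. mpc_update P i (c i) (\<lambda>j. if j < M then mpc_send P j (c j) i else [])))"

primrec mpc_run :: "('i, 'o) mpc_protocol \<Rightarrow> nat \<Rightarrow> (nat \<Rightarrow> 'i) \<Rightarrow> nat \<Rightarrow> config pmf" where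
  "mpc_run P M inp 0 = Pi_pmf {..<M} [] (\<lambda>i. mpc_init P i (inp i))"
| "mpc_run P M inp (Suc t) = bind_pmf (mpc_run P M inp t) (mpc_round P M)"

definition mpc_legal :: "('i, 'o) mpc_protocol \<Rightarrow> nat \<Rightarrow> nat \<Rightarrow> nat \<Rightarrow> config \<Rightarrow> bool" where
  "mpc_legal P M S w c \<longleftrightarrow>
     (\<forall>i<M. length (c i) \<le> S \<and> set (c i) \<subseteq> {..<2 ^ w}) \<and>
     (\<not> mpc_halted P M c \<longrightarrow>
        (\<forall>i<M. \<forall>j<M. set (mpc_send P i (c i) j) \<subseteq> {..<2 ^ w}) \<and>
        (\<forall>i<M. (\<Sum>j<M. length (mpc_send P i (c i) j)) \<le> S) \<and>
        (\<forall>j<M. (\<Sum>i<M. length (mpc_send P i (c i) j)) \<le> S))"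

section \<open>Explicit metric setting\<close>

text \<open>Vertex \<open>v\<close> is hosted by machine \<open>v\<close>, whose input is all it initially knows about the
  instance; a machine that hosts no vertex has input \<open>None\<close>.\<close>

record local_input =
  li_distance :: "nat \<Rightarrow> real option"
  li_opening_cost :: "real option"
  li_is_client :: bool
  li_coverage :: nat

definition explicit_input :: "rfl_instance \<Rightarrow> nat \<Rightarrow> local_input option" where
  "explicit_input I v =
     (if v \<in> vertices I then
        Some \<lparr>li_distance = (\<lambda>u. if u \<in> vertices I then Some (distance I u v) else None),
              li_opening_cost = (if v \<in> facilities I then Some (opening_cost I v) else None),
              li_is_client = (v \<in> clients I),
              li_coverage = coverage I\<rparr>
      else None)"

text \<open>The output of machine \<open>v\<close> is a pair of flags: whether \<open>v\<close> is a served client, and whether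
  \<open>v\<close> is an open facility.\<close>

type_synonym rfl_protocol = "(local_input option, bool \<times> bool) mpc_protocol"

definition served_clients :: "rfl_protocol \<Rightarrow> nat \<Rightarrow> config \<Rightarrow> nat set" where
  "served_clients P M c = {v. v < M \<and> (\<exists>b. mpc_output P v (c v) = Some (True, b))}"

definition open_facilities :: "rfl_protocol \<Rightarrow> nat \<Rightarrow> config \<Rightarrow> nat set" where
  "open_facilities P M c = {v. v < M \<and> (\<exists>b. mpc_output P v (c v) = Some (b, True))}"

section \<open>Asymptotics\<close>

definition soft_O :: "(nat \<Rightarrow> real) \<Rightarrow> (nat \<Rightarrow> real) set" where
  "soft_O g = {f. \<exists>q::nat. f \<in> O(\<lambda>n. g n * ln (real n) ^ q)}"

end

theory Submission
  imports Defs "HOL-Real_Asymp.Real_Asymp"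
begin

text \<open>
  As in the algorithm of Mettu and Plaxton, the level of a facility is the smallest dyadic radius at
  which the clients in its ball can pay for it, and the level of a client is the smallest radius at
  which it meets such a facility. After guessing the largest opening cost \<open>\<phi>\<close> of an optimal solution,
  \<open>\<phi>\<close> plus the sum of the \<open>p\<close> smallest client radii is at most six times the optimum.

  Every client draws a random dyadic arrival time, whose rate is its radius over the price of the
  cheapest facility within reach, and opens that facility if no client nearby has a lower level or an
  earlier arrival. The clients in the ball of a facility together arrive at rate at least one, so the
  probability that nobody arrives before time \<open>2\<^sup>t\<close> is \<open>exp (- \<Omega>(2\<^sup>t))\<close>. Hence the expected opening cost
  charged to a client is proportional to its radius, and so is the expected distance to an open
  facility, since a chain of earlier and earlier arrivals starting from a client is short. On the
  highest level that is needed, a fractional knapsack argument selects facilities covering just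
  enough clients; the one facility that overshoots costs at most \<open>\<phi>\<close>.

  Messages are broadcast from everybody to everybody, so that five rounds suffice to evaluate
  logarithmically many independent samples of the coins. If none of them is good, which has
  probability at most \<open>1 / n\<close>, all remaining choices of the coins are tried one after the other.
\<close>

text \<open>With \<open>S\<close> of order \<open>n\<close> up to logarithms, every machine can
  receive a polylogarithmic message from every other one, so a constant number of all-to-all
  broadcasts fits the round bound. The difficulty is to let each vertex summarise itself in O(log n)
  words of O(log n) bits. This forces the discretisation: dyadic radii and arrival times, coins
  uniform on \<open>{..<n}\<close> instead of exponential clocks, distances sent as fractions.
  Dyadic time costs only constants: the chance of having arrived by step \<open>t\<close> grows like
  \<open>2 ^ t\<close>, while the chance that nobody nearby came earlier decays doubly
  exponentially, so the products have a bounded sum. Since every halted configuration has to be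
  correct, machines stop only on a certificate: a solution whose cost, evaluated at the offered
  facilities, is at most 180 times the score of the best guess. This bound is computable without
  knowing the optimum. In expectation a client pays 66 radii for opening and 24 for distance, 90
  together; Markov's inequality doubles this to 180, and the factor six between score and optimum
  gives 1080.\<close>

section \<open>Dyadic radii\<close>

text \<open>Level 0 is the radius 0, kept for zero distances. Level 1 lies a factor \<open>n\<close>
  below \<open>1 / 2 ^ b\<close>, a lower bound of all positive distances and prices, so that
  \<open>n\<close> clients at level 1 together cost no more than one such unit.\<close>

definition rad :: "nat \<Rightarrow> nat \<Rightarrow> nat \<Rightarrow> real" where
  "rad n b e = (if e = 0 then 0 else 2 ^ (e - 1) / (2 ^ b * real n))"

text \<open>The binary logarithm rounded up, with value 0 at 0.\<close>

definition lg :: "nat \<Rightarrow> nat" where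
  "lg n = (LEAST k. n \<le> 2 ^ k)"

text \<open>Tuned so that the top radius is at least \<open>2 ^ b\<close>, which bounds every
  distance and every price: a ball of that radius contains all clients and can pay for any
  facility.\<close>

definition max_level :: "nat \<Rightarrow> nat \<Rightarrow> nat" where
  "max_level n b = 2 * b + lg n + 1"

lemma le_two_power_lg: "n \<le> 2 ^ lg n"
  unfolding lg_def by (rule LeastI[of _ n]) (simp add: less_imp_le)

lemma rad_0 [simp]: "rad n b 0 = 0"
  by (simp add: rad_def)

lemma rad_nonneg [simp]: "0 \<le> rad n b e"
  by (simp add: rad_def)

lemma rad_pos: "n \<ge> 1 \<Longrightarrow> e \<ge> 1 \<Longrightarrow> 0 < rad n b e"
  by (simp add: rad_def)

lemma rad_Suc: "e \<ge> 1 \<Longrightarrow> rad n b (Suc e) = 2 * rad n b e"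
  by (cases e) (simp_all add: rad_def)

lemma two_rad_le_rad_Suc: "2 * rad n b e \<le> rad n b (Suc e)"
  using rad_Suc[of e n b] by (cases "e = 0") auto

lemma rad_mono: "e \<le> e' \<Longrightarrow> rad n b e \<le> rad n b e'"
  by (auto simp: rad_def intro!: divide_right_mono power_increasing)

lemma two_rad_le: "e < e' \<Longrightarrow> 2 * rad n b e \<le> rad n b e'"
  using two_rad_le_rad_Suc[of n b e] rad_mono[of "Suc e" e' n b] by linarith

lemma rad_1_le: "n \<ge> 1 \<Longrightarrow> rad n b 1 \<le> 1 / 2 ^ b"
  by (simp add: rad_def field_simps)

lemma n_rad_1: "n \<ge> 1 \<Longrightarrow> real n * rad n b 1 = 1 / 2 ^ b"
  by (simp add: rad_def)

lemma rad_max_level: assumes "n \<ge> 1" shows "2 ^ b \<le> rad n b (max_level n b)"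
proof -
  have "real n \<le> 2 ^ lg n"
    using le_two_power_lg[of n] by (metis of_nat_le_iff of_nat_numeral of_nat_power)
  then have "real n * (2 ^ b * 2 ^ b) \<le> 2 ^ lg n * (2 ^ b * 2 ^ b)"
    by (intro mult_right_mono) auto
  moreover have "(2::real) ^ (2 * b) = 2 ^ b * 2 ^ b"
    by (simp add: mult_2 power_add)
  ultimately show ?thesis
    using assms by (simp add: rad_def max_level_def field_simps power_add)
qed

section \<open>Levels of facilities and clients\<close>

text \<open>\<open>r\<close> is the row of the distance matrix known to the machine that computes the value.\<close>

definition facility_level :: "nat \<Rightarrow> nat \<Rightarrow> nat set \<Rightarrow> (nat \<Rightarrow> real) \<Rightarrow> real \<Rightarrow> nat" where
  "facility_level n b C r x = (LEAST e. x \<le> rad n b e * real (card {j\<in>C. r j \<le> rad n b e}))"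

definition client_level :: "nat \<Rightarrow> nat \<Rightarrow> nat set \<Rightarrow> (nat \<Rightarrow> nat) \<Rightarrow> (nat \<Rightarrow> real) \<Rightarrow> nat" where
  "client_level n b A lev r = (LEAST e. \<exists>i\<in>A. r i \<le> rad n b e \<and> lev i \<le> e)"

text \<open>The cheapest choice matters for the arrival rates: every client of the same level that
  helps to pay for the facility of \<open>j\<close> then has a facility of at most that price, hence
  a rate at least as large.\<close>

definition cheapest :: "nat \<Rightarrow> nat \<Rightarrow> nat set \<Rightarrow> (nat \<Rightarrow> nat) \<Rightarrow> (nat \<Rightarrow> real) \<Rightarrow> (nat \<Rightarrow> real) \<Rightarrow> nat" where
  "cheapest n b A lev f r =
     arg_min_on f {i\<in>A. r i \<le> rad n b (client_level n b A lev r) \<and> lev i \<le> client_level n b A lev r}"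

text \<open>\<open>lev\<close> is a parameter pinned down only on \<open>F\<close>, so that the
  table read off the transcript, which is 0 elsewhere, can take its place. The assumptions with
  \<open>2 ^ b\<close> are all that is kept of representability in \<open>b\<close> bits.\<close>

locale facility_location =
  fixes n b :: nat and F C :: "nat set" and f :: "nat \<Rightarrow> real" and d :: "nat \<Rightarrow> nat \<Rightarrow> real"
    and lev :: "nat \<Rightarrow> nat"
  assumes n: "n \<ge> 1"
    and F: "F \<subseteq> {..<2 * n}" and C: "C \<subseteq> {..<2 * n}" and card_F: "card F = n" and card_C: "card C = n"
    and d_nonneg: "\<And>u v. u \<in> F \<union> C \<Longrightarrow> v \<in> F \<union> C \<Longrightarrow> 0 \<le> d u v"
    and d_self: "\<And>u. u \<in> F \<union> C \<Longrightarrow> d u u = 0"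
    and d_commute: "\<And>u v. u \<in> F \<union> C \<Longrightarrow> v \<in> F \<union> C \<Longrightarrow> d u v = d v u"
    and d_triangle: "\<And>u v w. u \<in> F \<union> C \<Longrightarrow> v \<in> F \<union> C \<Longrightarrow> w \<in> F \<union> C \<Longrightarrow> d u w \<le> d u v + d v w"
    and d_grid: "\<And>u v. u \<in> F \<union> C \<Longrightarrow> v \<in> F \<union> C \<Longrightarrow> d u v = 0 \<or> 1 / 2 ^ b \<le> d u v"
    and d_le: "\<And>u v. u \<in> F \<union> C \<Longrightarrow> v \<in> F \<union> C \<Longrightarrow> d u v \<le> 2 ^ b"
    and f_nonneg: "\<And>i. i \<in> F \<Longrightarrow> 0 \<le> f i"
    and f_grid: "\<And>i. i \<in> F \<Longrightarrow> f i = 0 \<or> 1 / 2 ^ b \<le> f i"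
    and f_le: "\<And>i. i \<in> F \<Longrightarrow> f i \<le> 2 ^ b"
    and lev: "\<And>i. i \<in> F \<Longrightarrow> lev i = facility_level n b C (d i) (f i)"
begin

abbreviation "\<rho> \<equiv> rad n b"
abbreviation "L \<equiv> max_level n b"

lemma finite_F [simp, intro]: "finite F" and finite_C [simp, intro]: "finite C"
  using F C finite_subset by blast+

lemma facility_level_max:
  assumes "i \<in> F"
  shows "f i \<le> \<rho> L * real (card {j\<in>C. d i j \<le> \<rho> L})"
proof -
  have "{j\<in>C. d i j \<le> \<rho> L} = C"
    using d_le[of i] rad_max_level[OF n, of b] assms by force
  moreover have "f i \<le> \<rho> L * 1"
    using f_le[OF assms] rad_max_level[OF n, of b] by simp
  moreover have "\<rho> L * 1 \<le> \<rho> L * real n"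
    using n by (intro mult_left_mono) auto
  ultimately show ?thesis using card_C by simp
qed

lemma lev_ripe: "i \<in> F \<Longrightarrow> f i \<le> \<rho> (lev i) * real (card {j\<in>C. d i j \<le> \<rho> (lev i)})"
  unfolding lev facility_level_def by (rule LeastI[where k = L]) (rule facility_level_max)

lemma lev_le: "i \<in> F \<Longrightarrow> lev i \<le> L"
  unfolding lev facility_level_def by (rule Least_le) (rule facility_level_max)

lemma lev_least: "i \<in> F \<Longrightarrow> e < lev i \<Longrightarrow> \<rho> e * real (card {j\<in>C. d i j \<le> \<rho> e}) < f i"
  unfolding lev facility_level_def using not_less_Least by (metis (lifting) not_le_imp_less)

text \<open>One level below \<open>lev i\<close> the ball around \<open>i\<close> cannot pay for
  \<open>i\<close>. So the clients of \<open>D\<close> inside that smaller ball are charged to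
  \<open>f i\<close>, those outside to their own distance, and doubling the radius doubles the
  bound. Level 1 has only radius 0 below it; there the positive price \<open>f i\<close> is at least
  \<open>1 / 2 ^ b = n * rad n b 1\<close>.\<close>

lemma card_rad_lev_le:
  assumes i: "i \<in> F" and D: "D \<subseteq> C"
  shows "real (card D) * \<rho> (lev i) \<le> 2 * (f i + (\<Sum>j\<in>D. d i j))"
proof -
  have fD: "finite D" using D finite_subset by blast
  have dD: "0 \<le> d i j" if "j \<in> D" for j using d_nonneg that i D by blast
  have sD: "0 \<le> (\<Sum>j\<in>D. d i j)" by (rule sum_nonneg) (rule dD)
  consider "lev i = 0" | "lev i = 1" | e where "lev i = Suc e" "e \<ge> 1"
    by (metis One_nat_def Suc_leI gr0I not0_implies_Suc)
  then show ?thesis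
  proof cases
    case 1
    then show ?thesis using f_nonneg[OF i] sD by simp
  next
    case 2
    have "f i > 0" using lev_least[OF i, of 0] 2 by simp
    then have "f i \<ge> 1 / 2 ^ b" using f_grid[OF i] by auto
    moreover have "real (card D) * \<rho> 1 \<le> real n * \<rho> 1"
      using card_mono[OF finite_C D] card_C by (intro mult_right_mono) auto
    ultimately show ?thesis using 2 n_rad_1[OF n, of b] sD f_nonneg[OF i] by simp
  next
    case 3
    let ?B = "{j\<in>C. d i j \<le> \<rho> e}"
    have "real (card D) * \<rho> e = (\<Sum>j\<in>D. \<rho> e)" by simp
    also have "\<dots> \<le> (\<Sum>j\<in>D. (if j \<in> ?B then \<rho> e else 0) + d i j)"
      using dD D by (intro sum_mono) auto
    also have "\<dots> = (\<Sum>j\<in>D \<inter> ?B. \<rho> e) + (\<Sum>j\<in>D. d i j)"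
      unfolding sum.distrib sum.inter_restrict[OF fD] ..
    also have "(\<Sum>j\<in>D \<inter> ?B. \<rho> e) \<le> (\<Sum>j\<in>?B. \<rho> e)"
      by (intro sum_mono2) auto
    also have "(\<Sum>j\<in>?B. \<rho> e) = \<rho> e * real (card ?B)" by simp
    also have "\<dots> \<le> f i" using lev_least[OF i, of e] 3 by simp
    finally have "real (card D) * \<rho> e \<le> f i + (\<Sum>j\<in>D. d i j)" by simp
    then show ?thesis using 3 rad_Suc[of e n b] by simp
  qed
qed

end

locale facility_guess = facility_location +
  fixes A :: "nat set" and a ch :: "nat \<Rightarrow> nat"
  assumes A: "A \<subseteq> F" and A_nonempty: "A \<noteq> {}"
    and a: "\<And>j. j \<in> C \<Longrightarrow> a j = client_level n b A lev (d j)"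
    and ch: "\<And>j. j \<in> C \<Longrightarrow> ch j = cheapest n b A lev f (d j)"
begin

lemma finite_A [simp, intro]: "finite A"
  using A finite_F finite_subset by blast

lemma client_level_max:
  assumes "j \<in> C"
  shows "\<exists>i\<in>A. d j i \<le> \<rho> L \<and> lev i \<le> L"
proof -
  obtain i where i: "i \<in> A" using A_nonempty by blast
  then show ?thesis using d_le[of j i] lev_le[of i] A assms rad_max_level[OF n, of b]
    by (intro bexI[of _ i]) auto
qed

lemma a_attained: "j \<in> C \<Longrightarrow> \<exists>i\<in>A. d j i \<le> \<rho> (a j) \<and> lev i \<le> a j"
  unfolding a client_level_def by (rule LeastI[where k = L]) (rule client_level_max)

lemma a_le: "j \<in> C \<Longrightarrow> i \<in> A \<Longrightarrow> d j i \<le> \<rho> e \<Longrightarrow> lev i \<le> e \<Longrightarrow> a j \<le> e"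
  unfolding a client_level_def by (rule Least_le) blast

lemma a_le_L: "j \<in> C \<Longrightarrow> a j \<le> L"
  unfolding a client_level_def by (rule Least_le) (rule client_level_max)

lemma ch_props:
  assumes "j \<in> C"
  shows "ch j \<in> A" and "d j (ch j) \<le> \<rho> (a j)" and "lev (ch j) \<le> a j"
    and "\<And>i. i \<in> A \<Longrightarrow> d j i \<le> \<rho> (a j) \<Longrightarrow> lev i \<le> a j \<Longrightarrow> f (ch j) \<le> f i"
proof -
  let ?S = "{i\<in>A. d j i \<le> \<rho> (a j) \<and> lev i \<le> a j}"
  have S: "finite ?S" "?S \<noteq> {}" using a_attained[OF assms] by auto
  have eq: "ch j = arg_min_on f ?S"
    using assms by (simp add: ch cheapest_def a)
  show "ch j \<in> A" "d j (ch j) \<le> \<rho> (a j)" "lev (ch j) \<le> a j"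
    using arg_min_if_finite(1)[OF S, of f] eq by auto
  show "f (ch j) \<le> f i" if "i \<in> A" "d j i \<le> \<rho> (a j)" "lev i \<le> a j" for i
    using arg_min_least[OF S, of i f] eq that by auto
qed

text \<open>If \<open>a j\<close> exceeds \<open>lev i\<close>, then one level below
  \<open>a j\<close> the facility \<open>i\<close> fails for \<open>j\<close> by distance, since its
  level still qualifies; doubling gives \<open>2 * d i j\<close>. Otherwise the radius at
  \<open>a j\<close> is at most the one at \<open>lev i\<close>.\<close>

lemma rad_a_le:
  assumes j: "j \<in> C" and i: "i \<in> A"
  shows "\<rho> (a j) \<le> 2 * d i j + \<rho> (lev i)"
proof -
  have iF: "i \<in> F" using i A by blast
  have dp: "0 \<le> d i j" using d_nonneg iF j by blast
  have sym: "d i j = d j i" using d_commute iF j by blast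
  show ?thesis
  proof (cases "a j \<le> lev i")
    case True
    then show ?thesis using dp rad_mono[of "a j" "lev i" n b] by simp
  next
    case False
    then obtain e where e: "a j = Suc e" "lev i \<le> e" by (metis Suc_leI less_imp_Suc_add linorder_not_le le_add1)
    have far: "d j i > \<rho> e"
      using a_le[OF j i, of e] e by (cases "d j i \<le> \<rho> e") auto
    show ?thesis
    proof (cases "e = 0")
      case True
      then have "d i j \<ge> 1 / 2 ^ b" using far sym d_grid[of i j] iF j by auto
      then show ?thesis using rad_1_le[OF n, of b] e True rad_nonneg[of n b "lev i"] dp by simp
    next
      case False
      then have "\<rho> (a j) = 2 * \<rho> e" using rad_Suc[of e n b] e by simp
      then show ?thesis using far sym rad_nonneg[of n b "lev i"] by linarith
    qed
  qed
qed

text \<open>The lower bound on any solution with facilities in \<open>A\<close>: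
  \<open>rad_a_le\<close> charges each client twice its distance plus the radius of its facility,
  and \<open>card_rad_lev_le\<close> turns the latter into \<open>2 * f i\<close> and another two
  distances. Hence the factor 4.\<close>

lemma sum_rad_le:
  assumes D: "D \<subseteq> C" and F': "F' \<subseteq> A" and \<pi>: "\<And>j. j \<in> D \<Longrightarrow> \<pi> j \<in> F'"
  shows "(\<Sum>j\<in>D. \<rho> (a j)) \<le> 4 * ((\<Sum>i\<in>F'. f i) + (\<Sum>j\<in>D. d (\<pi> j) j))"
proof -
  have fD: "finite D" and fF': "finite F'" using D F' finite_subset by blast+
  let ?D = "\<lambda>i. {j\<in>D. \<pi> j = i}"
  have "(\<Sum>j\<in>D. \<rho> (a j)) \<le> (\<Sum>j\<in>D. 2 * d (\<pi> j) j + \<rho> (lev (\<pi> j)))"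
    using rad_a_le D F' \<pi> by (intro sum_mono) blast
  also have "\<dots> = 2 * (\<Sum>j\<in>D. d (\<pi> j) j) + (\<Sum>j\<in>D. \<rho> (lev (\<pi> j)))"
    by (simp add: sum.distrib sum_distrib_left)
  also have "(\<Sum>j\<in>D. \<rho> (lev (\<pi> j))) = (\<Sum>i\<in>F'. \<Sum>j\<in>?D i. \<rho> (lev (\<pi> j)))"
    using fD fF' \<pi> by (subst sum.group) auto
  also have "\<dots> = (\<Sum>i\<in>F'. real (card (?D i)) * \<rho> (lev i))"
    by (intro sum.cong) auto
  also have "\<dots> \<le> (\<Sum>i\<in>F'. 2 * (f i + (\<Sum>j\<in>?D i. d i j)))"
    using F' A D by (intro sum_mono card_rad_lev_le) auto
  also have "\<dots> = 2 * ((\<Sum>i\<in>F'. f i) + (\<Sum>i\<in>F'. \<Sum>j\<in>?D i. d (\<pi> j) j))"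
    by (simp add: sum.distrib sum_distrib_left)
  also have "(\<Sum>i\<in>F'. \<Sum>j\<in>?D i. d (\<pi> j) j) = (\<Sum>j\<in>D. d (\<pi> j) j)"
    using fD fF' \<pi> by (subst sum.group) auto
  finally have "(\<Sum>j\<in>D. \<rho> (a j)) \<le> 2 * (\<Sum>i\<in>F'. f i) + 4 * (\<Sum>j\<in>D. d (\<pi> j) j)" by simp
  moreover have "0 \<le> (\<Sum>i\<in>F'. f i)" using f_nonneg F' A by (intro sum_nonneg) auto
  ultimately show ?thesis by simp
qed

end

section \<open>Random arrivals\<close>

text \<open>For a coin \<open>u\<close> uniform on \<open>{..<n}\<close>, the client arrives before or at time \<open>t\<close> with
  probability about \<open>2\<^sup>t\<close> times its radius divided by the price of its facility.\<close>

definition arrival :: "nat \<Rightarrow> nat \<Rightarrow> (nat \<Rightarrow> real) \<Rightarrow> (nat \<Rightarrow> nat) \<Rightarrow> (nat \<Rightarrow> nat) \<Rightarrow> (nat \<Rightarrow> nat) \<Rightarrow> nat \<Rightarrow> nat" where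
  "arrival n b f a ch s j = (LEAST t. real (s j) * f (ch j) < 2 ^ t * rad n b (a j) * real n)"

text \<open>Level-0 clients open nothing, as a free facility at distance 0 is always open. Ties are
  not broken, so several nearby clients may open; the doubled radius ensures that all payers of the
  chosen facility take part in the comparison.\<close>

definition opens :: "nat \<Rightarrow> nat \<Rightarrow> nat set \<Rightarrow> (nat \<Rightarrow> nat) \<Rightarrow> (nat \<Rightarrow> nat) \<Rightarrow> (nat \<Rightarrow> real) \<Rightarrow> nat \<Rightarrow> bool" where
  "opens n b C a arr r j \<longleftrightarrow> 1 \<le> a j \<and>
     (\<forall>j'\<in>C. r j' \<le> 2 * rad n b (a j) \<longrightarrow> a j < a j' \<or> a j = a j' \<and> arr j \<le> arr j')"

text \<open>Only openings by clients of level at most \<open>e\<close> count, so the offer to a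
  client never depends on a higher level. This allows all levels above the threshold to be discarded
  together with their opening costs.\<close>

definition opened :: "nat set \<Rightarrow> (nat \<Rightarrow> real) \<Rightarrow> nat set \<Rightarrow> (nat \<Rightarrow> nat) \<Rightarrow> (nat \<Rightarrow> nat) \<Rightarrow> (nat \<Rightarrow> bool) \<Rightarrow> nat \<Rightarrow> nat set" where
  "opened A f C a ch Q e = {i\<in>A. f i = 0} \<union> ch ` {j\<in>C. Q j \<and> a j \<le> e}"

section \<open>Elementary estimates: exponentials and counting in finite cubes\<close>

lemma two_div_power_sum: "(\<Sum>t=1..T. 1 / 2 ^ t :: real) \<le> 1"
proof -
  have "(\<Sum>t=1..T. 1 / 2 ^ t :: real) = 1 - 1 / 2 ^ T"
    by (induction T) (auto simp: field_simps)
  then show ?thesis by simp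
qed

lemma exp_minus_le_inverse: "x > 0 \<Longrightarrow> exp (- x) \<le> 1 / (x::real)"
proof -
  assume x: "x > 0"
  have "x \<le> exp x" using exp_ge_add_one_self[of x] by linarith
  then have "1 / exp x \<le> 1 / x" using x by (intro divide_left_mono) auto
  then show ?thesis by (simp add: exp_minus inverse_eq_divide)
qed

lemma exp_minus_le_inverse_square: "x > 0 \<Longrightarrow> exp (- x) \<le> 2 / (x::real)\<^sup>2"
proof -
  assume x: "x > 0"
  have "1 + x + x\<^sup>2 / 2 \<le> exp x" using x by (intro exp_lower_Taylor_quadratic) simp
  then have "x\<^sup>2 / 2 \<le> exp x" using x by linarith
  then have "1 / exp x \<le> 1 / (x\<^sup>2 / 2)" using x by (intro divide_left_mono) auto
  then show ?thesis by (simp add: exp_minus inverse_eq_divide)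
qed

lemma card_below_le:
  fixes x :: real assumes "0 \<le> x"
  shows "real (card {u\<in>{..<N}. real u < x}) \<le> x + 1"
proof -
  have "{u\<in>{..<N}. real u < x} \<subseteq> {..<nat \<lceil>x\<rceil>}"
    by auto linarith
  then have "card {u\<in>{..<N}. real u < x} \<le> nat \<lceil>x\<rceil>"
    using card_mono[of "{..<nat \<lceil>x\<rceil>}"] by fastforce
  then show ?thesis using assms by linarith
qed

text \<open>\<open>N - x\<close> equals \<open>N * (1 - x / N)\<close>, and \<open>1 + y\<close> is
  at most \<open>exp y\<close>: a uniform coin has at most the tail of an exponential clock.\<close>

lemma card_above_le:
  fixes x :: real assumes "0 \<le> x"
  shows "real (card {u\<in>{..<N}. x \<le> real u}) \<le> real N * exp (- (x / real N))"
proof (cases "N = 0 \<or> x > real N")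
  case True
  then have "{u\<in>{..<N}. x \<le> real u} = {}" by auto
  then show ?thesis by (simp only: card.empty) simp
next
  case False
  have "{u\<in>{..<N}. x \<le> real u} \<subseteq> {nat \<lceil>x\<rceil>..<N}"
    by auto
  then have "card {u\<in>{..<N}. x \<le> real u} \<le> N - nat \<lceil>x\<rceil>"
    using card_mono[of "{nat \<lceil>x\<rceil>..<N}"] by fastforce
  then have "real (card {u\<in>{..<N}. x \<le> real u}) \<le> real N - x"
    using False assms by linarith
  also have "\<dots> = real N * (1 + - (x / real N))" using False by (simp add: field_simps)
  also have "\<dots> \<le> real N * exp (- (x / real N))"
    by (intro mult_left_mono exp_ge_add_one_self) auto
  finally show ?thesis .
qed

text \<open>Independence of the coins in counting form: constraints on the coordinates in
  \<open>J\<close> multiply, the other coordinates are free.\<close>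

lemma card_PiE_box:
  assumes "finite I" and "J \<subseteq> I"
  shows "real (card {s\<in>I \<rightarrow>\<^sub>E U. \<forall>j\<in>J. s j \<in> B j}) =
    (\<Prod>j\<in>J. real (card (U \<inter> B j))) * real (card U) ^ (card I - card J)"
proof -
  have "{s\<in>I \<rightarrow>\<^sub>E U. \<forall>j\<in>J. s j \<in> B j} = PiE I (\<lambda>j. if j \<in> J then U \<inter> B j else U)"
  proof (intro set_eqI iffI)
    fix s assume "s \<in> PiE I (\<lambda>j. if j \<in> J then U \<inter> B j else U)"
    then have *: "s \<in> extensional I" "\<And>j. j \<in> I \<Longrightarrow> s j \<in> (if j \<in> J then U \<inter> B j else U)"
      by (auto simp: PiE_iff)
    have "s j \<in> U" if "j \<in> I" for j using *(2)[OF that] by (simp split: if_splits)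
    moreover have "s j \<in> B j" if "j \<in> J" for j using *(2)[of j] that assms(2) by auto
    ultimately show "s \<in> {s\<in>I \<rightarrow>\<^sub>E U. \<forall>j\<in>J. s j \<in> B j}" using *(1) by (auto simp: PiE_iff)
  qed (auto simp: PiE_iff)
  then have "card {s\<in>I \<rightarrow>\<^sub>E U. \<forall>j\<in>J. s j \<in> B j} = (\<Prod>j\<in>I. card (if j \<in> J then U \<inter> B j else U))"
    using assms(1) by (simp add: card_PiE)
  also have "\<dots> = (\<Prod>j\<in>J. card (U \<inter> B j)) * (\<Prod>j\<in>I - J. card U)"
    using assms by (subst prod.subset_diff[OF assms(2,1)]) (simp add: mult.commute)
  also have "(\<Prod>j\<in>I - J. card U) = card U ^ (card I - card J)"
    using card_Diff_subset[OF finite_subset[OF assms(2,1)] assms(2)] by simp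
  finally show ?thesis by simp
qed

lemma sum_indicator_eq_card: "finite X \<Longrightarrow> (\<Sum>x\<in>X. if P x then 1 else 0 :: real) = real (card {x\<in>X. P x})"
  by (simp add: sum.If_cases Int_def)

section \<open>The clients who pay for a facility, and the expected opening cost\<close>

context facility_guess
begin

abbreviation "arr s \<equiv> arrival n b f a ch s"
abbreviation "ops s j \<equiv> opens n b C a (arr s) (d j) j"
abbreviation "Y s \<equiv> opened A f C a ch (ops s)"
definition "near j = {j'\<in>C. d j j' \<le> 2 * \<rho> (a j) \<and> a j' = a j}"
definition "isolated j \<longleftrightarrow> (\<forall>j'\<in>C. d j j' \<le> 2 * \<rho> (a j) \<longrightarrow> a j \<le> a j')"
text \<open>One coin for every vertex name below \<open>2 * n\<close>; expectations are written as
  sums over this finite set.\<close>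

definition "\<Omega> = {..<2 * n} \<rightarrow>\<^sub>E {..<n}"
definition "first_arr s j = Min (arr s ` near j)"
text \<open>The value 0 for clients that are not isolated reflects that they move at once to a
  client of lower level, without waiting for an arrival.\<close>

definition "delay s j = (if isolated j then first_arr s j else 0)"

lemma finite_near [simp, intro]: "finite (near j)"
  by (simp add: near_def)

lemma finite_Omega [simp, intro]: "finite \<Omega>"
  unfolding \<Omega>_def by (intro finite_PiE) auto

lemma card_Omega: "card \<Omega> = n ^ (2 * n)"
  unfolding \<Omega>_def by (simp add: card_PiE)

lemma card_Omega_pos: "card \<Omega> > 0"
  using n by (simp add: card_Omega)

lemma ch_F: "j \<in> C \<Longrightarrow> ch j \<in> F"
  using ch_props(1) A by blast

lemma ch_nonneg: "j \<in> C \<Longrightarrow> 0 \<le> f (ch j)"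
  using ch_F f_nonneg by blast

lemma arrival_exists:
  assumes "a j \<ge> 1" shows "\<exists>t. real (s j) * f (ch j) < 2 ^ t * \<rho> (a j) * real n"
proof -
  have p: "\<rho> (a j) * real n > 0" using rad_pos[OF n assms] n by simp
  obtain t where "real (s j) * f (ch j) / (\<rho> (a j) * real n) < 2 ^ t"
    using real_arch_pow[of 2] by fastforce
  then show ?thesis using p by (auto simp: field_simps intro!: exI[of _ t])
qed

lemma arrival_le_iff:
  assumes "a j \<ge> 1"
  shows "arr s j \<le> t \<longleftrightarrow> real (s j) * f (ch j) < 2 ^ t * \<rho> (a j) * real n"
proof
  assume "arr s j \<le> t"
  have "real (s j) * f (ch j) < 2 ^ arr s j * \<rho> (a j) * real n"
    unfolding arrival_def using LeastI_ex[OF arrival_exists[OF assms]] .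
  also have "\<dots> \<le> 2 ^ t * \<rho> (a j) * real n"
    using \<open>arr s j \<le> t\<close> by (intro mult_right_mono power_increasing) auto
  finally show "real (s j) * f (ch j) < 2 ^ t * \<rho> (a j) * real n" .
next
  assume "real (s j) * f (ch j) < 2 ^ t * \<rho> (a j) * real n"
  then show "arr s j \<le> t" unfolding arrival_def by (rule Least_le)
qed

definition "payers j = {j'\<in>C. d (ch j) j' \<le> \<rho> (lev (ch j))}"

text \<open>A payer \<open>k\<close> reaches \<open>ch j\<close> within the radius of level
  \<open>lev (ch j)\<close>, so \<open>a k\<close> is at most that level, which is at most
  \<open>a j\<close>; and \<open>k\<close> lies within two radii of \<open>j\<close>. Isolation
  forbids a smaller level, so the three levels coincide, and \<open>ch j\<close> is then a candidate
  for \<open>k\<close>.\<close>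

lemma payers_near:
  assumes j: "j \<in> C" and iso: "isolated j" and k: "k \<in> payers j"
  shows "k \<in> near j" and "lev (ch j) = a j" and "f (ch k) \<le> f (ch j)"
proof -
  let ?i = "ch j"
  have kC: "k \<in> C" and dk: "d ?i k \<le> \<rho> (lev ?i)" using k by (auto simp: payers_def)
  have iF: "?i \<in> F" using ch_F j by blast
  have dk': "d k ?i \<le> \<rho> (lev ?i)" using dk d_commute[of k ?i] kC iF by simp
  have ak: "a k \<le> lev ?i" using a_le[OF kC ch_props(1)[OF j] dk'] by simp
  have "d j k \<le> d j ?i + d ?i k" using d_triangle j kC iF by blast
  also have "\<dots> \<le> 2 * \<rho> (a j)"
    using ch_props(2)[OF j] dk rad_mono[OF ch_props(3)[OF j], of n b] by simp
  finally have djk: "d j k \<le> 2 * \<rho> (a j)" .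
  then have "a j \<le> a k" using iso kC by (auto simp: isolated_def)
  then show eq: "lev ?i = a j" using ak ch_props(3)[OF j] by simp
  have "a k = a j" using \<open>a j \<le> a k\<close> ak ch_props(3)[OF j] by simp
  then show "k \<in> near j" using djk kC by (simp add: near_def)
  show "f (ch k) \<le> f ?i"
    using ch_props(4)[OF kC ch_props(1)[OF j]] dk' eq \<open>a k = a j\<close> by simp
qed

text \<open>In terms of rates: each payer arrives at rate at least
  \<open>\<rho> (a j) / f (ch j)\<close>, so the payers of an isolated client have total rate at
  least one.\<close>

lemma payers_pay:
  assumes j: "j \<in> C" and iso: "isolated j" and pos: "0 < f (ch j)"
  shows "f (ch j) \<le> \<rho> (a j) * real (card (payers j))" and "a j \<ge> 1"
proof -
  have le: "f (ch j) \<le> \<rho> (lev (ch j)) * real (card (payers j))"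
    using lev_ripe[OF ch_F[OF j]] by (simp add: payers_def)
  then have "payers j \<noteq> {}" using pos by auto
  then have "lev (ch j) = a j" using payers_near(2)[OF j iso] by blast
  then show "f (ch j) \<le> \<rho> (a j) * real (card (payers j))" using le by simp
  then show "a j \<ge> 1" using pos by (cases "a j") auto
qed

lemma card_late_le:
  assumes j: "j \<in> C" and iso: "isolated j" and pos: "0 < f (ch j)" and t: "t \<ge> 1"
    and k: "k \<in> payers j"
  shows "real (card {u\<in>{..<n}. 2 ^ (t - 1) * \<rho> (a k) * real n \<le> real u * f (ch k)})
    \<le> real n * exp (- (2 ^ (t - 1) * \<rho> (a j) / f (ch j)))"
proof -
  let ?x = "2 ^ (t - 1) * \<rho> (a j) * real n / f (ch j)"
  have ak: "a k = a j" using payers_near(1)[OF j iso k] by (simp add: near_def)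
  have "{u\<in>{..<n}. 2 ^ (t - 1) * \<rho> (a k) * real n \<le> real u * f (ch k)} \<subseteq> {u\<in>{..<n}. ?x \<le> real u}"
  proof
    fix u assume u: "u \<in> {u\<in>{..<n}. 2 ^ (t - 1) * \<rho> (a k) * real n \<le> real u * f (ch k)}"
    then have "2 ^ (t - 1) * \<rho> (a k) * real n \<le> real u * f (ch k)" by simp
    also have "real u * f (ch k) \<le> real u * f (ch j)"
      using payers_near(3)[OF j iso k] by (intro mult_left_mono) auto
    finally show "u \<in> {u\<in>{..<n}. ?x \<le> real u}" using pos ak u by (simp add: field_simps)
  qed
  then have "card {u\<in>{..<n}. 2 ^ (t - 1) * \<rho> (a k) * real n \<le> real u * f (ch k)}
      \<le> card {u\<in>{..<n}. ?x \<le> real u}" by (intro card_mono) auto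
  moreover have "?x / real n = 2 ^ (t - 1) * \<rho> (a j) / f (ch j)" using n by simp
  ultimately show ?thesis using card_above_le[of ?x n] pos by simp
qed

text \<open>The coin of \<open>j\<close> is constrained separately by \<open>U\<close> and excluded
  from the payers, so that the two events are independent. Dropping \<open>j\<close> loses a rate of
  at most 1/2 because \<open>2 * \<rho> (a j) \<le> f (ch j)\<close>; rate 1/2 remains, and up to
  time \<open>2 ^ (t - 1)\<close> this gives the exponent \<open>2 ^ t / 4\<close>.\<close>

lemma card_all_late_le:
  assumes j: "j \<in> C" and iso: "isolated j" and f: "2 * \<rho> (a j) \<le> f (ch j)" and pos: "0 < f (ch j)"
    and t: "t \<ge> 1"
  shows "real (card {s\<in>\<Omega>. s j \<in> U \<and> (\<forall>k\<in>payers j - {j}. t \<le> arr s k)})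
    \<le> real (card ({..<n} \<inter> U)) / real n * exp (- (2 ^ t / 4)) * real (card \<Omega>)"
proof -
  let ?P = "payers j - {j}"
  let ?B = "\<lambda>k. if k = j then U else {u. 2 ^ (t - 1) * \<rho> (a k) * real n \<le> real u * f (ch k)}"
  let ?x = "2 ^ (t - 1) * \<rho> (a j) / f (ch j)"
  have sub: "insert j ?P \<subseteq> {..<2 * n}" using C j by (auto simp: payers_def)
  have fin: "finite ?P" by (simp add: payers_def)
  have card_P: "card (insert j ?P) \<le> 2 * n" using card_mono[OF _ sub] by simp
  have ge1: "a k \<ge> 1" if "k \<in> payers j" for k
    using payers_near(1)[OF j iso that] payers_pay(2)[OF j iso pos] by (simp add: near_def)
  have iff: "t \<le> arr s k \<longleftrightarrow> 2 ^ (t - 1) * \<rho> (a k) * real n \<le> real (s k) * f (ch k)" if "k \<in> payers j" for s k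
    using arrival_le_iff[OF ge1[OF that], of s "t - 1"] t by linarith
  have "{s\<in>\<Omega>. s j \<in> U \<and> (\<forall>k\<in>?P. t \<le> arr s k)} = {s\<in>{..<2 * n} \<rightarrow>\<^sub>E {..<n}. \<forall>k\<in>insert j ?P. s k \<in> ?B k}"
    unfolding \<Omega>_def using iff by auto
  then have "real (card {s\<in>\<Omega>. s j \<in> U \<and> (\<forall>k\<in>?P. t \<le> arr s k)}) =
      (\<Prod>k\<in>insert j ?P. real (card ({..<n} \<inter> ?B k))) * real n ^ (2 * n - card (insert j ?P))"
    using card_PiE_box[OF _ sub, of "{..<n}" ?B] by simp
  moreover have "(\<Prod>k\<in>insert j ?P. real (card ({..<n} \<inter> ?B k))) =
      real (card ({..<n} \<inter> U)) * (\<Prod>k\<in>?P. real (card ({..<n} \<inter> ?B k)))"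
    by (subst prod.insert[OF fin]) simp_all
  ultimately have eq: "real (card {s\<in>\<Omega>. s j \<in> U \<and> (\<forall>k\<in>?P. t \<le> arr s k)}) =
      real (card ({..<n} \<inter> U)) * (\<Prod>k\<in>?P. real (card ({..<n} \<inter> ?B k))) * real n ^ (2 * n - card (insert j ?P))"
    by simp
  have "(\<Prod>k\<in>?P. real (card ({..<n} \<inter> ?B k))) \<le> (\<Prod>k\<in>?P. real n * exp (- ?x))"
  proof (intro prod_mono conjI)
    fix k assume k: "k \<in> ?P"
    have "{..<n} \<inter> ?B k = {u\<in>{..<n}. 2 ^ (t - 1) * \<rho> (a k) * real n \<le> real u * f (ch k)}"
      using k by auto
    then show "real (card ({..<n} \<inter> ?B k)) \<le> real n * exp (- ?x)"
      using card_late_le[OF j iso pos t, of k] k by simp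
  qed simp
  also have "\<dots> = real n ^ card ?P * exp (- ?x) ^ card ?P"
    by (simp only: prod_constant power_mult_distrib)
  also have "exp (- ?x) ^ card ?P = exp (real (card ?P) * - ?x)"
    by (rule exp_of_nat_mult[symmetric])
  finally have le1: "(\<Prod>k\<in>?P. real (card ({..<n} \<inter> ?B k))) \<le> real n ^ card ?P * exp (real (card ?P) * - ?x)" .
  have "exp (real (card ?P) * - ?x) \<le> exp (- (2 ^ t / 4))"
  proof (rule iffD2[OF exp_le_cancel_iff])
    have "card (payers j) \<le> Suc (card ?P)"
      by (auto simp: card_Diff_singleton_if)
    then have "real (card (payers j)) - 1 \<le> real (card ?P)" by linarith
    then have "(real (card (payers j)) - 1) * \<rho> (a j) \<le> real (card ?P) * \<rho> (a j)"
      by (rule mult_right_mono) simp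
    then have "f (ch j) / 2 \<le> real (card ?P) * \<rho> (a j)"
      using payers_pay(1)[OF j iso pos] f by (simp add: algebra_simps)
    then have "1 / 2 \<le> real (card ?P) * \<rho> (a j) / f (ch j)"
      using pos by (simp add: field_simps)
    then have "2 ^ (t - 1) * (1 / 2) \<le> 2 ^ (t - 1) * (real (card ?P) * \<rho> (a j) / f (ch j))"
      by (rule mult_left_mono) simp
    moreover have "2 ^ (t - 1) * (1 / 2) = (2::real) ^ t / 4" using t by (cases t) auto
    moreover have "2 ^ (t - 1) * (real (card ?P) * \<rho> (a j) / f (ch j)) = real (card ?P) * ?x" by simp
    ultimately show "real (card ?P) * - ?x \<le> - (2 ^ t / 4)" by linarith
  qed
  then have "real n ^ card ?P * exp (real (card ?P) * - ?x) \<le> real n ^ card ?P * exp (- (2 ^ t / 4))"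
    by (rule mult_left_mono) simp
  with le1 have "(\<Prod>k\<in>?P. real (card ({..<n} \<inter> ?B k))) \<le> real n ^ card ?P * exp (- (2 ^ t / 4))"
    by (rule order_trans)
  then have "real (card {s\<in>\<Omega>. s j \<in> U \<and> (\<forall>k\<in>?P. t \<le> arr s k)}) \<le>
     real (card ({..<n} \<inter> U)) * (real n ^ card ?P * exp (- (2 ^ t / 4))) * real n ^ (2 * n - card (insert j ?P))"
    unfolding eq by (intro mult_right_mono mult_left_mono) simp_all
  also have "\<dots> = real (card ({..<n} \<inter> U)) * exp (- (2 ^ t / 4)) * (real n ^ card ?P * real n ^ (2 * n - card (insert j ?P)))"
    by (simp only: mult_ac)
  also have "real n ^ card ?P * real n ^ (2 * n - card (insert j ?P)) = real n ^ (2 * n - 1)"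
  proof -
    have "card (insert j ?P) = Suc (card ?P)" by (subst card_insert_disjoint[OF fin]) simp_all
    then have "card ?P + (2 * n - card (insert j ?P)) = 2 * n - 1" using card_P by linarith
    then show ?thesis by (simp only: power_add[symmetric])
  qed
  also have "real n ^ (2 * n - 1) = real (card \<Omega>) / real n"
    using n by (simp add: card_Omega power_diff)
  finally show ?thesis by (simp add: mult_ac)
qed

lemma arrival_le_one:
  assumes j: "j \<in> C" and pos: "a j \<ge> 1" and f: "f (ch j) < 2 * \<rho> (a j)" and s: "s \<in> \<Omega>"
  shows "arr s j \<le> 1"
proof -
  have "real (s j) < real n" using s j C by (auto simp: \<Omega>_def)
  then have "real (s j) * f (ch j) \<le> real n * f (ch j)"
    using ch_nonneg[OF j] by (intro mult_right_mono) auto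
  also have "\<dots> < real n * (2 * \<rho> (a j))" using f n by (intro mult_strict_left_mono) auto
  finally show ?thesis using arrival_le_iff[OF pos, of s 1] by (simp add: mult_ac)
qed

text \<open>At most \<open>n\<close> payers share the price, so \<open>f (ch j)\<close> is at most
  \<open>n\<close> radii and even the largest coin arrives by \<open>lg n\<close>. This truncates
  the sums over time in the expectations.\<close>

lemma arrival_le_lg:
  assumes j: "j \<in> C" and iso: "isolated j" and pos: "a j \<ge> 1" and s: "s \<in> \<Omega>"
  shows "arr s j \<le> lg n"
proof (cases "f (ch j) > 0")
  case True
  have "real (card (payers j)) \<le> real n"
    using card_C card_mono[of C "payers j"] by (auto simp: payers_def)
  then have "\<rho> (a j) * real (card (payers j)) \<le> \<rho> (a j) * real n" by (intro mult_left_mono) auto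
  then have fle: "f (ch j) \<le> \<rho> (a j) * real n" using payers_pay(1)[OF j iso True] by simp
  have nle: "real n \<le> 2 ^ lg n"
    using le_two_power_lg[of n] by (metis of_nat_le_iff of_nat_numeral of_nat_power)
  have "real (s j) < real n" using s j C by (auto simp: \<Omega>_def)
  then have "real (s j) * f (ch j) < real n * f (ch j)"
    using True by (intro mult_strict_right_mono) auto
  also have "\<dots> \<le> 2 ^ lg n * (\<rho> (a j) * real n)" using fle nle True by (intro mult_mono) auto
  finally show ?thesis using arrival_le_iff[OF pos, of s "lg n"] by (simp add: mult_ac)
next
  case False
  then have "f (ch j) = 0" using ch_nonneg[OF j] by simp
  then have "arr s j \<le> 0" using arrival_le_iff[OF pos, of s 0] rad_pos[OF n pos, of b] n by simp
  then show ?thesis by simp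
qed

lemma opens_isolated: "j \<in> C \<Longrightarrow> ops s j \<Longrightarrow> isolated j"
  by (auto simp: opens_def isolated_def)

lemma opens_arr_le: "j \<in> C \<Longrightarrow> ops s j \<Longrightarrow> k \<in> near j \<Longrightarrow> arr s j \<le> arr s k"
  by (auto simp: opens_def near_def)

lemma near_self: "j \<in> C \<Longrightarrow> j \<in> near j"
  by (simp add: near_def d_self)

text \<open>A price below two radii is paid without any appeal to chance. Otherwise, opening at
  arrival time \<open>t\<close> means that \<open>j\<close> came by time \<open>t\<close>, with
  probability at most \<open>2 * 2 ^ t * \<rho> (a j) / f (ch j)\<close>, and that no other payer
  came before, which for \<open>t \<ge> 1\<close> has probability at most
  \<open>exp (- (2 ^ t / 4)) \<le> 32 / 4 ^ t\<close>. Times the price this is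
  \<open>64 * \<rho> (a j) / 2 ^ t\<close>; summing over \<open>t \<ge> 1\<close> gives at most 64
  radii, and \<open>t = 0\<close> adds 2.\<close>

lemma expected_opening_cost:
  assumes j: "j \<in> C"
  shows "(\<Sum>s\<in>\<Omega>. if ops s j then f (ch j) else 0) \<le> 66 * \<rho> (a j) * real (card \<Omega>)"
proof -
  consider "a j = 0 \<or> \<not> isolated j" | "f (ch j) < 2 * \<rho> (a j)"
    | "a j \<ge> 1" "isolated j" "2 * \<rho> (a j) \<le> f (ch j)" by linarith
  then show ?thesis
  proof cases
    case 1
    then have "\<not> ops s j" for s using opens_isolated[OF j] by (auto simp: opens_def)
    then show ?thesis by simp
  next
    case 2
    have "(\<Sum>s\<in>\<Omega>. if ops s j then f (ch j) else 0) \<le> (\<Sum>s\<in>\<Omega>. 66 * \<rho> (a j))"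
      using 2 ch_nonneg[OF j] rad_nonneg[of n b "a j"] by (intro sum_mono) auto
    then show ?thesis by (simp add: mult_ac)
  next
    case 3
    have pos: "f (ch j) > 0" using 3 rad_pos[OF n 3(1), of b] by simp
    let ?r = "\<rho> (a j)" and ?f = "f (ch j)" and ?T = "lg n"
    let ?E = "\<lambda>t. {s\<in>\<Omega>. arr s j \<le> t \<and> (\<forall>k\<in>payers j - {j}. t \<le> arr s k)}"
    let ?U = "\<lambda>t. {u. real u < 2 ^ t * ?r * real n / ?f}"
    have "real (card (payers j)) \<le> real n"
      using card_C card_mono[of C "payers j"] by (auto simp: payers_def)
    then have "?r * real (card (payers j)) \<le> ?r * real n" by (intro mult_left_mono) auto
    then have fle: "?f \<le> ?r * real n" using payers_pay(1)[OF j 3(2) pos] by simp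
    have U: "arr s j \<le> t \<longleftrightarrow> s j \<in> ?U t" for s t
      using arrival_le_iff[OF 3(1), of s t] pos by (simp add: field_simps)
    have card_U: "real (card ({..<n} \<inter> ?U t)) / real n \<le> 2 * 2 ^ t * ?r / ?f" for t
    proof -
      have "real (card ({..<n} \<inter> ?U t)) \<le> 2 ^ t * ?r * real n / ?f + 1"
        using card_below_le[of "2 ^ t * ?r * real n / ?f" n] pos by (simp add: Int_def)
      \<comment> \<open>This absorbs the rounding error 1 of \<open>card_below_le\<close> into the
        factor 2; it holds because \<open>f (ch j)\<close> is at most \<open>n\<close>
        radii.\<close>
      moreover have "1 \<le> 2 ^ t * ?r * real n / ?f"
      proof -
        have "?r * real n \<le> 2 ^ t * (?r * real n)"
          using mult_right_mono[of 1 "2 ^ t" "?r * real n"] by simp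
        then show ?thesis using fle pos by (simp add: field_simps)
      qed
      ultimately have "real (card ({..<n} \<inter> ?U t)) \<le> 2 * (2 ^ t * ?r * real n / ?f)" by simp
      then show ?thesis using n pos by (simp add: field_simps)
    qed
    have E0: "?f * real (card (?E 0)) \<le> 2 * ?r * real (card \<Omega>)"
    proof -
      have "real (card (?E 0)) = real (card {s\<in>{..<2*n} \<rightarrow>\<^sub>E {..<n}. \<forall>k\<in>{j}. s k \<in> ?U 0})"
        unfolding \<Omega>_def using U[of _ 0] by (intro arg_cong[where f = "\<lambda>X. real (card X)"]) auto
      also have "\<dots> = real (card ({..<n} \<inter> ?U 0)) * real n ^ (2 * n - 1)"
        using j C by (subst card_PiE_box) auto
      also have "\<dots> = real (card ({..<n} \<inter> ?U 0)) / real n * real (card \<Omega>)"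
        using n by (simp add: card_Omega power_diff)
      also have "\<dots> \<le> 2 * 2 ^ 0 * ?r / ?f * real (card \<Omega>)"
        by (intro mult_right_mono card_U) auto
      finally show ?thesis using pos by (simp add: field_simps)
    qed
    have Et: "?f * real (card (?E t)) \<le> 64 * ?r * real (card \<Omega>) * (1 / 2 ^ t)" if t: "t \<ge> 1" for t
    proof -
      have "real (card (?E t)) \<le> real (card ({..<n} \<inter> ?U t)) / real n * exp (- (2 ^ t / 4)) * real (card \<Omega>)"
        using card_all_late_le[OF j 3(2,3) pos t, of "?U t"] U by simp
      also have "\<dots> \<le> (2 * 2 ^ t * ?r / ?f) * (2 / (2 ^ t / 4)\<^sup>2) * real (card \<Omega>)"
        using pos by (intro mult_right_mono mult_mono card_U exp_minus_le_inverse_square) auto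
      also have "\<dots> = 64 * ?r * real (card \<Omega>) * (1 / 2 ^ t) / ?f"
        using pos by (simp add: power2_eq_square field_simps)
      finally show ?thesis using pos by (simp add: field_simps)
    qed
    have "(\<Sum>s\<in>\<Omega>. if ops s j then ?f else 0) \<le> (\<Sum>s\<in>\<Omega>. \<Sum>t\<le>?T. if s \<in> ?E t then ?f else 0)"
    proof (intro sum_mono)
      fix s assume s: "s \<in> \<Omega>"
      show "(if ops s j then ?f else 0) \<le> (\<Sum>t\<le>?T. if s \<in> ?E t then ?f else 0)"
      proof (cases "ops s j")
        case True
        have "s \<in> ?E (arr s j)"
          using s opens_arr_le[OF j True] payers_near(1)[OF j 3(2)] by auto
        moreover have "arr s j \<in> {..?T}" using arrival_le_lg[OF j 3(2,1) s] by simp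
        ultimately have "(if s \<in> ?E (arr s j) then ?f else 0) \<le> (\<Sum>t\<le>?T. if s \<in> ?E t then ?f else 0)"
          using pos by (intro member_le_sum) auto
        then show ?thesis using True \<open>s \<in> ?E (arr s j)\<close> by auto
      qed (use pos in \<open>auto intro!: sum_nonneg\<close>)
    qed
    also have "\<dots> = (\<Sum>t\<le>?T. \<Sum>s\<in>\<Omega>. if s \<in> ?E t then ?f else 0)" by (rule sum.swap)
    also have "\<dots> = (\<Sum>t\<le>?T. ?f * real (card (?E t)))"
    proof (intro sum.cong refl)
      fix t
      have "(\<Sum>s\<in>\<Omega>. if s \<in> ?E t then ?f else 0) = (\<Sum>s\<in>\<Omega> \<inter> ?E t. ?f)"
        by (rule sum.inter_restrict[symmetric]) simp
      also have "\<Omega> \<inter> ?E t = ?E t" by auto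
      finally show "(\<Sum>s\<in>\<Omega>. if s \<in> ?E t then ?f else 0) = ?f * real (card (?E t))" by simp
    qed
    also have "\<dots> = ?f * real (card (?E 0)) + (\<Sum>t=1..?T. ?f * real (card (?E t)))"
      by (simp only: atMost_atLeast0 sum.atLeast_Suc_atMost[of 0 ?T] le0 One_nat_def)
    also have "\<dots> \<le> 2 * ?r * real (card \<Omega>) + (\<Sum>t=1..?T. 64 * ?r * real (card \<Omega>) * (1 / 2 ^ t))"
      by (intro add_mono E0 sum_mono Et) auto
    also have "(\<Sum>t=1..?T. 64 * ?r * real (card \<Omega>) * (1 / 2 ^ t)) \<le> 64 * ?r * real (card \<Omega>) * 1"
      unfolding sum_distrib_left[symmetric] by (intro mult_left_mono two_div_power_sum) auto
    finally show ?thesis by (simp add: algebra_simps)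
  qed
qed

end

section \<open>The expected distance to the nearest open facility\<close>

definition nearest :: "(nat \<Rightarrow> real) \<Rightarrow> nat set \<Rightarrow> nat" where
  "nearest r X = arg_min_on r X"

context facility_guess
begin

definition "x s j = nearest (d j) (Y s (a j))"
definition "lower j = {k\<in>C. a k < a j}"

lemma finite_lower [simp, intro]: "finite (lower j)"
  by (simp add: lower_def)

lemma opened_mono: "e \<le> e' \<Longrightarrow> Y s e \<subseteq> Y s e'"
  by (auto simp: opened_def)

lemma opened_subset: "Y s e \<subseteq> A"
  using ch_props(1) by (auto simp: opened_def)

lemma finite_opened [simp, intro]: "finite (Y s e)"
  using opened_subset finite_A finite_subset by blast

text \<open>A client that does not open sees, within two radii, a client of lower level or one of
  the same level with a strictly earlier arrival. Arrival times are natural numbers, so at most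
  \<open>arr s j\<close> moves of length \<open>2 * \<rho> (a j)\<close> stay on the level; the
  additional 1 pays for the move that leaves it.\<close>

lemma arrival_chain:
  assumes "j \<in> C" and "a j \<ge> 1"
  shows "(\<exists>k\<in>C. ops s k \<and> a k = a j \<and> d j k \<le> 2 * \<rho> (a j) * real (arr s j)) \<or>
         (\<exists>k\<in>lower j. d j k \<le> 2 * \<rho> (a j) * (real (arr s j) + 1))"
  using assms
proof (induction "arr s j" arbitrary: j rule: less_induct)
  case less
  show ?case
  proof (cases "ops s j")
    case True
    have "0 \<le> 2 * \<rho> (a j) * real (arr s j)" by (intro mult_nonneg_nonneg) auto
    then have "d j j \<le> 2 * \<rho> (a j) * real (arr s j)" using d_self[of j] less.prems by simp
    then show ?thesis using True less.prems by blast
  next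
    case False
    then obtain k where k: "k \<in> C" "d j k \<le> 2 * \<rho> (a j)"
        "\<not> (a j < a k \<or> a j = a k \<and> arr s j \<le> arr s k)"
      using less.prems by (auto simp: opens_def)
    show ?thesis
    proof (cases "a k < a j")
      case True
      have "2 * \<rho> (a j) * 1 \<le> 2 * \<rho> (a j) * (real (arr s j) + 1)"
        by (rule mult_left_mono) auto
      then show ?thesis using True k by (auto simp: lower_def intro!: bexI[of _ k])
    next
      case False
      then have ak: "a k = a j" and lt: "arr s k < arr s j" using k by auto
      have tri: "d j l \<le> 2 * \<rho> (a j) + d k l" if "l \<in> C" for l
        using d_triangle[of j k l] k less.prems that by auto
      have le: "2 * \<rho> (a j) + 2 * \<rho> (a j) * y \<le> 2 * \<rho> (a j) * y'" if "y + 1 \<le> y'" for y y'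
        using mult_left_mono[OF that, of "2 * \<rho> (a j)"] by (simp add: algebra_simps)
      have step: "real (arr s k) + 1 \<le> real (arr s j)" using lt by simp
      have lower: "lower k = lower j" using ak by (simp add: lower_def)
      from less.hyps[OF lt k(1)] ak less.prems
      consider l where "l \<in> C" "ops s l" "a l = a j" "d k l \<le> 2 * \<rho> (a j) * real (arr s k)"
        | l where "l \<in> lower j" "d k l \<le> 2 * \<rho> (a j) * (real (arr s k) + 1)"
        using lower by auto
      then show ?thesis
      proof cases
        case 1
        have "d j l \<le> 2 * \<rho> (a j) * real (arr s j)"
          using tri[OF 1(1)] 1(4) le[OF step] by linarith
        then show ?thesis using 1 by blast
      next
        case 2
        have "d j l \<le> 2 * \<rho> (a j) * (real (arr s j) + 1)"
          using tri[of l] 2 le[of "real (arr s k) + 1" "real (arr s j) + 1"] step by (auto simp: lower_def)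
        then show ?thesis using 2 by blast
      qed
    qed
  qed
qed

text \<open>The arrival of \<open>j\<close> itself may be as late as \<open>lg n\<close>, so the
  walk first moves to the earliest arrival nearby, at distance two radii, and continues from there.
  With delay \<open>t\<close>, ending at an opening client costs \<open>2 + 2 * t + 1\<close> radii,
  the last one for reaching its facility; leaving the level costs \<open>2 + 2 * (t + 1)\<close>,
  whence the 4.\<close>

lemma cover_step:
  assumes j: "j \<in> C" and pos: "a j \<ge> 1"
  shows "(\<exists>i\<in>Y s (a j). d j i \<le> \<rho> (a j) * (2 * real (delay s j) + 4)) \<or>
         (\<exists>k\<in>lower j. d j k \<le> \<rho> (a j) * (2 * real (delay s j) + 4))"
proof (cases "isolated j")
  case False
  then obtain k where k: "k \<in> C" "d j k \<le> 2 * \<rho> (a j)" "a k < a j"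
    by (auto simp: isolated_def not_le)
  have "2 * \<rho> (a j) \<le> \<rho> (a j) * (2 * real (delay s j) + 4)"
    using mult_left_mono[of 2 "2 * real (delay s j) + 4" "\<rho> (a j)"] by simp
  then show ?thesis using k by (auto simp: lower_def intro!: bexI[of _ k])
next
  case True
  have "first_arr s j \<in> arr s ` near j"
    unfolding first_arr_def using near_self[OF j] by (intro Min_in) auto
  then obtain k where k: "k \<in> near j" "arr s k = delay s j"
    using True by (auto simp: delay_def)
  have kC: "k \<in> C" and ak: "a k = a j" and djk: "d j k \<le> 2 * \<rho> (a j)"
    using k(1) by (auto simp: near_def)
  let ?t = "real (delay s j)"
  have lower: "lower k = lower j" using ak by (simp add: lower_def)
  from arrival_chain[OF kC, of s] ak pos k(2)
  consider l where "l \<in> C" "ops s l" "a l = a j" "d k l \<le> 2 * \<rho> (a j) * ?t"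
    | l where "l \<in> lower j" "d k l \<le> 2 * \<rho> (a j) * (?t + 1)"
    using lower by auto
  then show ?thesis
  proof cases
    case 1
    have "ch l \<in> Y s (a j)" using 1 by (auto simp: opened_def)
    have "d j (ch l) \<le> d j l + d l (ch l)" using d_triangle[of j l "ch l"] j 1 ch_F by blast
    also have "d j l \<le> d j k + d k l" using d_triangle[of j k l] j kC 1 by blast
    finally have "d j (ch l) \<le> \<rho> (a j) * (2 * ?t + 3)"
      using ch_props(2)[OF 1(1)] 1 djk by (simp add: algebra_simps)
    also have "\<dots> \<le> \<rho> (a j) * (2 * ?t + 4)" by (intro mult_left_mono) auto
    finally show ?thesis using \<open>ch l \<in> Y s (a j)\<close> by blast
  next
    case 2
    have "d j l \<le> d j k + d k l" using d_triangle[of j k l] j kC 2 by (auto simp: lower_def)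
    then have "d j l \<le> \<rho> (a j) * (2 * ?t + 4)" using 2 djk by (simp add: algebra_simps)
    then show ?thesis using 2 by blast
  qed
qed

lemma x_props:
  assumes "Y s (a j) \<noteq> {}"
  shows "x s j \<in> Y s (a j)" and "i \<in> Y s (a j) \<Longrightarrow> d j (x s j) \<le> d j i"
  unfolding x_def nearest_def
  using arg_min_if_finite(1)[OF finite_opened assms] arg_min_least[OF finite_opened assms] by auto

lemma cover_base:
  assumes j: "j \<in> C" and "a j = 0"
  shows "Y s (a j) \<noteq> {}" and "d j (x s j) = 0"
proof -
  obtain i where i: "i \<in> A" "d j i \<le> 0" "lev i = 0" using a_attained[OF j] assms by auto
  have iF: "i \<in> F" using i A by blast
  have "f i = 0" using lev_ripe[OF iF] i f_nonneg[OF iF] by simp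
  then have iY: "i \<in> Y s (a j)" using i by (simp add: opened_def)
  then show ne: "Y s (a j) \<noteq> {}" by blast
  have "x s j \<in> F" using x_props(1)[OF ne] opened_subset A by blast
  then show "d j (x s j) = 0" using x_props(2)[OF ne iY] i d_nonneg[of j "x s j"] j by simp
qed

definition "nearest_lower j = nearest (d j) (lower j)"

lemma nearest_lower_props:
  assumes "lower j \<noteq> {}"
  shows "nearest_lower j \<in> lower j" and "k \<in> lower j \<Longrightarrow> d j (nearest_lower j) \<le> d j k"
  unfolding nearest_lower_def nearest_def
  using arg_min_if_finite(1)[OF finite_lower assms] arg_min_least[OF finite_lower assms] by auto

lemma opened_nonempty: "j \<in> C \<Longrightarrow> Y s (a j) \<noteq> {}"
proof (induction "a j" arbitrary: j rule: less_induct)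
  case less
  show ?case
  proof (cases "a j = 0")
    case True then show ?thesis using cover_base(1) less by blast
  next
    case False
    then consider i where "i \<in> Y s (a j)" | k where "k \<in> lower j"
      using cover_step[OF less.prems, of s] by auto
    then show ?thesis
    proof cases
      case 2
      then have "Y s (a k) \<noteq> {}" "Y s (a k) \<subseteq> Y s (a j)"
        using less.hyps opened_mono by (auto simp: lower_def)
      then show ?thesis by blast
    qed blast
  qed
qed

lemma x_in: "j \<in> C \<Longrightarrow> x s j \<in> Y s (a j)" and x_F: "j \<in> C \<Longrightarrow> x s j \<in> F"
  and x_nearest: "j \<in> C \<Longrightarrow> i \<in> Y s (a j) \<Longrightarrow> d j (x s j) \<le> d j i"
  using x_props[OF opened_nonempty] opened_subset A by blast+

text \<open>Following the nearest client of a lower level, which does not depend on the coins, makes the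
  bound linear in the delays, so that it can be averaged term by term.\<close>

lemma dist_x_le:
  assumes j: "j \<in> C" and pos: "a j \<ge> 1"
  shows "d j (x s j) \<le> \<rho> (a j) * (2 * real (delay s j) + 4) +
    (if lower j = {} then 0 else d (nearest_lower j) (x s (nearest_lower j)))"
proof -
  let ?k = "nearest_lower j"
  have nn: "lower j \<noteq> {} \<Longrightarrow> 0 \<le> d ?k (x s ?k)"
    using nearest_lower_props(1)[of j] x_F[of ?k s] d_nonneg by (auto simp: lower_def)
  from cover_step[OF j pos, of s] show ?thesis
  proof
    assume "\<exists>i\<in>Y s (a j). d j i \<le> \<rho> (a j) * (2 * real (delay s j) + 4)"
    then have "d j (x s j) \<le> \<rho> (a j) * (2 * real (delay s j) + 4)"
      using x_nearest[OF j] by (meson order_trans)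
    then show ?thesis using add_mono[OF _ nn, of "d j (x s j)"] by (cases "lower j = {}") simp_all
  next
    assume "\<exists>k\<in>lower j. d j k \<le> \<rho> (a j) * (2 * real (delay s j) + 4)"
    then obtain k where k: "k \<in> lower j" "d j k \<le> \<rho> (a j) * (2 * real (delay s j) + 4)" by blast
    then have ne: "lower j \<noteq> {}" by blast
    have le: "d j ?k \<le> \<rho> (a j) * (2 * real (delay s j) + 4)"
      using nearest_lower_props(2)[OF ne k(1)] k(2) by (rule order_trans)
    have kC: "?k \<in> C" and ak: "a ?k \<le> a j" using nearest_lower_props(1)[OF ne] by (auto simp: lower_def)
    have "d j (x s j) \<le> d j (x s ?k)"
      using x_nearest[OF j] x_in[OF kC] opened_mono[OF ak] by blast
    also have "\<dots> \<le> d j ?k + d ?k (x s ?k)" using d_triangle j kC x_F[OF kC] by blast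
    finally show ?thesis using ne le by simp
  qed
qed

text \<open>The expectation is the sum of its tail probabilities. A delay of at least
  \<open>t\<close> means that no payer other than \<open>j\<close> arrives before \<open>t\<close>,
  which has probability at most \<open>exp (- (2 ^ t / 4)) \<le> 4 / 2 ^ t\<close>.\<close>

lemma expected_delay:
  assumes j: "j \<in> C" and pos: "a j \<ge> 1"
  shows "(\<Sum>s\<in>\<Omega>. real (delay s j)) \<le> 4 * real (card \<Omega>)"
proof -
  have delay_le: "delay s j \<le> arr s j" for s
    using near_self[OF j] by (auto simp: delay_def first_arr_def)
  consider "\<not> isolated j" | "f (ch j) < 2 * \<rho> (a j)" | "isolated j" "2 * \<rho> (a j) \<le> f (ch j)" by linarith
  then show ?thesis
  proof cases
    case 1
    then show ?thesis by (simp add: delay_def)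
  next
    case 2
    have "real (delay s j) \<le> 4" if "s \<in> \<Omega>" for s
      using delay_le[of s] arrival_le_one[OF j pos 2 that] by simp
    then have "(\<Sum>s\<in>\<Omega>. real (delay s j)) \<le> (\<Sum>s\<in>\<Omega>. 4)" by (intro sum_mono) auto
    then show ?thesis by simp
  next
    case 3
    have fpos: "0 < f (ch j)" using 3 rad_pos[OF n pos, of b] by simp
    have "(\<Sum>s\<in>\<Omega>. real (delay s j)) = (\<Sum>s\<in>\<Omega>. \<Sum>t=1..lg n. if t \<le> delay s j then 1 else 0)"
    proof (intro sum.cong refl)
      fix s assume "s \<in> \<Omega>"
      then have "delay s j \<le> lg n" using delay_le[of s] arrival_le_lg[OF j 3(1) pos] by (meson order_trans)
      then have "{t\<in>{1..lg n}. t \<le> delay s j} = {1..delay s j}" by auto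
      then show "real (delay s j) = (\<Sum>t=1..lg n. if t \<le> delay s j then 1 else 0)"
        using sum_indicator_eq_card[of "{1..lg n}" "\<lambda>t. t \<le> delay s j"] by simp
    qed
    also have "\<dots> = (\<Sum>t=1..lg n. real (card {s\<in>\<Omega>. t \<le> delay s j}))"
      by (subst sum.swap) (simp only: sum_indicator_eq_card[OF finite_Omega])
    also have "\<dots> \<le> (\<Sum>t=1..lg n. 4 * real (card \<Omega>) * (1 / 2 ^ t))"
    proof (intro sum_mono)
      fix t assume t: "t \<in> {1..lg n}"
      have "{s\<in>\<Omega>. t \<le> delay s j} \<subseteq> {s\<in>\<Omega>. s j \<in> UNIV \<and> (\<forall>k\<in>payers j - {j}. t \<le> arr s k)}"
      proof (intro Collect_mono impI conjI ballI; elim conjE)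
        fix s k assume t: "t \<le> delay s j" and k: "k \<in> payers j - {j}"
        have "first_arr s j \<le> arr s k"
          unfolding first_arr_def using payers_near(1)[OF j 3(1)] k by (intro Min_le) auto
        then show "t \<le> arr s k" using t 3(1) by (simp add: delay_def)
      qed auto
      then have "real (card {s\<in>\<Omega>. t \<le> delay s j})
          \<le> real (card {s\<in>\<Omega>. s j \<in> UNIV \<and> (\<forall>k\<in>payers j - {j}. t \<le> arr s k)})"
        by (intro iffD2[OF of_nat_le_iff] card_mono) auto
      also have "\<dots> \<le> real (card ({..<n} \<inter> UNIV)) / real n * exp (- (2 ^ t / 4)) * real (card \<Omega>)"
        using card_all_late_le[OF j 3 fpos, of t UNIV] t by simp
      also have "\<dots> = exp (- (2 ^ t / 4)) * real (card \<Omega>)" using n by simp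
      also have "\<dots> \<le> (1 / (2 ^ t / 4)) * real (card \<Omega>)"
        by (intro mult_right_mono exp_minus_le_inverse) auto
      finally show "real (card {s\<in>\<Omega>. t \<le> delay s j}) \<le> 4 * real (card \<Omega>) * (1 / 2 ^ t)"
        by (simp add: mult_ac)
    qed
    also have "\<dots> \<le> 4 * real (card \<Omega>) * 1"
      unfolding sum_distrib_left[symmetric] by (intro mult_left_mono two_div_power_sum) auto
    finally show ?thesis by simp
  qed
qed

text \<open>The constant solves \<open>c = 2 * 4 + 4 + c / 2\<close>: the expected delay is at most
  4, and a client of lower level has at most half the radius, so by induction its share enters with
  half the constant.\<close>

lemma expected_dist:
  "j \<in> C \<Longrightarrow> (\<Sum>s\<in>\<Omega>. d j (x s j)) \<le> 24 * \<rho> (a j) * real (card \<Omega>)"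
proof (induction "a j" arbitrary: j rule: less_induct)
  case less
  show ?case
  proof (cases "a j = 0")
    case True
    then show ?thesis using cover_base(2)[OF less.prems] by simp
  next
    case False
    then have pos: "a j \<ge> 1" by simp
    let ?r = "\<rho> (a j)" and ?k = "nearest_lower j"
    define g where "g s = (if lower j = {} then 0 else d ?k (x s ?k))" for s
    have g: "(\<Sum>s\<in>\<Omega>. g s) \<le> 12 * ?r * real (card \<Omega>)"
    proof (cases "lower j = {}")
      case True
      then show ?thesis by (simp add: g_def)
    next
      case ne: False
      have k: "?k \<in> C" "a ?k < a j" using nearest_lower_props(1)[OF ne] by (auto simp: lower_def)
      have "(\<Sum>s\<in>\<Omega>. g s) \<le> 24 * \<rho> (a ?k) * real (card \<Omega>)" using less.hyps[OF k(2,1)] ne by (simp add: g_def)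
      also have "\<dots> \<le> 12 * ?r * real (card \<Omega>)"
        using two_rad_le[OF k(2), of n b] by (intro mult_right_mono) auto
      finally show ?thesis .
    qed
    have arith: "(2 * r) * (4 * c) + 4 * r * c + 12 * r * c = 24 * r * c" for r c :: real by algebra
    let ?S = "\<Sum>s\<in>\<Omega>. real (delay s j)" and ?c = "real (card \<Omega>)"
    have "(\<Sum>s\<in>\<Omega>. d j (x s j)) \<le> (\<Sum>s\<in>\<Omega>. (2 * ?r) * real (delay s j) + 4 * ?r + g s)"
    proof (rule sum_mono)
      fix s
      show "d j (x s j) \<le> (2 * ?r) * real (delay s j) + 4 * ?r + g s"
        using dist_x_le[OF less.prems pos, of s] by (simp add: g_def algebra_simps)
    qed
    also have "\<dots> = (2 * ?r) * ?S + 4 * ?r * ?c + (\<Sum>s\<in>\<Omega>. g s)"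
      by (simp only: sum.distrib sum_distrib_left[symmetric] sum_constant mult_ac)
    also have "\<dots> \<le> (2 * ?r) * (4 * ?c) + 4 * ?r * ?c + 12 * ?r * ?c"
      by (rule add_mono[OF add_right_mono[OF mult_left_mono[OF expected_delay[OF less.prems pos]]] g]) simp
    also have "\<dots> = 24 * ?r * ?c" by (rule arith)
    finally show ?thesis .
  qed
qed

end

section \<open>Serving the required number of clients\<close>

text \<open>The greedy fractional solution of the knapsack problem is no worse than a uniformly scaled
  one; it rounds down all but one item.\<close>

lemma fractional_knapsack:
  fixes c :: "'a \<Rightarrow> real" and k :: "'a \<Rightarrow> nat"
  assumes "finite X" and "\<And>x. x \<in> X \<Longrightarrow> 0 < k x" and "0 < q" and "q \<le> (\<Sum>x\<in>X. k x)"
  shows "\<exists>Z z. Z \<subseteq> X \<and> z \<in> X - Z \<and> (\<Sum>x\<in>Z. k x) < q \<and> q \<le> (\<Sum>x\<in>Z. k x) + k z \<and>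
    (\<Sum>x\<in>Z. c x) + c z * real (q - (\<Sum>x\<in>Z. k x)) / real (k z)
      \<le> real q * (\<Sum>x\<in>X. c x) / real (\<Sum>x\<in>X. k x)"
  using assms
proof (induction "card X" arbitrary: X)
  case 0
  then show ?case by simp
next
  case (Suc m)
  let ?K = "\<lambda>X. \<Sum>x\<in>X. k x" and ?c = "\<lambda>X. \<Sum>x\<in>X. c x"
  have ne: "X \<noteq> {}" using Suc.hyps(2) by auto
  \<comment> \<open>The largest cost per unit, written as a minimum of negatives: discarding this
    item does not raise the average cost. If the rest still reaches \<open>q\<close>, the induction
    hypothesis applies; otherwise this is the item cut by the fraction.\<close>
  define z where "z = arg_min_on (\<lambda>x. - (c x / real (k x))) X"
  have z: "z \<in> X"
    unfolding z_def by (rule arg_min_if_finite(1)[OF Suc.prems(1) ne])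
  have worst: "c x / real (k x) \<le> c z / real (k z)" if "x \<in> X" for x
    using arg_min_least[OF Suc.prems(1) ne that, of "\<lambda>x. - (c x / real (k x))"]
    unfolding z_def[symmetric] by simp
  let ?Z = "X - {z}"
  have kz: "0 < k z" using Suc.prems(2)[OF z] .
  have KX: "?K X = ?K ?Z + k z" and cX: "?c X = ?c ?Z + c z"
    using sum.remove[OF Suc.prems(1) z] by (simp_all add: add.commute)
  have Kpos: "0 < ?K X" using KX kz by simp
  have "?c X \<le> (\<Sum>x\<in>X. c z / real (k z) * real (k x))"
  proof (intro sum_mono)
    fix x assume x: "x \<in> X"
    show "c x \<le> c z / real (k z) * real (k x)"
      using worst[OF x] Suc.prems(2)[OF x] by (simp add: divide_le_eq)
  qed
  also have "\<dots> = c z / real (k z) * real (?K X)" by (simp add: sum_distrib_left)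
  finally have avg: "?c X / real (?K X) \<le> c z / real (k z)"
    using Kpos by (subst pos_divide_le_eq) (simp_all only: of_nat_0_less_iff)
  define K KZ cX cZ where "K = ?K X" and "KZ = ?K ?Z" and "cX = ?c X" and "cZ = ?c ?Z"
  note names = K_def KZ_def cX_def cZ_def
  have K: "K = KZ + k z" and c: "cX = cZ + c z" and K0: "0 < K" and qK: "q \<le> K"
    and ratio: "cX * real (k z) \<le> c z * real K"
    using KX cX Kpos Suc.prems(4) avg kz unfolding names[symmetric] by (simp_all add: field_simps)
  show ?case unfolding names[symmetric]
  proof (cases "q \<le> KZ")
    case True
    have "\<exists>Z z. Z \<subseteq> ?Z \<and> z \<in> ?Z - Z \<and> ?K Z < q \<and> q \<le> ?K Z + k z \<and>
        ?c Z + c z * real (q - ?K Z) / real (k z) \<le> real q * ?c ?Z / real (?K ?Z)"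
      by (rule Suc.hyps(1)) (use Suc.prems True Suc.hyps(2) z in \<open>auto simp: KZ_def\<close>)
    then obtain Z z' where Z: "Z \<subseteq> ?Z" "z' \<in> ?Z - Z" "?K Z < q" "q \<le> ?K Z + k z'"
        and le: "?c Z + c z' * real (q - ?K Z) / real (k z') \<le> real q * cZ / real KZ"
      unfolding names by blast
    have "real q * cZ / real KZ \<le> real q * cX / real K"
    proof -
      have KZ: "0 < real KZ" using True Suc.prems(3) by linarith
      have "cZ * real K \<le> cX * real KZ"
        using ratio K c by (simp add: algebra_simps)
      then have "cZ / real KZ \<le> cX / real K"
        using KZ K0 by (simp add: field_simps)
      then have "real q * (cZ / real KZ) \<le> real q * (cX / real K)"
        by (intro mult_left_mono) auto
      then show ?thesis by simp
    qed
    with le have "?c Z + c z' * real (q - ?K Z) / real (k z') \<le> real q * cX / real K"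
      by (rule order_trans)
    then show "\<exists>Z z. Z \<subseteq> X \<and> z \<in> X - Z \<and> ?K Z < q \<and> q \<le> ?K Z + k z \<and>
        ?c Z + c z * real (q - ?K Z) / real (k z) \<le> real q * cX / real K"
      using Z by (intro exI[of _ Z] exI[of _ z']) auto
  next
    case False
    have "cZ + c z * real (q - KZ) / real (k z) = cX - c z / real (k z) * real (K - q)"
    proof -
      have eq: "real (q - KZ) = real (k z) - real (K - q)"
        using K False qK by (simp add: of_nat_diff)
      show ?thesis unfolding eq using c kz by (simp add: field_simps)
    qed
    also have "\<dots> \<le> cX - cX / real K * real (K - q)"
      using avg unfolding names by (intro diff_left_mono mult_right_mono) auto
    also have "\<dots> = real q * cX / real K"
      using qK K0 by (simp add: of_nat_diff field_simps)
    finally have "?c ?Z + c z * real (q - ?K ?Z) / real (k z) \<le> real q * cX / real K"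
      unfolding KZ_def cZ_def .
    moreover have "?K ?Z < q" "q \<le> ?K ?Z + k z" using False qK K by (simp_all add: KZ_def)
    ultimately show "\<exists>Z z. Z \<subseteq> X \<and> z \<in> X - Z \<and> ?K Z < q \<and> q \<le> ?K Z + k z \<and>
        ?c Z + c z * real (q - ?K Z) / real (k z) \<le> real q * cX / real K"
      using z by (intro exI[of _ ?Z] exI[of _ z] conjI) auto
  qed
qed

text \<open>With unit weights the cut item is taken whole, as exactly one unit is missing.\<close>

lemma cheap_subset:
  fixes h :: "'a \<Rightarrow> real"
  assumes "finite D" and "r \<le> card D"
  shows "\<exists>D'. D' \<subseteq> D \<and> card D' = r \<and> (\<Sum>j\<in>D'. h j) \<le> real r * (\<Sum>j\<in>D. h j) / real (card D)"
proof (cases "r = 0")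
  case True
  then show ?thesis by (intro exI[of _ "{}"]) auto
next
  case False
  then obtain Z z where Z: "Z \<subseteq> D" "z \<in> D - Z" "card Z < r" "r \<le> card Z + 1"
      "(\<Sum>x\<in>Z. h x) + h z * real (r - card Z) \<le> real r * (\<Sum>x\<in>D. h x) / real (card D)"
    using fractional_knapsack[of D "\<lambda>_. 1" r h] assms by auto
  have fin: "finite Z" using Z assms finite_subset by blast
  have "r - card Z = 1" using Z by simp
  then show ?thesis using Z fin by (intro exI[of _ "insert z Z"]) (auto simp: add.commute)
qed

text \<open>For \<open>p \<ge> 1\<close>, the level of the \<open>p\<close>-th client when clients
  are sorted by level.\<close>

definition threshold :: "nat set \<Rightarrow> (nat \<Rightarrow> nat) \<Rightarrow> nat \<Rightarrow> nat" where
  "threshold C a p = (LEAST e. p \<le> card {j\<in>C. a j \<le> e})"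

text \<open>The sum of the \<open>p\<close> smallest client radii.\<close>

definition radii_sum :: "nat \<Rightarrow> nat \<Rightarrow> nat set \<Rightarrow> (nat \<Rightarrow> nat) \<Rightarrow> nat \<Rightarrow> real" where
  "radii_sum n b C a p =
     (\<Sum>j\<in>{j\<in>C. a j < threshold C a p}. rad n b (a j)) +
     real (p - card {j\<in>C. a j < threshold C a p}) * rad n b (threshold C a p)"

text \<open>Every client \<open>j\<close> offers to be served by \<open>x j\<close> at distance \<open>\<delta> j\<close>.\<close>

definition star_solution ::
  "nat set \<Rightarrow> nat set \<Rightarrow> nat \<Rightarrow> (nat \<Rightarrow> real) \<Rightarrow> (nat \<Rightarrow> nat) \<Rightarrow> (nat \<Rightarrow> real) \<Rightarrow> real \<Rightarrow> nat set \<Rightarrow> nat set \<Rightarrow> bool"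
where
  "star_solution F C p f x \<delta> K C' F' \<longleftrightarrow> F' \<subseteq> F \<and> C' \<subseteq> C \<and> p \<le> card C' \<and> x ` C' \<subseteq> F' \<and>
     (\<Sum>i\<in>F'. f i) + (\<Sum>j\<in>C'. \<delta> j) \<le> K"

text \<open>Markov's inequality for the uniform distribution. The bound \<open>c\<close> on the mean
  may be 0, where nothing can be cancelled and \<open>g\<close> vanishes identically
  instead.\<close>

lemma markov_card:
  fixes g :: "'a \<Rightarrow> real"
  assumes fin: "finite X" and nn: "\<And>s. s \<in> X \<Longrightarrow> 0 \<le> g s" and le: "(\<Sum>s\<in>X. g s) \<le> c * real (card X)"
  shows "2 * card {s\<in>X. 2 * c < g s} \<le> card X"
proof -
  let ?B = "{s\<in>X. 2 * c < g s}"
  have "(\<Sum>s\<in>?B. g s) \<le> (\<Sum>s\<in>X. g s)" using fin nn by (intro sum_mono2) auto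
  then have le': "(\<Sum>s\<in>?B. g s) \<le> c * real (card X)" using le by linarith
  show ?thesis
  proof (cases "X = {}")
    case True
    then have "?B = {}" by blast
    then show ?thesis by (simp only: card.empty)
  next
    case False
    have "0 \<le> c * real (card X)" using sum_nonneg[of X g] nn le by force
    moreover have "0 < real (card X)" using False fin by (simp add: card_gt_0_iff)
    ultimately have c: "0 \<le> c" by (simp add: zero_le_mult_iff)
    show ?thesis
    proof (cases "c = 0")
      case True
      then have "(\<Sum>s\<in>X. g s) = 0" using le sum_nonneg[of X g] nn by force
      then have "g s = 0" if "s \<in> X" for s using sum_nonneg_eq_0_iff[OF fin, of g] nn that by blast
      then have "?B = {}" using True by auto
      then show ?thesis by (simp only: card.empty)
    next
      case False
      have "2 * c * real (card ?B) = (\<Sum>s\<in>?B. 2 * c)" by simp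
      also have "\<dots> \<le> (\<Sum>s\<in>?B. g s)" by (intro sum_mono) auto
      also note le'
      finally have "c * (2 * real (card ?B)) \<le> c * real (card X)" by (simp add: mult_ac)
      then have "2 * real (card ?B) \<le> real (card X)" using False c by (simp add: mult_le_cancel_left)
      then show ?thesis by linarith
    qed
  qed
qed

section \<open>Lower bounds: the cheapest radii and the guess of the largest price\<close>

context facility_location
begin

lemma threshold_props:
  assumes "1 \<le> p" "p \<le> n"
  shows "card {j\<in>C. a j < threshold C a p} < p" (is "card ?low < p")
    and "p \<le> card {j\<in>C. a j < threshold C a p} + card {j\<in>C. a j = threshold C a p}"
proof -
  let ?e = "threshold C a p"
  have "{j\<in>C. a j \<le> Max (a ` C)} = C" by auto
  then have ex: "p \<le> card {j\<in>C. a j \<le> Max (a ` C)}" using assms card_C by simp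
  have "p \<le> card {j\<in>C. a j \<le> ?e}" unfolding threshold_def by (rule LeastI) (rule ex)
  also have "{j\<in>C. a j \<le> ?e} = ?low \<union> {j\<in>C. a j = ?e}" by auto
  also have "card \<dots> = card ?low + card {j\<in>C. a j = ?e}" by (intro card_Un_disjoint) auto
  finally show "p \<le> card ?low + card {j\<in>C. a j = ?e}" .
  show "card ?low < p"
  proof (cases ?e)
    case 0
    then show ?thesis using assms by simp
  next
    case (Suc e')
    then have "\<not> p \<le> card {j\<in>C. a j \<le> e'}" unfolding threshold_def by (intro not_less_Least) simp
    moreover have "{j\<in>C. a j \<le> e'} = ?low" using Suc by auto
    ultimately show ?thesis by simp
  qed
qed

text \<open>After subtracting the threshold radius from every term, only clients below the threshold
  can contribute a negative amount, so leaving out some of them or adding others does not decrease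
  the sum.\<close>

lemma radii_sum_le:
  assumes p: "1 \<le> p" and D: "D \<subseteq> C" and card_D: "card D = p"
  shows "radii_sum n b C a p \<le> (\<Sum>j\<in>D. \<rho> (a j))"
proof -
  let ?e = "threshold C a p" and ?low = "{j\<in>C. a j < threshold C a p}"
  have fD: "finite D" using D finite_subset by blast
  have "p \<le> n" using card_mono[OF finite_C D] card_D card_C by simp
  then have lt: "card ?low < p" using threshold_props(1)[OF p, of a] by blast
  have "(\<Sum>j\<in>?low. \<rho> (a j) - \<rho> ?e) \<le> (\<Sum>j\<in>?low \<inter> D. \<rho> (a j) - \<rho> ?e)"
  proof -
    have "(\<Sum>j\<in>?low - D. \<rho> (a j) - \<rho> ?e) \<le> 0"
      using rad_mono[of "a _" ?e n b] by (intro sum_nonpos) (auto simp: less_imp_le)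
    moreover have "(\<Sum>j\<in>?low. \<rho> (a j) - \<rho> ?e) = (\<Sum>j\<in>?low \<inter> D. \<rho> (a j) - \<rho> ?e) + (\<Sum>j\<in>?low - D. \<rho> (a j) - \<rho> ?e)"
      by (rule sum.Int_Diff) simp
    ultimately show ?thesis by simp
  qed
  also have "\<dots> \<le> (\<Sum>j\<in>?low \<inter> D. \<rho> (a j) - \<rho> ?e) + (\<Sum>j\<in>D - ?low. \<rho> (a j) - \<rho> ?e)"
  proof -
    have "0 \<le> (\<Sum>j\<in>D - ?low. \<rho> (a j) - \<rho> ?e)"
      using D by (intro sum_nonneg) (auto intro!: rad_mono)
    then show ?thesis by simp
  qed
  also have "\<dots> = (\<Sum>j\<in>D. \<rho> (a j) - \<rho> ?e)"
    using sum.Int_Diff[OF fD, of "\<lambda>j. \<rho> (a j) - \<rho> ?e" ?low] by (simp add: Int_commute)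
  also have "\<dots> = (\<Sum>j\<in>D. \<rho> (a j)) - real p * \<rho> ?e"
    using card_D by (simp add: sum_subtractf)
  finally have "(\<Sum>j\<in>?low. \<rho> (a j)) - real (card ?low) * \<rho> ?e \<le> (\<Sum>j\<in>D. \<rho> (a j)) - real p * \<rho> ?e"
    by (simp add: sum_subtractf)
  moreover have "real (p - card ?low) * \<rho> ?e = real p * \<rho> ?e - real (card ?low) * \<rho> ?e"
    using lt by (simp add: of_nat_diff algebra_simps)
  ultimately show ?thesis unfolding radii_sum_def by linarith
qed

text \<open>The caps \<open>real n * \<rho> g\<close> start with 0 and \<open>1 / 2 ^ b\<close> and
  then double, so the least one above the largest price exceeds it by at most a factor 2. That price
  is one summand of the total opening cost.\<close>

lemma guess_exists:
  assumes F': "F' \<subseteq> F" "F' \<noteq> {}"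
  shows "\<exists>g\<le>L. (\<forall>i\<in>F'. f i \<le> real n * \<rho> g) \<and> real n * \<rho> g \<le> 2 * (\<Sum>i\<in>F'. f i)"
proof -
  have fin: "finite F'" using F' finite_subset by blast
  define m where "m = Max (f ` F')"
  obtain i where i: "i \<in> F'" "m = f i" unfolding m_def using fin F' Max_in[of "f ` F'"] by blast
  have max: "f i' \<le> m" if "i' \<in> F'" for i' unfolding m_def using fin that by auto
  have m0: "0 \<le> m" using i f_nonneg F' by auto
  have m_sum: "m \<le> (\<Sum>i\<in>F'. f i)" unfolding i(2) using fin i f_nonneg F' by (intro member_le_sum) auto
  have "2 ^ b * 1 \<le> \<rho> L * real n"
    using rad_max_level[OF n, of b] n by (intro mult_mono) auto
  moreover have "m \<le> 2 ^ b" using i f_le F' by auto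
  ultimately have ex: "m \<le> real n * \<rho> L" by (simp add: mult.commute)
  define g where "g = (LEAST g. m \<le> real n * \<rho> g)"
  have g: "m \<le> real n * \<rho> g" "g \<le> L"
    unfolding g_def using LeastI[of "\<lambda>g. m \<le> real n * \<rho> g", OF ex] Least_le[of "\<lambda>g. m \<le> real n * \<rho> g", OF ex] by auto
  have "real n * \<rho> g \<le> 2 * m"
  proof (cases g)
    case 0
    then show ?thesis using m0 by simp
  next
    case (Suc g')
    then have lt: "real n * \<rho> g' < m" using not_less_Least[of g' "\<lambda>g. m \<le> real n * \<rho> g"] g_def by auto
    show ?thesis
    proof (cases "g' = 0")
      case True
      then have "0 < m" using lt by simp
      then have "1 / 2 ^ b \<le> m" using f_grid[of i] i F' by auto
      then show ?thesis using n_rad_1[OF n, of b] Suc True m0 by simp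
    next
      case False
      then have "\<rho> g = 2 * \<rho> g'" using Suc rad_Suc[of g' n b] by simp
      then show ?thesis using lt by simp
    qed
  qed
  then show ?thesis using g max m_sum by (intro exI[of _ g]) (auto intro: order_trans)
qed

end

section \<open>Turning one outcome of the coins into a solution\<close>

context facility_guess
begin

definition "h s j = (if ops s j then f (ch j) else 0) + d j (x s j)"
text \<open>Which clients of the threshold level get served is decided only after the coins are
  known. The estimate therefore uses the average of \<open>h\<close> over that whole level, which is
  linear in \<open>h\<close> and can be averaged over the coins.\<close>

definition "estimate p s =
  (\<Sum>j\<in>{j\<in>C. a j < threshold C a p}. h s j) +
  real (p - card {j\<in>C. a j < threshold C a p}) * (\<Sum>j\<in>{j\<in>C. a j = threshold C a p}. h s j)
    / real (card {j\<in>C. a j = threshold C a p})"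

lemma h_nonneg: "j \<in> C \<Longrightarrow> 0 \<le> h s j"
  unfolding h_def using ch_nonneg x_F[of j s] d_nonneg[of j "x s j"] by auto

lemma expected_h: "j \<in> C \<Longrightarrow> (\<Sum>s\<in>\<Omega>. h s j) \<le> 90 * \<rho> (a j) * real (card \<Omega>)"
  using expected_opening_cost[of j] expected_dist[of j] unfolding h_def sum.distrib by linarith

lemma expected_estimate:
  assumes p: "1 \<le> p" "p \<le> n"
  shows "(\<Sum>s\<in>\<Omega>. estimate p s) \<le> 90 * radii_sum n b C a p * real (card \<Omega>)"
proof -
  let ?e = "threshold C a p"
  let ?low = "{j\<in>C. a j < ?e}" and ?J = "{j\<in>C. a j = ?e}" and ?c = "real (card \<Omega>)"
  let ?q = "real (p - card ?low)" and ?Q = "real (card ?J)"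
  have Q: "?Q > 0" using threshold_props[OF p, of a] by simp
  have cancel: "z \<noteq> 0 \<Longrightarrow> y * (z * w) / z = y * w" for y z w :: real by simp
  have "(\<Sum>s\<in>\<Omega>. estimate p s) = (\<Sum>s\<in>\<Omega>. \<Sum>j\<in>?low. h s j) + ?q * (\<Sum>s\<in>\<Omega>. \<Sum>j\<in>?J. h s j) / ?Q"
    unfolding estimate_def sum.distrib sum_divide_distrib sum_distrib_left ..
  also have "(\<Sum>s\<in>\<Omega>. \<Sum>j\<in>?low. h s j) = (\<Sum>j\<in>?low. \<Sum>s\<in>\<Omega>. h s j)" by (rule sum.swap)
  also have "(\<Sum>s\<in>\<Omega>. \<Sum>j\<in>?J. h s j) = (\<Sum>j\<in>?J. \<Sum>s\<in>\<Omega>. h s j)" by (rule sum.swap)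
  finally have eq: "(\<Sum>s\<in>\<Omega>. estimate p s) = (\<Sum>j\<in>?low. \<Sum>s\<in>\<Omega>. h s j) + ?q * (\<Sum>j\<in>?J. \<Sum>s\<in>\<Omega>. h s j) / ?Q" .
  have 1: "(\<Sum>j\<in>?low. \<Sum>s\<in>\<Omega>. h s j) \<le> (\<Sum>j\<in>?low. 90 * \<rho> (a j) * ?c)"
    using expected_h by (intro sum_mono) auto
  have "(\<Sum>j\<in>?J. \<Sum>s\<in>\<Omega>. h s j) \<le> (\<Sum>j\<in>?J. 90 * \<rho> ?e * ?c)"
  proof (intro sum_mono)
    fix j assume "j \<in> ?J"
    then show "(\<Sum>s\<in>\<Omega>. h s j) \<le> 90 * \<rho> ?e * ?c" using expected_h[of j] by simp
  qed
  then have "(\<Sum>j\<in>?J. \<Sum>s\<in>\<Omega>. h s j) \<le> ?Q * (90 * \<rho> ?e * ?c)" by simp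
  then have "?q * (\<Sum>j\<in>?J. \<Sum>s\<in>\<Omega>. h s j) / ?Q \<le> ?q * (?Q * (90 * \<rho> ?e * ?c)) / ?Q"
    by (intro divide_right_mono mult_left_mono) auto
  also have "\<dots> = ?q * (90 * \<rho> ?e * ?c)"
    by (rule cancel) (use Q in linarith)
  finally have 2: "?q * (\<Sum>j\<in>?J. \<Sum>s\<in>\<Omega>. h s j) / ?Q \<le> ?q * (90 * \<rho> ?e * ?c)" .
  have 3: "(\<Sum>j\<in>?low. 90 * \<rho> (a j) * ?c) = 90 * ?c * (\<Sum>j\<in>?low. \<rho> (a j))"
    unfolding sum_distrib_left by (intro sum.cong) auto
  have "(\<Sum>j\<in>?low. 90 * \<rho> (a j) * ?c) + ?q * (90 * \<rho> ?e * ?c) = 90 * radii_sum n b C a p * ?c"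
    unfolding 3 radii_sum_def by (simp only: distrib_left distrib_right mult_ac)
  then show ?thesis using 1 2 eq by linarith
qed

text \<open>All clients below the threshold are served, and the facilities that they open are
  charged to them. On the threshold level, clients are grouped by offered facility, and a cluster
  costs its distances plus its price unless that is already paid. The knapsack selects
  \<open>q\<close> clients at no more than \<open>q / card J\<close> of the total; since only part
  of cluster \<open>z\<close> may be served, its full price is covered by
  \<open>\<phi>\<close>.\<close>

lemma star_solution_exists:
  assumes p: "1 \<le> p" "p \<le> n" and \<phi>: "\<And>i. i \<in> A \<Longrightarrow> f i \<le> \<phi>"
  shows "\<exists>C' F'. star_solution F C p f (x s) (\<lambda>j. d j (x s j)) (estimate p s + \<phi>) C' F'"
proof -
  define e where "e = threshold C a p"
  define low where "low = {j\<in>C. a j < e}"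
  define J where "J = {j\<in>C. a j = e}"
  define q where "q = p - card low"
  define \<delta> where "\<delta> j = d j (x s j)" for j
  define o' where "o' j = (if ops s j then f (ch j) else 0)" for j
  define Z0 where "Z0 = {i\<in>A. f i = 0} \<union> ch ` {j\<in>low. ops s j}"
  define f' where "f' i = (if i \<in> Z0 then 0 else f i)" for i
  define cl where "cl i = {j\<in>J. x s j = i}" for i
  define X where "X = x s ` J"
  define c where "c i = f' i + (\<Sum>j\<in>cl i. \<delta> j)" for i
  have fin: "finite low" "finite J" "finite Z0" "finite X" "finite (cl i)" for i
    by (auto simp: low_def J_def Z0_def X_def cl_def)
  have lt: "card low < p" and pQ: "p \<le> card low + card J"
    using threshold_props[OF p, of a] by (simp_all add: low_def J_def e_def)
  have q: "0 < q" "q \<le> card J" using lt pQ by (auto simp: q_def)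
  have xY: "x s j \<in> Y s (a j)" if "j \<in> C" for j by (rule x_in[OF that])
  have Z0_A: "Z0 \<subseteq> A" using ch_props(1) by (auto simp: Z0_def low_def)
  have X_A: "X \<subseteq> A" using xY opened_subset by (auto simp: X_def J_def)
  have f_A: "0 \<le> f i" if "i \<in> A" for i using that A f_nonneg by blast
  have f'_nn: "0 \<le> f' i" if "i \<in> A" for i using f_A[OF that] by (simp add: f'_def)
  have \<delta>_nn: "0 \<le> \<delta> j" if "j \<in> C" for j unfolding \<delta>_def using x_F[OF that] d_nonneg that by blast
  have card_J: "(\<Sum>i\<in>X. card (cl i)) = card J"
    unfolding cl_def X_def card_eq_sum using fin(2) by (intro sum.group) auto
  have cl_pos: "0 < card (cl i)" if "i \<in> X" for i
    using that fin(5) by (auto simp: X_def cl_def card_gt_0_iff)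
  have "\<exists>Z z. Z \<subseteq> X \<and> z \<in> X - Z \<and> (\<Sum>i\<in>Z. card (cl i)) < q \<and> q \<le> (\<Sum>i\<in>Z. card (cl i)) + card (cl z) \<and>
    (\<Sum>i\<in>Z. c i) + c z * real (q - (\<Sum>i\<in>Z. card (cl i))) / real (card (cl z))
      \<le> real q * (\<Sum>i\<in>X. c i) / real (\<Sum>i\<in>X. card (cl i))"
    by (rule fractional_knapsack) (use fin cl_pos q card_J in auto)
  then obtain Z z where Z: "Z \<subseteq> X" "z \<in> X" "z \<notin> Z" "(\<Sum>i\<in>Z. card (cl i)) < q"
      "q \<le> (\<Sum>i\<in>Z. card (cl i)) + card (cl z)"
    and knap: "(\<Sum>i\<in>Z. c i) + c z * real (q - (\<Sum>i\<in>Z. card (cl i))) / real (card (cl z))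
      \<le> real q * (\<Sum>i\<in>X. c i) / real (card J)"
    unfolding card_J by blast
  \<comment> \<open>The number of clients still missing; the cut cluster supplies them at no more
    than its average distance.\<close>
  define r where "r = q - (\<Sum>i\<in>Z. card (cl i))"
  have "r \<le> card (cl z)" using Z by (simp add: r_def)
  from cheap_subset[OF fin(5) this, of \<delta>]
  obtain D where D: "D \<subseteq> cl z" "card D = r"
    and D_le: "(\<Sum>j\<in>D. \<delta> j) \<le> real r * (\<Sum>j\<in>cl z. \<delta> j) / real (card (cl z))" by blast
  define JZ where "JZ = {j\<in>J. x s j \<in> Z}"
  have finZ: "finite Z" "finite JZ" "finite D"
    using Z(1) fin D finite_subset by (auto simp: JZ_def intro: finite_subset)
  have group: "(\<Sum>i\<in>Z. \<Sum>j\<in>cl i. w j) = (\<Sum>j\<in>JZ. w j)" for w :: "nat \<Rightarrow> 'z::comm_monoid_add"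
  proof -
    have "(\<Sum>i\<in>Z. \<Sum>j\<in>cl i. w j) = (\<Sum>i\<in>Z. \<Sum>j\<in>{j\<in>JZ. x s j = i}. w j)"
      by (intro sum.cong) (auto simp: cl_def JZ_def)
    also have "\<dots> = (\<Sum>j\<in>JZ. w j)" using finZ by (intro sum.group) (auto simp: JZ_def)
    finally show ?thesis .
  qed
  let ?C = "low \<union> JZ \<union> D" and ?F = "Z0 \<union> insert z Z"
  have disj: "low \<inter> JZ = {}" "(low \<union> JZ) \<inter> D = {}"
    using D Z by (auto simp: low_def JZ_def J_def cl_def)
  have sum_C: "(\<Sum>j\<in>?C. w j) = (\<Sum>j\<in>low. w j) + (\<Sum>j\<in>JZ. w j) + (\<Sum>j\<in>D. w j)" for w :: "nat \<Rightarrow> 'z::comm_monoid_add"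
    using disj fin finZ by (simp add: sum.union_disjoint)
  have "card ?C = card low + (\<Sum>i\<in>Z. card (cl i)) + r"
    using sum_C[of "\<lambda>_. 1::nat"] group[of "\<lambda>_. 1::nat"] D by simp
  then have card_C': "card ?C = p" using Z lt by (simp add: r_def q_def)
  have sub_C: "?C \<subseteq> C" using D by (auto simp: low_def JZ_def J_def cl_def)
  have sub_F: "?F \<subseteq> F" using Z0_A X_A Z A by blast
  have image: "x s ` ?C \<subseteq> ?F"
  proof -
    have "Y s (a j) \<subseteq> Z0" if "j \<in> low" for j
      using that by (auto simp: opened_def Z0_def low_def)
    then have "x s ` low \<subseteq> Z0" using xY by (auto simp: low_def)
    then show ?thesis using D by (auto simp: JZ_def cl_def)
  qed
  have sum_Z0: "(\<Sum>i\<in>Z0. f i) \<le> (\<Sum>j\<in>low. o' j)"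
  proof -
    have "(\<Sum>i\<in>Z0. f i) = (\<Sum>i\<in>ch ` {j\<in>low. ops s j}. f i)"
      unfolding Z0_def using fin by (intro sum.mono_neutral_right) auto
    also have "\<dots> \<le> (\<Sum>j\<in>{j\<in>low. ops s j}. f (ch j))"
      using sum_image_le[of "{j\<in>low. ops s j}" f ch] fin ch_nonneg by (auto simp: low_def o_def)
    also have "\<dots> = (\<Sum>j\<in>low. o' j)"
      unfolding o'_def using fin by (simp add: sum.inter_filter)
    finally show ?thesis .
  qed
  have sum_X: "(\<Sum>i\<in>X. f' i) \<le> (\<Sum>j\<in>J. o' j)"
  proof -
    \<comment> \<open>An offered facility outside \<open>Z0\<close> was opened by a client of level
      at most \<open>e\<close> that is not below the threshold, hence of level
      \<open>e\<close>.\<close>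
    have "X - Z0 \<subseteq> ch ` {j\<in>J. ops s j}"
    proof
      fix i assume "i \<in> X - Z0"
      then obtain j where "j \<in> J" "x s j = i" "i \<notin> Z0" by (auto simp: X_def)
      then have "i \<in> {i\<in>A. f i = 0} \<union> ch ` {k\<in>C. ops s k \<and> a k \<le> e}" and "i \<notin> Z0"
        using xY[of j] by (auto simp: J_def opened_def)
      then obtain k where "k \<in> C" "ops s k" "a k \<le> e" "i = ch k" "k \<notin> low"
        by (auto simp: Z0_def)
      then show "i \<in> ch ` {j\<in>J. ops s j}" by (auto simp: J_def low_def)
    qed
    have "(\<Sum>i\<in>X. f' i) = (\<Sum>i\<in>X - Z0. f i)"
      unfolding f'_def using fin by (subst sum.mono_neutral_right[of X "X - Z0"]) (auto intro: sum.cong)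
    also have "\<dots> \<le> (\<Sum>i\<in>ch ` {j\<in>J. ops s j}. f i)"
      using \<open>X - Z0 \<subseteq> _\<close> fin ch_nonneg by (intro sum_mono2) (auto simp: J_def)
    also have "\<dots> \<le> (\<Sum>j\<in>{j\<in>J. ops s j}. f (ch j))"
      using sum_image_le[of "{j\<in>J. ops s j}" f ch] fin ch_nonneg by (auto simp: J_def o_def)
    also have "\<dots> = (\<Sum>j\<in>J. o' j)"
      unfolding o'_def using fin by (simp add: sum.inter_filter)
    finally show ?thesis .
  qed
  have zA: "z \<in> A" using Z X_A by blast
  have sum_F: "(\<Sum>i\<in>?F. f i) \<le> (\<Sum>i\<in>Z0. f i) + (\<Sum>i\<in>Z. f' i) + \<phi>"
  proof -
    have "?F = Z0 \<union> (insert z Z - Z0)" by blast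
    then have "(\<Sum>i\<in>?F. f i) = (\<Sum>i\<in>Z0. f i) + (\<Sum>i\<in>insert z Z - Z0. f i)"
      using fin finZ by (metis Diff_disjoint finite_Diff finite_insert sum.union_disjoint)
    also have "(\<Sum>i\<in>insert z Z - Z0. f i) = (\<Sum>i\<in>insert z Z. f' i)"
      unfolding f'_def using finZ
      by (subst sum.mono_neutral_right[of "insert z Z" "insert z Z - Z0"]) (auto intro: sum.cong)
    also have "\<dots> = f' z + (\<Sum>i\<in>Z. f' i)" using Z finZ by simp
    also have "f' z \<le> \<phi>" using \<phi>[OF zA] f_A[OF zA] by (simp add: f'_def)
    finally show ?thesis by simp
  qed
  have sum_c: "(\<Sum>i\<in>X. c i) \<le> (\<Sum>j\<in>J. h s j)"
  proof -
    have "(\<Sum>i\<in>X. \<Sum>j\<in>cl i. \<delta> j) = (\<Sum>j\<in>J. \<delta> j)"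
      unfolding cl_def X_def using fin(2) by (intro sum.group) auto
    then show ?thesis using sum_X by (simp add: c_def h_def o'_def[symmetric] \<delta>_def[symmetric] sum.distrib)
  qed
  have D_le': "(\<Sum>j\<in>D. \<delta> j) \<le> c z * real r / real (card (cl z))"
  proof -
    \<comment> \<open>The fraction of the price \<open>f' z\<close> contained in \<open>c z\<close>
      is given away here; \<open>\<phi>\<close> pays the whole price.\<close>
    have "real r * (\<Sum>j\<in>cl z. \<delta> j) \<le> real r * c z"
      using f'_nn[OF zA] by (intro mult_left_mono) (auto simp: c_def)
    then have "real r * (\<Sum>j\<in>cl z. \<delta> j) / real (card (cl z)) \<le> real r * c z / real (card (cl z))"
      by (rule divide_right_mono) simp
    then show ?thesis using D_le by (simp only: mult.commute)
  qed
  have "real q * (\<Sum>i\<in>X. c i) / real (card J) \<le> real q * (\<Sum>j\<in>J. h s j) / real (card J)"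
    by (intro divide_right_mono mult_left_mono sum_c) auto
  then have top: "(\<Sum>i\<in>Z. c i) + (\<Sum>j\<in>D. \<delta> j) \<le> real q * (\<Sum>j\<in>J. h s j) / real (card J)"
    using knap D_le' unfolding r_def by linarith
  have "(\<Sum>i\<in>?F. f i) + (\<Sum>j\<in>?C. \<delta> j) \<le>
      (\<Sum>j\<in>low. o' j) + (\<Sum>i\<in>Z. f' i) + \<phi> + ((\<Sum>j\<in>low. \<delta> j) + (\<Sum>j\<in>JZ. \<delta> j) + (\<Sum>j\<in>D. \<delta> j))"
    unfolding sum_C using sum_F sum_Z0 by linarith
  also have "\<dots> = (\<Sum>j\<in>low. h s j) + ((\<Sum>i\<in>Z. c i) + (\<Sum>j\<in>D. \<delta> j)) + \<phi>"
    unfolding group[symmetric] h_def c_def o'_def[symmetric] \<delta>_def[symmetric] sum.distrib by linarith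
  also have "\<dots> \<le> estimate p s + \<phi>"
    using top unfolding estimate_def low_def J_def q_def e_def by linarith
  finally have "star_solution F C p f (x s) \<delta> (estimate p s + \<phi>) ?C ?F"
    unfolding star_solution_def using sub_C sub_F image card_C' by blast
  then show ?thesis unfolding \<delta>_def by blast
qed

text \<open>Markov's inequality at twice the mean \<open>90 * radii_sum n b C a p\<close>; the cap
  \<open>\<phi>\<close> enters with the same factor, so that the bound is a multiple of the
  score.\<close>

lemma card_bad_coins_le:
  assumes p: "1 \<le> p" "p \<le> n" and \<phi>: "\<And>i. i \<in> A \<Longrightarrow> f i \<le> \<phi>" "0 \<le> \<phi>"
  shows "2 * card {s\<in>\<Omega>. \<nexists>C' F'. star_solution F C p f (x s) (\<lambda>j. d j (x s j))
    (180 * (\<phi> + radii_sum n b C a p)) C' F'} \<le> card \<Omega>" (is "2 * card ?B \<le> _")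
proof -
  let ?R = "radii_sum n b C a p"
  have "?B \<subseteq> {s\<in>\<Omega>. 2 * (90 * ?R) < estimate p s}"
  proof
    fix s assume s: "s \<in> ?B"
    obtain C' F' where sol: "star_solution F C p f (x s) (\<lambda>j. d j (x s j)) (estimate p s + \<phi>) C' F'"
      using star_solution_exists[OF p \<phi>(1)] by blast
    have "\<not> estimate p s + \<phi> \<le> 180 * (\<phi> + ?R)"
    proof
      assume "estimate p s + \<phi> \<le> 180 * (\<phi> + ?R)"
      then have "star_solution F C p f (x s) (\<lambda>j. d j (x s j)) (180 * (\<phi> + ?R)) C' F'"
        using sol by (auto simp: star_solution_def)
      then show False using s by blast
    qed
    then show "s \<in> {s\<in>\<Omega>. 2 * (90 * ?R) < estimate p s}" using s \<phi>(2) by simp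
  qed
  then have "card ?B \<le> card {s\<in>\<Omega>. 2 * (90 * ?R) < estimate p s}" by (intro card_mono) auto
  also have "2 * \<dots> \<le> card \<Omega>"
  proof (rule markov_card)
    show "0 \<le> estimate p s" for s unfolding estimate_def
      by (intro add_nonneg_nonneg sum_nonneg divide_nonneg_nonneg mult_nonneg_nonneg) (auto intro: h_nonneg)
  qed (use expected_estimate[OF p] in auto)
  finally show ?thesis by simp
qed

end

section \<open>The protocol\<close>

text \<open>Each sample fails with probability at most 1/2, so this many independent ones all fail
  with probability at most \<open>1 / (2 * n)\<close>.\<close>

definition copies :: "nat \<Rightarrow> nat" where "copies n = lg n + 1"

text \<open>A common upper bound for the lengths of the five messages, so that all blocks of the
  transcript are equally long.\<close>

definition msg_len :: "nat \<Rightarrow> nat \<Rightarrow> nat" where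
  "msg_len n b = 3 * copies n + 2 * max_level n b + 10"

definition word_bits :: "nat \<Rightarrow> nat \<Rightarrow> nat" where
  "word_bits n b = b + max_level n b + lg n + 1"

definition numer :: "nat \<Rightarrow> real \<Rightarrow> nat" where
  "numer b x = (SOME p. p < 2 ^ b \<and> (\<exists>q>0. q < 2 ^ b \<and> x = real p / real q))"

text \<open>Chosen for the numerator already fixed, so that the two choices form one
  fraction.\<close>

definition denom :: "nat \<Rightarrow> real \<Rightarrow> nat" where
  "denom b x = (SOME q. 0 < q \<and> q < 2 ^ b \<and> x = real (numer b x) / real q)"

lemma numer_denom:
  assumes "representable b x"
  shows "numer b x < 2 ^ b" and "denom b x < 2 ^ b" and "real (numer b x) / real (denom b x) = x"
proof -
  have "\<exists>p. p < 2 ^ b \<and> (\<exists>q>0. q < 2 ^ b \<and> x = real p / real q)"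
    using assms by (auto simp: representable_def)
  from someI_ex[OF this]
  have num: "numer b x < 2 ^ b" "\<exists>q>0. q < 2 ^ b \<and> x = real (numer b x) / real q"
    unfolding numer_def by blast+
  then have "\<exists>q. 0 < q \<and> q < 2 ^ b \<and> x = real (numer b x) / real q" by blast
  from someI_ex[OF this] show "denom b x < 2 ^ b" "real (numer b x) / real (denom b x) = x"
    unfolding denom_def by simp_all
  show "numer b x < 2 ^ b" by (rule num(1))
qed

text \<open>The memory of a machine is a private part (its row of the distance matrix, then its flags,
  opening cost, coverage and coins) followed by a transcript of everything that has been broadcast.
  Block \<open>r\<close> of the transcript consists of the messages of round \<open>r\<close>, padded to equal length.\<close>

definition private_word :: "nat \<Rightarrow> nat \<Rightarrow> local_input option \<Rightarrow> nat \<Rightarrow> nat" where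
  "private_word n b inp k = (case inp of None \<Rightarrow> 0 | Some li \<Rightarrow>
     if k < 4 * n then
       (case li_distance li (k div 2) of None \<Rightarrow> 0
        | Some x \<Rightarrow> if even k then numer b x else denom b x)
     else if k = 4 * n then (case li_opening_cost li of None \<Rightarrow> 0 | Some _ \<Rightarrow> 1)
     else if k = 4 * n + 1 then of_bool (li_is_client li)
     else if k = 4 * n + 2 then (case li_opening_cost li of None \<Rightarrow> 0 | Some x \<Rightarrow> numer b x)
     else if k = 4 * n + 3 then (case li_opening_cost li of None \<Rightarrow> 0 | Some x \<Rightarrow> denom b x)
     else li_coverage li)"

definition private_input :: "nat \<Rightarrow> nat \<Rightarrow> local_input option \<Rightarrow> words" where
  "private_input n b inp = map (\<lambda>k. private_word n b inp k mod 2 ^ word_bits n b) [0..<4 * n + 5]"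

definition private_len :: "nat \<Rightarrow> nat" where
  "private_len n = 4 * n + 5 + copies n"

definition coin_lists :: "nat \<Rightarrow> words set" where
  "coin_lists n = {cs. length cs = copies n \<and> set cs \<subseteq> {..<n}}"

definition block_len :: "nat \<Rightarrow> nat \<Rightarrow> nat" where
  "block_len n b = 2 * n * msg_len n b"

text \<open>Row-major indexing: block, then sender, then position in the message.\<close>

definition word_at :: "nat \<Rightarrow> nat \<Rightarrow> words \<Rightarrow> nat \<Rightarrow> nat \<Rightarrow> nat \<Rightarrow> nat" where
  "word_at n b K r v k = K ! (r * block_len n b + v * msg_len n b + k)"

section \<open>What a machine computes from the common transcript\<close>

context
  fixes n b :: nat and R :: "nat \<Rightarrow> nat \<Rightarrow> nat \<Rightarrow> nat"
begin

definition known_F :: "nat set" where "known_F = {v\<in>{..<2 * n}. R 0 v 0 = 1}"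
definition known_C :: "nat set" where "known_C = {v\<in>{..<2 * n}. R 0 v 1 = 1}"
definition known_cost :: "nat \<Rightarrow> real" where
  "known_cost v = (if v \<in> known_F then real (R 0 v 2) / real (R 0 v 3) else 0)"
text \<open>A machine that hosts no vertex reports 0, so the maximum recovers the true
  value.\<close>

definition known_coverage :: nat where
  "known_coverage = Max ((\<lambda>v. R 0 v 4) ` {..<2 * n})"
definition known_coins :: "nat \<Rightarrow> nat \<Rightarrow> nat" where
  "known_coins c = restrict (\<lambda>v. R 0 v (5 + c)) {..<2 * n}"
definition known_lev :: "nat \<Rightarrow> nat" where
  "known_lev v = (if v \<in> known_F then R 1 v 0 else 0)"
definition known_A :: "nat \<Rightarrow> nat set" where
  "known_A g = {i\<in>known_F. known_cost i \<le> real n * rad n b g}"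
definition known_level :: "nat \<Rightarrow> nat \<Rightarrow> nat" where
  "known_level g v = (if v \<in> known_C \<and> g \<le> max_level n b \<and> known_A g \<noteq> {} then R 2 v (2 * g) else 0)"
definition known_ch :: "nat \<Rightarrow> nat \<Rightarrow> nat" where
  "known_ch g v = (if v \<in> known_C \<and> g \<le> max_level n b \<and> known_A g \<noteq> {} then R 2 v (2 * g + 1) else 0)"
definition score :: "nat \<Rightarrow> real" where
  "score g = real n * rad n b g + radii_sum n b known_C (known_level g) known_coverage"
definition best_guess :: nat where
  "best_guess = arg_min_on score {g. g \<le> max_level n b \<and> known_A g \<noteq> {}}"
text \<open>With coverage 0 the optimum is 0, and a positive bound would certify nothing.\<close>

definition bound :: real where
  "bound = (if known_coverage = 0 then 0 else 180 * score best_guess)"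
definition known_opens :: "nat \<Rightarrow> nat \<Rightarrow> bool" where
  "known_opens c v \<longleftrightarrow> v \<in> known_C \<and> R 3 v c = 1"
text \<open>Depends on broadcast words only, so all machines reach the same verdict; searching for
  the solution is free local computation.\<close>

definition accepts :: "nat \<Rightarrow> nat set \<Rightarrow> nat set \<Rightarrow> bool" where
  "accepts c C' F' \<longleftrightarrow> star_solution known_F known_C known_coverage known_cost
     (\<lambda>v. R 4 v (3 * c)) (\<lambda>v. real (R 4 v (3 * c + 1)) / real (R 4 v (3 * c + 2))) bound C' F'"
definition row :: "words \<Rightarrow> nat \<Rightarrow> real" where
  "row m u = (if u \<in> known_F \<union> known_C then real (m ! (2 * u)) / real (m ! (2 * u + 1)) else 0)"

definition offer :: "words \<Rightarrow> nat \<Rightarrow> nat \<Rightarrow> nat" where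
  "offer m v c = nearest (row m)
     (opened (known_A best_guess) known_cost known_C (known_level best_guess) (known_ch best_guess)
       (known_opens c) (known_level best_guess v))"

text \<open>Round 2 sends level and facility for all guesses at once, in even and odd words, and
  rounds 3 and 4 treat all samples in parallel; this keeps the number of rounds constant. Where a
  formula makes no sense for a vertex, its value is masked when it is read.\<close>

definition message_word :: "nat \<Rightarrow> words \<Rightarrow> nat \<Rightarrow> nat \<Rightarrow> nat" where
  "message_word r m v k =
     (if r = 0 then (if k < 5 + copies n then m ! (4 * n + k) else 0)
      else if r = 1 then facility_level n b known_C (row m) (known_cost v)
      else if r = 2 then
        (if even k then client_level n b (known_A (k div 2)) known_lev (row m)
         else cheapest n b (known_A (k div 2)) known_lev known_cost (row m))
      else if r = 3 then
        of_bool (opens n b known_C (known_level best_guess)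
          (arrival n b known_cost (known_level best_guess) (known_ch best_guess) (known_coins k))
          (row m) v)
      else if r = 4 then
        (if k mod 3 = 0 then offer m v (k div 3)
         else if k mod 3 = 1 then m ! (2 * offer m v (k div 3))
         else m ! (2 * offer m v (k div 3) + 1))
      else 0)"

end

definition all_coins :: "nat \<Rightarrow> (nat \<Rightarrow> nat) set" where
  "all_coins n = {..<2 * n * copies n} \<rightarrow>\<^sub>E {..<n}"

text \<open>Any map that runs through all coin tables in a cycle will do, provided that all machines
  use the same one.\<close>

definition next_coins :: "nat \<Rightarrow> (nat \<Rightarrow> nat) \<Rightarrow> nat \<Rightarrow> nat" where
  "next_coins n = (SOME h. \<forall>\<sigma>\<in>all_coins n. h \<sigma> \<in> all_coins n \<and>
     (\<forall>\<sigma>'\<in>all_coins n. \<exists>m. (h ^^ m) \<sigma> = \<sigma>'))"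

definition stored_coins :: "nat \<Rightarrow> nat \<Rightarrow> words \<Rightarrow> nat \<Rightarrow> nat" where
  "stored_coins n b K =
     restrict (\<lambda>y. word_at n b K 0 (y div copies n) (5 + y mod copies n)) {..<2 * n * copies n}"

text \<open>The inputs and levels in the first three blocks do not depend on the coins and are kept;
  only the coins in block 0 are overwritten. The new coins are a function of the transcript, so the
  machines agree on them by local computation.\<close>

definition restart :: "nat \<Rightarrow> nat \<Rightarrow> words \<Rightarrow> words" where
  "restart n b K = map (\<lambda>i. if i < block_len n b \<and> 5 \<le> i mod msg_len n b \<and> i mod msg_len n b < 5 + copies n
     then next_coins n (stored_coins n b K) (i div msg_len n b * copies n + (i mod msg_len n b - 5))
     else K ! i) [0..<3 * block_len n b]"

definition rounds_done :: "nat \<Rightarrow> nat \<Rightarrow> words \<Rightarrow> nat" where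
  "rounds_done n b K = length K div block_len n b"

definition accepting :: "nat \<Rightarrow> nat \<Rightarrow> words \<Rightarrow> bool" where
  "accepting n b K \<longleftrightarrow> rounds_done n b K = 5 \<and> (\<exists>c<copies n. \<exists>C' F'. accepts n b (word_at n b K) c C' F')"

text \<open>All machines hold the same transcript, so they make the same choice.\<close>

definition solution :: "nat \<Rightarrow> nat \<Rightarrow> words \<Rightarrow> nat set \<times> nat set" where
  "solution n b K = (SOME (C', F'). \<exists>c<copies n. accepts n b (word_at n b K) c C' F')"

text \<open>Truncation makes all words legal unconditionally; by \<open>mod_word\<close> it
  preserves the meaningful values.\<close>

definition message :: "nat \<Rightarrow> nat \<Rightarrow> nat \<Rightarrow> words \<Rightarrow> words \<Rightarrow> words" where
  "message n b v m K = map (\<lambda>k. message_word n b (word_at n b K) (rounds_done n b K) m v k mod 2 ^ word_bits n b)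
     [0..<msg_len n b]"

definition extend :: "nat \<Rightarrow> nat \<Rightarrow> words \<Rightarrow> (nat \<Rightarrow> words) \<Rightarrow> words" where
  "extend n b K rcv = (if rounds_done n b K = 5 then restart n b K
     else K @ map (\<lambda>i. rcv (i div msg_len n b) ! (i mod msg_len n b)) [0..<block_len n b])"

definition rfl_protocol :: "nat \<Rightarrow> nat \<Rightarrow> rfl_protocol" where
  "rfl_protocol n b = \<lparr>
     mpc_init = (\<lambda>v inp. map_pmf (\<lambda>cs. private_input n b inp @ cs) (pmf_of_set (coin_lists n))),
     mpc_send = (\<lambda>v m j. message n b v (take (private_len n) m) (drop (private_len n) m)),
     mpc_update = (\<lambda>v m rcv. return_pmf (take (private_len n) m @ extend n b (drop (private_len n) m) rcv)),
     mpc_output = (\<lambda>v m. let K = drop (private_len n) m in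
       if accepting n b K then Some (v \<in> fst (solution n b K), v \<in> snd (solution n b K)) else None)\<rparr>"

section \<open>Approximation guarantee\<close>

lemma representable_grid:
  assumes "representable b x" shows "0 \<le> x" and "x = 0 \<or> 1 / 2 ^ b \<le> x" and "x \<le> 2 ^ b"
proof -
  obtain p q :: nat where pq: "p < 2 ^ b" "0 < q" "q < 2 ^ b" "x = real p / real q"
    using assms by (auto simp: representable_def)
  have P: "real p < 2 ^ b" and Q: "real q < 2 ^ b"
    using pq(1,3) by (metis of_nat_less_iff of_nat_numeral of_nat_power)+
  show "0 \<le> x" using pq by simp
  show "x \<le> 2 ^ b"
  proof -
    have "real p / real q \<le> real p / 1" using pq(2) by (intro divide_left_mono) auto
    then have "x \<le> real p" using pq(4) by simp
    then show ?thesis using P by linarith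
  qed
  show "x = 0 \<or> 1 / 2 ^ b \<le> x"
  proof (cases "p = 0")
    case False
    have "1 / 2 ^ b \<le> 1 / real q" using Q pq(2) by (intro divide_left_mono) auto
    also have "\<dots> \<le> real p / real q" using False by (intro divide_right_mono) auto
    finally show ?thesis using pq(4) by simp
  qed (use pq in simp)
qed

section \<open>Masked tables, array indices and word sizes\<close>

lemma opened_guard: "opened A f C a ch (\<lambda>v. v \<in> C \<and> Q v) e = opened A f C a ch Q e"
  by (auto simp: opened_def)

lemma star_solution_cong:
  assumes "\<And>j. j \<in> C \<Longrightarrow> x j = x' j" and "\<And>j. j \<in> C \<Longrightarrow> \<delta> j = \<delta>' j"
  shows "star_solution F C p f x \<delta> K C' F' \<longleftrightarrow> star_solution F C p f x' \<delta>' K C' F'"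
proof (cases "C' \<subseteq> C")
  case True
  then have "x ` C' = x' ` C'" "(\<Sum>j\<in>C'. \<delta> j) = (\<Sum>j\<in>C'. \<delta>' j)"
    using assms by (auto intro!: image_cong sum.cong)
  then show ?thesis by (simp add: star_solution_def)
qed (simp add: star_solution_def)

lemma block_index:
  assumes "v < (m::nat)" and "k < l"
  shows "(v * l + k) div l = v" and "(v * l + k) mod l = k" and "v * l + k < m * l"
proof -
  have "Suc v * l \<le> m * l" using assms by (intro mult_right_mono) auto
  then show "v * l + k < m * l" using assms(2) by simp
qed (use assms in auto)

lemma word_at_append:
  assumes "length K = r * block_len n b" and "r' < r" and "v < 2 * n" and "k < msg_len n b"
  shows "word_at n b (K @ M) r' v k = word_at n b K r' v k"
proof -
  have "v * msg_len n b + k < block_len n b"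
    unfolding block_len_def by (rule block_index(3)) fact+
  then have "r' * block_len n b + (v * msg_len n b + k) < r * block_len n b"
    using block_index(3)[OF assms(2)] by simp
  then show ?thesis using assms(1) by (simp add: word_at_def nth_append add.assoc)
qed

lemma word_at_append_last:
  assumes "length K = r * block_len n b" and "v < 2 * n" and "k < msg_len n b"
  shows "word_at n b (K @ map g [0..<block_len n b]) r v k = g (v * msg_len n b + k)"
proof -
  have "v * msg_len n b + k < block_len n b"
    unfolding block_len_def by (rule block_index(3)) fact+
  then show ?thesis using assms(1) by (simp add: word_at_def nth_append add.assoc)
qed

lemma copies_pos: "0 < copies n"
  by (simp add: copies_def)

lemma n_le_two_power_copies: "2 * n \<le> 2 ^ copies n"
  using le_two_power_lg[of n] by (simp add: copies_def)

lemma le_msg_len: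
  shows "5 + copies n \<le> msg_len n b" and "g \<le> max_level n b \<Longrightarrow> 2 * g + 1 < msg_len n b"
    and "c < copies n \<Longrightarrow> 3 * c + 2 < msg_len n b" and "c < copies n \<Longrightarrow> c < msg_len n b"
  by (auto simp: msg_len_def)

lemma below_word:
  assumes "x < 2 ^ b \<or> x \<le> max_level n b \<or> x < 2 * n \<or> x \<le> n"
  shows "x < 2 ^ word_bits n b"
proof -
  have mono: "(2::nat) ^ k \<le> 2 ^ word_bits n b" if "k \<le> word_bits n b" for k
    using that by (intro power_increasing) auto
  have L: "max_level n b < 2 ^ max_level n b" by (rule less_exp)
  have n: "2 * n \<le> 2 ^ (lg n + 1)" using le_two_power_lg[of n] by simp
  have "(1::nat) \<le> 2 ^ lg n" by simp
  moreover have "(2::nat) ^ (lg n + 1) = 2 ^ lg n + 2 ^ lg n" by simp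
  ultimately have n': "n < 2 ^ (lg n + 1)" using le_two_power_lg[of n] by linarith
  have "b \<le> word_bits n b" "max_level n b \<le> word_bits n b" "lg n + 1 \<le> word_bits n b"
    by (simp_all add: word_bits_def)
  note le = this[THEN mono]
  from assms show ?thesis using L n n' le by (meson le_less_trans less_le_trans)
qed

lemma mod_word: "x < 2 ^ b \<or> x \<le> max_level n b \<or> x < 2 * n \<or> x \<le> n \<Longrightarrow> x mod 2 ^ word_bits n b = x"
  using below_word by (intro mod_less)

text \<open>Column \<open>c\<close> of the flattened coin table, read as one sample with a coin for
  every vertex.\<close>

definition seed :: "nat \<Rightarrow> (nat \<Rightarrow> nat) \<Rightarrow> nat \<Rightarrow> nat \<Rightarrow> nat" where
  "seed n \<sigma> c = restrict (\<lambda>v. \<sigma> (v * copies n + c)) {..<2 * n}"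

section \<open>The values that the protocol should compute, defined from the whole instance\<close>

locale rfl_input =
  fixes n b :: nat and I :: rfl_instance
  assumes n_pos: "n \<ge> 1" and valid: "valid_instance n b I"
begin

abbreviation "F \<equiv> facilities I"
abbreviation "C \<equiv> clients I"
abbreviation "p \<equiv> coverage I"

text \<open>The arguments are swapped as in \<open>explicit_input\<close>, and the value 0 off the
  vertices makes the decoded \<open>row\<close> equal to \<open>d v\<close> as a function.\<close>

definition d :: "nat \<Rightarrow> nat \<Rightarrow> real" where
  "d v u = (if u \<in> vertices I then distance I u v else 0)"
definition f :: "nat \<Rightarrow> real" where
  "f v = (if v \<in> F then opening_cost I v else 0)"
definition lev :: "nat \<Rightarrow> nat" where
  "lev v = (if v \<in> F then facility_level n b C (d v) (f v) else 0)"
definition A :: "nat \<Rightarrow> nat set" where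
  "A g = {i\<in>F. f i \<le> real n * rad n b g}"
definition a :: "nat \<Rightarrow> nat \<Rightarrow> nat" where
  "a g v = (if v \<in> C \<and> g \<le> max_level n b \<and> A g \<noteq> {} then client_level n b (A g) lev (d v) else 0)"
definition ch :: "nat \<Rightarrow> nat \<Rightarrow> nat" where
  "ch g v = (if v \<in> C \<and> g \<le> max_level n b \<and> A g \<noteq> {} then cheapest n b (A g) lev f (d v) else 0)"

lemma V: "vertices I \<subseteq> {..<2 * n}" and card_F: "card F = n" and card_C: "card C = n" and p_le: "p \<le> n"
  and metric: "Metric_space (vertices I) (distance I)"
  and rep_f: "\<And>i. i \<in> F \<Longrightarrow> representable b (opening_cost I i)"
  and rep_d: "\<And>u v. u \<in> vertices I \<Longrightarrow> v \<in> vertices I \<Longrightarrow> representable b (distance I u v)"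
  using valid by (auto simp: valid_instance_def)

sublocale facility_location n b F C f d lev
proof
  interpret Metric_space "vertices I" "distance I" by (rule metric)
  show "d u w \<le> d u v + d v w" if "u \<in> F \<union> C" "v \<in> F \<union> C" "w \<in> F \<union> C" for u v w
    using triangle[of w v u] that by (simp add: d_def)
  show "d u v = d v u" if "u \<in> F \<union> C" "v \<in> F \<union> C" for u v
    using that commute by (simp add: d_def)
  show "0 \<le> d u v" "d u v = 0 \<or> 1 / 2 ^ b \<le> d u v" "d u v \<le> 2 ^ b"
    if "u \<in> F \<union> C" "v \<in> F \<union> C" for u v
    using representable_grid[OF rep_d[OF that(2,1)]] that by (simp_all add: d_def)
  show "0 \<le> f i" "f i = 0 \<or> 1 / 2 ^ b \<le> f i" "f i \<le> 2 ^ b" if "i \<in> F" for i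
    using representable_grid[OF rep_f[OF that]] that by (simp_all add: f_def)
  show "d u u = 0" if "u \<in> F \<union> C" for u
    using zero[of u u] that by (simp add: d_def)
qed (use n_pos V card_F card_C in \<open>simp_all add: lev_def\<close>)

lemma guess: "g \<le> max_level n b \<Longrightarrow> A g \<noteq> {} \<Longrightarrow> facility_guess n b F C f d lev (A g) (a g) (ch g)"
  by unfold_locales (auto simp: A_def a_def ch_def)

lemma guess_max: "A (max_level n b) \<noteq> {}"
proof -
  have "F \<noteq> {}" using card_F n_pos by auto
  then obtain i where i: "i \<in> F" by blast
  have "2 ^ b * 1 \<le> rad n b (max_level n b) * real n"
    using rad_max_level[OF n_pos, of b] n_pos by (intro mult_mono) auto
  then have "f i \<le> real n * rad n b (max_level n b)" using f_le[OF i] by (simp add: mult.commute)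
  then show ?thesis using i by (auto simp: A_def)
qed

definition score0 :: "nat \<Rightarrow> real" where
  "score0 g = real n * rad n b g + radii_sum n b C (a g) p"
definition g0 :: nat where
  "g0 = arg_min_on score0 {g. g \<le> max_level n b \<and> A g \<noteq> {}}"
definition bound0 :: real where
  "bound0 = (if p = 0 then 0 else 180 * score0 g0)"
definition ops0 :: "(nat \<Rightarrow> nat) \<Rightarrow> nat \<Rightarrow> bool" where
  "ops0 s v = opens n b C (a g0) (arrival n b f (a g0) (ch g0) s) (d v) v"
definition x0 :: "(nat \<Rightarrow> nat) \<Rightarrow> nat \<Rightarrow> nat" where
  "x0 s v = nearest (d v) (opened (A g0) f C (a g0) (ch g0) (ops0 s) (a g0 v))"

lemma g0: "g0 \<le> max_level n b" "A g0 \<noteq> {}" and g0_least: "g \<le> max_level n b \<Longrightarrow> A g \<noteq> {} \<Longrightarrow> score0 g0 \<le> score0 g"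
proof -
  let ?S = "{g. g \<le> max_level n b \<and> A g \<noteq> {}}"
  have S: "finite ?S" "?S \<noteq> {}" using guess_max by auto
  show "g0 \<le> max_level n b" "A g0 \<noteq> {}"
    using arg_min_if_finite(1)[OF S, of score0] unfolding g0_def[symmetric] by auto
  show "g \<le> max_level n b \<Longrightarrow> A g \<noteq> {} \<Longrightarrow> score0 g0 \<le> score0 g"
    using arg_min_least[OF S, of g score0] unfolding g0_def[symmetric] by auto
qed

sublocale G: facility_guess n b F C f d lev "A g0" "a g0" "ch g0"
  by (rule guess[OF g0])

lemma x0_eq: "x0 s = G.x s"
  unfolding x0_def G.x_def ops0_def by (rule ext) simp

definition good :: "(nat \<Rightarrow> nat) \<Rightarrow> bool" where
  "good s \<longleftrightarrow> (\<exists>C' F'. star_solution F C p f (x0 s) (\<lambda>j. d j (x0 s j)) bound0 C' F')"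

lemma card_not_good_le: "2 * card {s\<in>G.\<Omega>. \<not> good s} \<le> card G.\<Omega>"
proof (cases "p = 0")
  case True
  have "star_solution F C p f (x0 s) (\<lambda>j. d j (x0 s j)) bound0 {} {}" for s
    using True by (simp add: star_solution_def bound0_def)
  then have "good s" for s unfolding good_def by blast
  then show ?thesis by simp
next
  case False
  have "2 * card {s\<in>G.\<Omega>. \<nexists>C' F'. star_solution F C p f (G.x s) (\<lambda>j. d j (G.x s j))
    (180 * (real n * rad n b g0 + radii_sum n b C (a g0) p)) C' F'} \<le> card G.\<Omega>"
    by (rule G.card_bad_coins_le) (use False p_le in \<open>auto simp: A_def\<close>)
  then show ?thesis using False by (simp add: good_def x0_eq bound0_def score0_def)
qed

lemma dist_to_eq: "F' \<noteq> {} \<Longrightarrow> dist_to I j F' = ereal (Min ((\<lambda>i. distance I i j) ` F'))"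
  by (simp add: dist_to_def)

lemma cost_le:
  assumes F': "F' \<subseteq> F" and C': "C' \<subseteq> C" and x: "x ` C' \<subseteq> F'"
  shows "cost I C' F' \<le> ereal ((\<Sum>i\<in>F'. f i) + (\<Sum>j\<in>C'. d j (x j)))"
proof -
  have fin: "finite F'" using F' finite_subset by blast
  have "(\<Sum>j\<in>C'. dist_to I j F') \<le> (\<Sum>j\<in>C'. ereal (d j (x j)))"
  proof (intro sum_mono)
    fix j assume j: "j \<in> C'"
    then have xj: "x j \<in> F'" using x by blast
    then have "Min ((\<lambda>i. distance I i j) ` F') \<le> distance I (x j) j" using fin by (intro Min_le) auto
    moreover have "d j (x j) = distance I (x j) j" using xj F' by (auto simp: d_def)
    ultimately show "dist_to I j F' \<le> ereal (d j (x j))" using dist_to_eq[of F' j] xj by (metis empty_iff ereal_less_eq(3))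
  qed
  moreover have "(\<Sum>i\<in>F'. opening_cost I i) = (\<Sum>i\<in>F'. f i)"
    using F' by (intro sum.cong) (auto simp: f_def)
  ultimately show ?thesis unfolding cost_def
    by (simp add: sum_ereal add_left_mono flip: plus_ereal.simps(1))
qed

lemma cost_nonneg:
  assumes "F' \<subseteq> F" "C' \<subseteq> C" shows "0 \<le> cost I C' F'"
proof -
  have fin: "finite F'" using assms finite_subset by blast
  interpret Metric_space "vertices I" "distance I" by (rule metric)
  have "0 \<le> dist_to I j F'" for j
    using fin by (auto simp: dist_to_def Min_ge_iff)
  moreover have "0 \<le> (\<Sum>i\<in>F'. opening_cost I i)"
    using assms(1) rep_f representable_grid(1) by (intro sum_nonneg) auto
  ultimately show ?thesis unfolding cost_def by (intro add_nonneg_nonneg sum_nonneg) auto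
qed

lemma min_cost_attained: "\<exists>C' F'. feasible I C' F' \<and> min_cost I = cost I C' F'"
proof -
  let ?X = "{cost I C' F' | C' F'. feasible I C' F'}"
  have "?X \<subseteq> (\<lambda>(C', F'). cost I C' F') ` (Pow C \<times> Pow F)"
    by (auto simp: feasible_def)
  then have fin: "finite ?X" by (rule finite_subset) auto
  have "feasible I C F" using p_le card_C by (simp add: feasible_def)
  then have ne: "?X \<noteq> {}" by blast
  show ?thesis
    using Min_in[OF fin ne] unfolding min_cost_def by blast
qed

text \<open>An optimal solution suggests a guess whose cap is at most twice its opening cost, and
  \<open>p\<close> of its clients bound the sum of radii by 4 times its cost: together 6. The best
  guess has no larger score. A solution without facilities has infinite cost as
  \<open>p \<ge> 1\<close>.\<close>

lemma score_le_min_cost: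
  assumes p: "p \<ge> 1"
  shows "ereal (score0 g0) \<le> ereal 6 * min_cost I"
proof -
  obtain C' F' where feas: "feasible I C' F'" and opt: "min_cost I = cost I C' F'"
    using min_cost_attained by blast
  have F': "F' \<subseteq> F" and C': "C' \<subseteq> C" and pC: "p \<le> card C'" using feas by (auto simp: feasible_def)
  have finF: "finite F'" and finC: "finite C'" using F' C' finite_subset by blast+
  show ?thesis
  proof (cases "F' = {}")
    case True
    have "C' \<noteq> {}" using pC p by auto
    then obtain j where "j \<in> C'" by blast
    then have "(\<Sum>j\<in>C'. dist_to I j F') = \<infinity>"
      using True finC by (subst sum_Pinfty) (auto simp: dist_to_def)
    then have "min_cost I = \<infinity>" using opt True by (simp add: cost_def)
    then show ?thesis by simp
  next
    case ne: False
    obtain D where D: "D \<subseteq> C'" "card D = p" using pC by (meson obtain_subset_with_card_n)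
    define \<pi> where "\<pi> j = arg_min_on (\<lambda>i. distance I i j) F'" for j
    have \<pi>: "\<pi> j \<in> F'" for j unfolding \<pi>_def by (rule arg_min_if_finite(1)[OF finF ne])
    have \<pi>_least: "distance I (\<pi> j) j \<le> distance I i j" if "i \<in> F'" for i j
      unfolding \<pi>_def using arg_min_least[OF finF ne that] .
    have dist: "dist_to I j F' = ereal (d (\<pi> j) j)" if "j \<in> C'" for j
    proof -
      have "Min ((\<lambda>i. distance I i j) ` F') = distance I (\<pi> j) j"
        using finF \<pi> \<pi>_least by (intro Min_eqI) auto
      moreover have "d (\<pi> j) j = distance I (\<pi> j) j"
        using that C' \<pi> F' Metric_space.commute[OF metric] by (auto simp: d_def)
      ultimately show ?thesis using ne by (simp add: dist_to_eq)
    qed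
    have sum_f: "(\<Sum>i\<in>F'. opening_cost I i) = (\<Sum>i\<in>F'. f i)"
      using F' by (intro sum.cong) (auto simp: f_def)
    have cost: "cost I C' F' = ereal ((\<Sum>i\<in>F'. f i) + (\<Sum>j\<in>C'. d (\<pi> j) j))"
      unfolding cost_def sum_f using dist by (simp add: sum_ereal)
    obtain g where g: "g \<le> max_level n b" "\<And>i. i \<in> F' \<Longrightarrow> f i \<le> real n * rad n b g"
        "real n * rad n b g \<le> 2 * (\<Sum>i\<in>F'. f i)"
      using guess_exists[OF F' ne] by blast
    have F'A: "F' \<subseteq> A g" using F' g(2) by (auto simp: A_def)
    then have Ag: "A g \<noteq> {}" using ne by blast
    interpret H: facility_guess n b F C f d lev "A g" "a g" "ch g" by (rule guess[OF g(1) Ag])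
    have DC: "D \<subseteq> C" using D C' by blast
    have "radii_sum n b C (a g) p \<le> (\<Sum>j\<in>D. rad n b (a g j))"
      by (rule radii_sum_le[OF p DC D(2)])
    also have "\<dots> \<le> 4 * ((\<Sum>i\<in>F'. f i) + (\<Sum>j\<in>D. d (\<pi> j) j))"
      by (rule H.sum_rad_le[OF DC F'A \<pi>])
    also have "(\<Sum>j\<in>D. d (\<pi> j) j) \<le> (\<Sum>j\<in>C'. d (\<pi> j) j)"
      using D(1) finC C' F' \<pi> d_nonneg by (intro sum_mono2) blast+
    finally have le: "radii_sum n b C (a g) p \<le> 4 * ((\<Sum>i\<in>F'. f i) + (\<Sum>j\<in>C'. d (\<pi> j) j))" by simp
    have nn: "0 \<le> (\<Sum>j\<in>C'. d (\<pi> j) j)" using C' F' \<pi> d_nonneg by (intro sum_nonneg) blast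
    have "r \<le> 4 * (y + z) \<Longrightarrow> 0 \<le> z \<Longrightarrow> w \<le> 2 * y \<Longrightarrow> w + r \<le> 6 * (y + z)" for r y z w :: real
      by (simp add: algebra_simps)
    from this[OF le nn g(3)] have "score0 g \<le> 6 * ((\<Sum>i\<in>F'. f i) + (\<Sum>j\<in>C'. d (\<pi> j) j))"
      unfolding score0_def .
    then have "score0 g0 \<le> 6 * ((\<Sum>i\<in>F'. f i) + (\<Sum>j\<in>C'. d (\<pi> j) j))"
      using g0_least[OF g(1) Ag] by linarith
    then show ?thesis unfolding opt cost by simp
  qed
qed

lemma star_solution_approx:
  assumes "star_solution F C p f x (\<lambda>j. d j (x j)) bound0 C' F'"
  shows "approx_solution 1080 I C' F'"
proof -
  have S: "F' \<subseteq> F" "C' \<subseteq> C" "p \<le> card C'" "x ` C' \<subseteq> F'"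
    and le: "(\<Sum>i\<in>F'. f i) + (\<Sum>j\<in>C'. d j (x j)) \<le> bound0"
    using assms by (auto simp: star_solution_def)
  have "cost I C' F' \<le> ereal bound0"
    using cost_le[OF S(1,2,4)] le by (meson ereal_less_eq(3) order_trans)
  also have "\<dots> \<le> ereal 1080 * min_cost I"
  proof (cases "p = 0")
    case True
    obtain C1 F1 where "feasible I C1 F1" "min_cost I = cost I C1 F1" using min_cost_attained by blast
    then have "0 \<le> min_cost I" using cost_nonneg by (simp add: feasible_def)
    then have "0 \<le> ereal 1080 * min_cost I" by (simp add: ereal_0_le_mult)
    then show ?thesis using True by (simp add: bound0_def flip: zero_ereal_def)
  next
    case False
    have "ereal bound0 = ereal 180 * ereal (score0 g0)" using False by (simp add: bound0_def)
    also have "\<dots> \<le> ereal 180 * (ereal 6 * min_cost I)"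
      using score_le_min_cost False by (intro ereal_mult_left_mono) auto
    also have "\<dots> = ereal 1080 * min_cost I" by (simp add: mult.assoc[symmetric])
    finally show ?thesis .
  qed
  finally show ?thesis using S by (simp add: approx_solution_def feasible_def)
qed

end

section \<open>Runs of the protocol\<close>

context rfl_input
begin

abbreviation "W \<equiv> word_bits n b"
abbreviation "\<kappa> \<equiv> copies n"
abbreviation "mlen \<equiv> msg_len n b"
abbreviation "pw v k \<equiv> private_word n b (explicit_input I v) k mod 2 ^ W"
abbreviation "pm cs v \<equiv> private_input n b (explicit_input I v) @ cs v"
abbreviation "sd \<equiv> seed n"
abbreviation "R K \<equiv> word_at n b K"

lemma V_lt: "v \<in> vertices I \<Longrightarrow> v < 2 * n"
  using V by auto

lemma pm_nth: "k < 4 * n + 5 \<Longrightarrow> pm cs v ! k = pw v k"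
  by (simp add: private_input_def nth_append)

lemma pm_coin: "pm cs v ! (4 * n + (5 + c)) = cs v ! c"
  by (simp add: private_input_def nth_append)

lemma pw_dist:
  assumes "v \<in> vertices I" "u \<in> vertices I"
  shows "pw v (2 * u) = numer b (distance I u v)" and "pw v (2 * u + 1) = denom b (distance I u v)"
proof -
  have u: "u < 2 * n" using V_lt assms by blast
  have "private_word n b (explicit_input I v) (2 * u) = numer b (distance I u v)"
    "private_word n b (explicit_input I v) (2 * u + 1) = denom b (distance I u v)"
    using assms u by (auto simp: private_word_def explicit_input_def)
  then show "pw v (2 * u) = numer b (distance I u v)" "pw v (2 * u + 1) = denom b (distance I u v)"
    using numer_denom[OF rep_d[OF assms(2,1)]] by (simp_all add: mod_word)
qed

lemma one_lt: "Suc 0 mod 2 ^ W = Suc 0"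
  using mod_word[of "Suc 0" b n] n_pos by simp

lemma pw_facility: "pw v (4 * n) = of_bool (v \<in> F)"
  using one_lt by (auto simp: private_word_def explicit_input_def)

lemma pw_client: "pw v (4 * n + 1) = of_bool (v \<in> C)"
  using one_lt by (auto simp: private_word_def explicit_input_def)

lemma pw_cost:
  assumes "v \<in> F"
  shows "pw v (4 * n + 2) = numer b (opening_cost I v)" and "pw v (4 * n + 3) = denom b (opening_cost I v)"
  using assms numer_denom[OF rep_f[OF assms]]
  by (auto simp: private_word_def explicit_input_def intro!: mod_word)

lemma pw_coverage: "pw v (4 * n + 4) = (if v \<in> vertices I then p else 0)"
  using p_le mod_word[of p b n] by (auto simp: private_word_def explicit_input_def)

text \<open>After \<open>r\<close> blocks, the transcript holds the intended values for the coins
  \<open>\<sigma>\<close>. These are the coins in force; after a restart they may differ from the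
  private ones kept in the memories.\<close>

definition inv :: "nat \<Rightarrow> (nat \<Rightarrow> nat) \<Rightarrow> words \<Rightarrow> bool" where
  "inv r \<sigma> K \<longleftrightarrow> r \<le> 5 \<and> length K = r * block_len n b \<and> set K \<subseteq> {..<2 ^ W} \<and> \<sigma> \<in> all_coins n \<and>
    (1 \<le> r \<longrightarrow> (\<forall>v<2 * n. (\<forall>k<5. R K 0 v k = pw v (4 * n + k)) \<and>
      (\<forall>c<\<kappa>. R K 0 v (5 + c) = \<sigma> (v * \<kappa> + c)))) \<and>
    (2 \<le> r \<longrightarrow> (\<forall>v\<in>F. R K 1 v 0 = lev v)) \<and>
    (3 \<le> r \<longrightarrow> (\<forall>v\<in>C. \<forall>g\<le>L. A g \<noteq> {} \<longrightarrow> R K 2 v (2 * g) = a g v \<and> R K 2 v (2 * g + 1) = ch g v)) \<and>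
    (4 \<le> r \<longrightarrow> (\<forall>v\<in>C. \<forall>c<\<kappa>. R K 3 v c = of_bool (ops0 (sd \<sigma> c) v))) \<and>
    (5 \<le> r \<longrightarrow> (\<forall>v\<in>C. \<forall>c<\<kappa>. R K 4 v (3 * c) = x0 (sd \<sigma> c) v \<and>
      real (R K 4 v (3 * c + 1)) / real (R K 4 v (3 * c + 2)) = d v (x0 (sd \<sigma> c) v)))"

lemma block_len_pos: "0 < block_len n b"
  using n_pos by (simp add: block_len_def msg_len_def)

lemma rounds_done_inv: "inv r \<sigma> K \<Longrightarrow> rounds_done n b K = r"
  using block_len_pos by (simp add: inv_def rounds_done_def)

lemma block0:
  assumes "inv r \<sigma> K" "1 \<le> r" "v < 2 * n"
  shows "k < 5 \<Longrightarrow> R K 0 v k = pw v (4 * n + k)" and "c < \<kappa> \<Longrightarrow> R K 0 v (5 + c) = \<sigma> (v * \<kappa> + c)"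
  using assms by (auto simp: inv_def)

section \<open>Decoding a transcript that satisfies the invariant\<close>

context
  fixes r \<sigma> K
  assumes inv: "inv r \<sigma> K" and r1: "1 \<le> r"
begin

lemma known_F: "known_F n (R K) = F"
proof -
  have "R K 0 v 0 = of_bool (v \<in> F)" if "v < 2 * n" for v
    using block0(1)[OF inv r1 that, of 0] pw_facility[of v] by simp
  then have "R K 0 v 0 = 1 \<longleftrightarrow> v \<in> F" if "v < 2 * n" for v using that by (simp only: of_bool_eq_1_iff)
  then have "known_F n (R K) = {v\<in>{..<2 * n}. v \<in> F}" unfolding known_F_def by blast
  then show ?thesis using V by blast
qed

lemma known_C: "known_C n (R K) = C"
proof -
  have "R K 0 v 1 = of_bool (v \<in> C)" if "v < 2 * n" for v
    using block0(1)[OF inv r1 that, of 1] pw_client[of v] by simp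
  then have "R K 0 v 1 = 1 \<longleftrightarrow> v \<in> C" if "v < 2 * n" for v using that by (simp only: of_bool_eq_1_iff)
  then have "known_C n (R K) = {v\<in>{..<2 * n}. v \<in> C}" unfolding known_C_def by blast
  then show ?thesis using V by blast
qed

lemma known_cost: "known_cost n (R K) = f"
proof
  fix v
  show "known_cost n (R K) v = f v"
  proof (cases "v \<in> F")
    case True
    then have v: "v < 2 * n" using V by auto
    show ?thesis
      using block0(1)[OF inv r1 v, of 2] block0(1)[OF inv r1 v, of 3] pw_cost[OF True]
        numer_denom(3)[OF rep_f[OF True]] True
      by (simp add: known_cost_def known_F f_def)
  qed (simp add: known_cost_def known_F f_def)
qed

lemma known_coverage: "known_coverage n (R K) = p"
proof -
  have R4: "R K 0 v 4 = (if v \<in> vertices I then p else 0)" if "v < 2 * n" for v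
    using block0(1)[OF inv r1 that, of 4] pw_coverage[of v] by simp
  have "F \<noteq> {}" using card_F n_pos by auto
  then obtain v where "v \<in> F" by blast
  then have v: "v \<in> vertices I" "v < 2 * n" using V by auto
  show ?thesis unfolding known_coverage_def
  proof (rule Max_eqI)
    show "p \<in> (\<lambda>v. R K 0 v 4) ` {..<2 * n}" using R4[OF v(2)] v by (intro image_eqI[of _ _ v]) auto
  qed (use R4 in auto)
qed

lemma known_coins: "c < \<kappa> \<Longrightarrow> known_coins n (R K) c = sd \<sigma> c"
  unfolding known_coins_def seed_def
  by (rule ext) (simp add: restrict_def block0(2)[OF inv r1])

lemma row:
  assumes "v \<in> vertices I"
  shows "row n (R K) (pm cs v) = d v"
proof
  fix u
  show "row n (R K) (pm cs v) u = d v u"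
  proof (cases "u \<in> vertices I")
    case True
    then have "2 * u + 1 < 4 * n + 5" "2 * u < 4 * n + 5" using V_lt[OF True] by auto
    then have "pm cs v ! (2 * u) = numer b (distance I u v)" "pm cs v ! (2 * u + 1) = denom b (distance I u v)"
      using pm_nth pw_dist[OF assms True] by simp_all
    then show ?thesis using True numer_denom(3)[OF rep_d[OF True assms]]
      by (simp add: row_def known_F known_C d_def)
  qed (simp add: row_def known_F known_C d_def)
qed

lemma known_A: "known_A n b (R K) = A"
  by (rule ext) (simp add: known_A_def A_def known_F known_cost)

lemma known_lev: "2 \<le> r \<Longrightarrow> known_lev n (R K) = lev"
  using inv by (intro ext) (auto simp: known_lev_def known_F inv_def lev_def)

context
  assumes r3: "3 \<le> r"
begin

lemma known_level: "known_level n b (R K) = a"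
  using inv r3 by (intro ext) (auto simp: known_level_def known_C known_A inv_def a_def)

lemma known_ch: "known_ch n b (R K) = ch"
  using inv r3 by (intro ext) (auto simp: known_ch_def known_C known_A inv_def ch_def)

lemma known_score: "score n b (R K) = score0"
  by (rule ext) (simp add: score_def score0_def known_C known_level known_coverage)

lemma best_guess: "best_guess n b (R K) = g0"
  by (simp add: best_guess_def g0_def known_score known_A)

lemma bound: "bound n b (R K) = bound0"
  by (simp add: bound_def bound0_def known_score best_guess known_coverage)

lemma known_opens: "4 \<le> r \<Longrightarrow> c < \<kappa> \<Longrightarrow> known_opens n (R K) c = (\<lambda>v. v \<in> C \<and> ops0 (sd \<sigma> c) v)"
  using inv by (intro ext) (auto simp: known_opens_def known_C inv_def of_bool_eq_1_iff simp del: One_nat_def)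

lemma offer: "4 \<le> r \<Longrightarrow> c < \<kappa> \<Longrightarrow> v \<in> C \<Longrightarrow> offer n b (R K) (pm cs v) v c = x0 (sd \<sigma> c) v"
  by (simp add: offer_def x0_def row known_A known_cost known_C known_level known_ch known_opens best_guess
      opened_guard)

lemma accepts:
  assumes "5 \<le> r" "c < \<kappa>"
  shows "accepts n b (R K) c C' F' \<longleftrightarrow>
    star_solution F C p f (x0 (sd \<sigma> c)) (\<lambda>j. d j (x0 (sd \<sigma> c) j)) bound0 C' F'"
  unfolding accepts_def known_F known_C known_coverage known_cost bound
  by (rule star_solution_cong) (use assms inv in \<open>auto simp: inv_def\<close>)

end

end

definition good_coins :: "(nat \<Rightarrow> nat) \<Rightarrow> bool" where
  "good_coins \<sigma> \<longleftrightarrow> (\<exists>c<\<kappa>. good (sd \<sigma> c))"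

lemma accepting_iff:
  assumes "inv r \<sigma> K"
  shows "accepting n b K \<longleftrightarrow> r = 5 \<and> good_coins \<sigma>"
proof (cases "r = 5")
  case True
  then have "accepts n b (R K) c C' F' \<longleftrightarrow>
      star_solution F C p f (x0 (sd \<sigma> c)) (\<lambda>j. d j (x0 (sd \<sigma> c) j)) bound0 C' F'" if "c < \<kappa>" for c C' F'
    using accepts[OF assms _ _ _ that] by simp
  then show ?thesis using True rounds_done_inv[OF assms]
    unfolding accepting_def good_coins_def good_def by blast
next
  case False
  then show ?thesis using rounds_done_inv[OF assms] by (simp add: accepting_def)
qed

lemma solution_approx:
  assumes "inv r \<sigma> K" and "accepting n b K"
  shows "approx_solution 1080 I (fst (solution n b K)) (snd (solution n b K))"
proof -
  let ?P = "\<lambda>S. \<exists>c<\<kappa>. accepts n b (R K) c (fst S) (snd S)"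
  have r: "r = 5" using accepting_iff assms by blast
  have "\<exists>S. ?P S" using assms(2) by (auto simp: accepting_def)
  then have "?P (SOME S. ?P S)" by (rule someI_ex)
  then have "?P (solution n b K)" by (simp add: solution_def case_prod_unfold)
  then obtain c where c: "c < \<kappa>" "accepts n b (R K) c (fst (solution n b K)) (snd (solution n b K))" by blast
  then show ?thesis using accepts[OF assms(1) _ _ _ c(1)] r star_solution_approx by simp
qed

section \<open>One round of communication\<close>

definition exchange :: "(nat \<Rightarrow> words) \<Rightarrow> words \<Rightarrow> nat \<Rightarrow> words" where
  "exchange cs K j = (if j < 2 * n then message n b j (pm cs j) K else [])"

lemma message_length: "length (message n b v m K) = mlen"
  by (simp add: message_def)

lemma message_words: "set (message n b v m K) \<subseteq> {..<2 ^ W}"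
  by (auto simp: message_def)

lemma extend_eq:
  "inv r \<sigma> K \<Longrightarrow> r < 5 \<Longrightarrow> extend n b K rcv = K @ map (\<lambda>i. rcv (i div mlen) ! (i mod mlen)) [0..<block_len n b]"
  using rounds_done_inv[of r \<sigma> K] unfolding extend_def by simp

lemma inv_length: "inv r \<sigma> K \<Longrightarrow> length K = r * block_len n b"
  by (simp add: inv_def)

lemma new_word:
  assumes inv: "inv r \<sigma> K" and r: "r < 5" and v: "v < 2 * n" and k: "k < mlen"
  shows "R (extend n b K (exchange cs K)) r v k = message_word n b (R K) r (pm cs v) v k mod 2 ^ W"
proof -
  have "R (extend n b K (exchange cs K)) r v k
      = exchange cs K ((v * mlen + k) div mlen) ! ((v * mlen + k) mod mlen)"
    unfolding extend_eq[OF inv r] by (rule word_at_append_last[OF inv_length[OF inv] v k])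
  also have "\<dots> = exchange cs K v ! k" by (simp only: block_index(1,2)[OF v k])
  also have "\<dots> = message_word n b (R K) r (pm cs v) v k mod 2 ^ W"
    unfolding exchange_def message_def rounds_done_inv[OF inv] using v k by simp
  finally show ?thesis .
qed

lemma old_word:
  assumes inv: "inv r \<sigma> K" and r: "r < 5" and "r' < r" "v < 2 * n" "k < mlen"
  shows "R (extend n b K rcv) r' v k = R K r' v k"
  unfolding extend_eq[OF inv r] by (rule word_at_append[OF inv_length[OF inv]]) fact+

lemma extend_length: "inv r \<sigma> K \<Longrightarrow> r < 5 \<Longrightarrow> length (extend n b K rcv) = Suc r * block_len n b"
  using inv_length[of r \<sigma> K] by (simp add: extend_eq)

lemma extend_words:
  assumes "inv r \<sigma> K" "r < 5"
  shows "set (extend n b K (exchange cs K)) \<subseteq> {..<2 ^ W}"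
proof -
  have "exchange cs K (i div mlen) ! (i mod mlen) < 2 ^ W" if "i < block_len n b" for i
  proof -
    let ?m = "message n b (i div mlen) (pm cs (i div mlen)) K"
    have "i div mlen < 2 * n" using that by (simp add: block_len_def less_mult_imp_div_less)
    then have eq: "exchange cs K (i div mlen) = ?m" by (simp add: exchange_def)
    have "i mod mlen < length ?m" unfolding message_length by (simp add: msg_len_def)
    then have "?m ! (i mod mlen) \<in> set ?m" by (rule nth_mem)
    then show ?thesis unfolding eq using message_words by blast
  qed
  moreover have "set K \<subseteq> {..<2 ^ W}" using assms(1) by (simp add: inv_def)
  ultimately show ?thesis unfolding extend_eq[OF assms] by auto
qed

definition coins_of :: "(nat \<Rightarrow> words) \<Rightarrow> nat \<Rightarrow> nat" where
  "coins_of cs = restrict (\<lambda>y. cs (y div \<kappa>) ! (y mod \<kappa>)) {..<2 * n * \<kappa>}"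

lemma coins_of:
  assumes "\<And>v. v < 2 * n \<Longrightarrow> cs v \<in> coin_lists n"
  shows "coins_of cs \<in> all_coins n"
    and "v < 2 * n \<Longrightarrow> c < \<kappa> \<Longrightarrow> coins_of cs (v * \<kappa> + c) = cs v ! c" and "v < 2 * n \<Longrightarrow> c < \<kappa> \<Longrightarrow> cs v ! c < n"
proof -
  have lt: "cs v ! c < n" if "v < 2 * n" "c < \<kappa>" for v c
  proof -
    have "cs v ! c \<in> set (cs v)" "set (cs v) \<subseteq> {..<n}"
      using assms[OF that(1)] that(2) by (auto simp: coin_lists_def)
    then show ?thesis by blast
  qed
  then show "v < 2 * n \<Longrightarrow> c < \<kappa> \<Longrightarrow> cs v ! c < n" .
  show "coins_of cs \<in> all_coins n"
    unfolding coins_of_def all_coins_def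
    using lt copies_pos[of n] by (auto simp: less_mult_imp_div_less)
  show "v < 2 * n \<Longrightarrow> c < \<kappa> \<Longrightarrow> coins_of cs (v * \<kappa> + c) = cs v ! c"
    using block_index[of v "2 * n" c \<kappa>] by (simp add: coins_of_def)
qed

lemma inv_0: "\<sigma> \<in> all_coins n \<Longrightarrow> inv 0 \<sigma> []"
  by (simp add: inv_def)

text \<open>The private coins are read in round 0 only; later rounds take the coins from the
  transcript. Tying \<open>\<sigma>\<close> to them just for \<open>r = 0\<close> makes the lemma
  applicable after a restart.\<close>

lemma inv_extend:
  assumes inv: "inv r \<sigma> K" and r: "r < 5" and cs: "\<And>v. v < 2 * n \<Longrightarrow> cs v \<in> coin_lists n"
    and \<sigma>: "r = 0 \<Longrightarrow> \<sigma> = coins_of cs"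
  shows "inv (Suc r) \<sigma> (extend n b K (exchange cs K))" (is "inv _ _ ?K")
proof -
  note new = new_word[OF inv r, of _ _ cs] and old = old_word[OF inv r]
  have inv': "r \<le> 5 \<and> length K = r * block_len n b \<and> set K \<subseteq> {..<2 ^ W} \<and> \<sigma> \<in> all_coins n"
    using inv by (simp add: inv_def)
  have b0: "R ?K 0 v k = pw v (4 * n + k)" if "v < 2 * n" "k < 5" for v k
  proof (cases "r = 0")
    case True
    have "k < mlen" using that by (simp add: msg_len_def)
    then show ?thesis using new[OF that(1), of k] True that pm_nth[of "4 * n + k" v cs]
      by (simp add: message_word_def)
  next
    case False
    have "k < mlen" using that by (simp add: msg_len_def)
    then show ?thesis using old[of 0 v k] block0(1)[OF inv _ that] False that by simp
  qed
  have b0': "R ?K 0 v (5 + c) = \<sigma> (v * \<kappa> + c)" if "v < 2 * n" "c < \<kappa>" for v c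
  proof (cases "r = 0")
    case True
    have "5 + c < mlen" using that le_msg_len(1)[of n b] by linarith
    moreover have "cs v ! c mod 2 ^ W = cs v ! c"
      using coins_of(3)[of cs v c, OF cs that] by (intro mod_word) simp
    ultimately show ?thesis using new[OF that(1), of "5 + c"] True that pm_coin[of v cs c]
        coins_of(2)[of cs v c, OF cs that] \<sigma>[OF True]
      by (simp add: message_word_def del: append_assoc)
  next
    case False
    have "5 + c < mlen" using that le_msg_len(1)[of n b] by linarith
    then show ?thesis using old[of 0 v "5 + c"] block0(2)[OF inv _ that] False that by simp
  qed
  have b1: "R ?K 1 v 0 = lev v" if "1 \<le> r" "v \<in> F" for v
  proof -
    have v: "v < 2 * n" and v': "v \<in> vertices I" using that V by auto
    have l: "0 < mlen" by (simp add: msg_len_def)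
    show ?thesis
    proof (cases "r = 1")
      case True
      have "R ?K 1 v 0 = lev v mod 2 ^ W"
        using new[OF v l] True known_C[OF inv] known_cost[OF inv] row[OF inv _ v', where cs = cs] that
        by (simp add: message_word_def lev_def)
      then show ?thesis using lev_le[OF that(2)] by (simp add: mod_word)
    next
      case False
      then show ?thesis using old[of 1 v 0] v l that inv by (simp add: inv_def)
    qed
  qed
  have b2: "R ?K 2 v (2 * g) = a g v \<and> R ?K 2 v (2 * g + 1) = ch g v"
    if "2 \<le> r" "v \<in> C" "g \<le> L" "A g \<noteq> {}" for v g
  proof -
    interpret H: facility_guess n b F C f d lev "A g" "a g" "ch g" by (rule guess[OF that(3,4)])
    have v: "v < 2 * n" and v': "v \<in> vertices I" using that V by auto
    have l: "2 * g < mlen" "2 * g + 1 < mlen" using le_msg_len(2)[OF that(3)] by auto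
    have r1: "1 \<le> r" using that by simp
    show ?thesis
    proof (cases "r = 2")
      case True
      have ch: "ch g v < 2 * n" using H.ch_F[OF that(2)] V by auto
      have "R ?K 2 v (2 * g) = a g v mod 2 ^ W" "R ?K 2 v (2 * g + 1) = ch g v mod 2 ^ W"
        using new[OF v l(1)] new[OF v l(2)] True that known_A[OF inv r1] known_lev[OF inv r1 that(1)]
          known_cost[OF inv r1] row[OF inv r1 v', where cs = cs]
        by (simp_all add: message_word_def a_def ch_def)
      then show ?thesis using H.a_le_L[OF that(2)] ch by (simp add: mod_word)
    next
      case False
      then show ?thesis using old[of 2 v "2 * g"] old[of 2 v "2 * g + 1"] v l that inv by (simp add: inv_def)
    qed
  qed
  have b3: "R ?K 3 v c = of_bool (ops0 (sd \<sigma> c) v)" if "3 \<le> r" "v \<in> C" "c < \<kappa>" for v c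
  proof -
    have v: "v < 2 * n" and v': "v \<in> vertices I" using that V by auto
    have l: "c < mlen" using le_msg_len(4)[OF that(3)] .
    have r1: "1 \<le> r" using that by simp
    show ?thesis
    proof (cases "r = 3")
      case True
      have "R ?K 3 v c = of_bool (ops0 (sd \<sigma> c) v) mod 2 ^ W"
        using new[OF v l] True that known_C[OF inv r1] known_cost[OF inv r1] row[OF inv r1 v', where cs = cs]
          known_coins[OF inv r1 that(3)] known_level[OF inv r1 that(1)] known_ch[OF inv r1 that(1)]
          best_guess[OF inv r1 that(1)]
        by (simp add: message_word_def ops0_def)
      then show ?thesis using one_lt by simp
    next
      case False
      then show ?thesis using old[of 3 v c] v l that inv by (simp add: inv_def)
    qed
  qed
  have b4: "R ?K 4 v (3 * c) = x0 (sd \<sigma> c) v \<and>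
      real (R ?K 4 v (3 * c + 1)) / real (R ?K 4 v (3 * c + 2)) = d v (x0 (sd \<sigma> c) v)"
    if "4 \<le> r" "v \<in> C" "c < \<kappa>" for v c
  proof -
    have v: "v < 2 * n" and v': "v \<in> vertices I" using that V by auto
    have l: "3 * c < mlen" "3 * c + 1 < mlen" "3 * c + 2 < mlen" using le_msg_len(3)[OF that(3), of b] by auto
    have r1: "1 \<le> r" and r3: "3 \<le> r" and r4: "r = 4" using that r by auto
    let ?x = "x0 (sd \<sigma> c) v"
    have "?x \<in> F" unfolding x0_eq by (rule G.x_F[OF that(2)])
    then have x: "?x < 2 * n" and x': "?x \<in> vertices I" using V by auto
    have x'': "2 * ?x < 4 * n + 5" "2 * ?x + 1 < 4 * n + 5" using x by auto
    note off = offer[OF inv r1 r3 that(1,3,2), where cs = cs]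
    have div: "3 * c div 3 = c" "(3 * c + 1) div 3 = c" "(3 * c + 2) div 3 = c"
      "3 * c mod 3 = 0" "(3 * c + 1) mod 3 = 1" "(3 * c + 2) mod 3 = 2" by presburger+
    have "R ?K 4 v (3 * c) = ?x mod 2 ^ W"
      using new[OF v l(1)] r4 off unfolding message_word_def div by simp
    moreover have "R ?K 4 v (3 * c + 1) = numer b (distance I ?x v)"
      using new[OF v l(2)] r4 off pm_nth[OF x''(1), of v cs] pw_dist(1)[OF v' x']
      unfolding message_word_def div by (simp add: mod_word numer_denom(1,2)[OF rep_d[OF x' v']])
    moreover have "R ?K 4 v (3 * c + 2) = denom b (distance I ?x v)"
      using new[OF v l(3)] r4 off pm_nth[OF x''(2), of v cs] pw_dist(2)[OF v' x']
      unfolding message_word_def div by (simp add: mod_word numer_denom(1,2)[OF rep_d[OF x' v']])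
    ultimately show ?thesis
      using x x' numer_denom(3)[OF rep_d[OF x' v']] by (simp add: mod_word d_def)
  qed
  show ?thesis unfolding inv_def
    using inv' r extend_length[OF inv r] extend_words[OF inv r, of cs] b0 b0' b1 b2 b3 b4 by simp
qed

end

text \<open>Enumerate \<open>S\<close> and add 1 modulo its size.\<close>

lemma cyclic_successor_exists:
  assumes "finite S"
  shows "\<exists>h. \<forall>x\<in>S. h x \<in> S \<and> (\<forall>y\<in>S. \<exists>m. (h ^^ m) x = y)"
proof -
  let ?N = "card S"
  obtain e where e: "bij_betw e {0..<?N} S" using ex_bij_betw_nat_finite[OF assms] by blast
  define h where "h x = e ((the_inv_into {0..<?N} e x + 1) mod ?N)" for x
  have h_e: "h (e i) = e ((i + 1) mod ?N)" if "i < ?N" for i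
    using that e by (simp add: h_def the_inv_into_f_f bij_betw_def)
  have pow: "(h ^^ m) (e i) = e ((i + m) mod ?N)" if "i < ?N" for i m
  proof (induction m)
    case (Suc m)
    have "(i + m) mod ?N < ?N" using that by simp
    then show ?case using Suc h_e by (simp add: mod_Suc_eq)
  qed (use that in simp)
  have "h x \<in> S \<and> (\<forall>y\<in>S. \<exists>m. (h ^^ m) x = y)" if x: "x \<in> S" for x
  proof -
    have surj: "\<exists>i<?N. y = e i" if "y \<in> S" for y
      using that bij_betw_imp_surj_on[OF e] by (metis atLeastLessThan_iff imageE)
    obtain i where i: "i < ?N" "x = e i" using surj[OF x] by blast
    have "(i + 1) mod ?N < ?N" using i by simp
    then have "h x \<in> S" using h_e[OF i(1)] i e by (auto simp: bij_betw_def)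
    moreover have "\<exists>m. (h ^^ m) x = y" if "y \<in> S" for y
    proof -
      obtain j where j: "j < ?N" "y = e j" using surj[OF \<open>y \<in> S\<close>] by blast
      have "(i + (?N - i + j)) mod ?N = j" using i j by simp
      then show ?thesis using pow[OF i(1), of "?N - i + j"] i j by auto
    qed
    ultimately show ?thesis by blast
  qed
  then show ?thesis by blast
qed

lemma next_coins:
  assumes "\<sigma> \<in> all_coins n"
  shows "next_coins n \<sigma> \<in> all_coins n" and "\<sigma>' \<in> all_coins n \<Longrightarrow> \<exists>m. (next_coins n ^^ m) \<sigma> = \<sigma>'"
proof -
  have "finite (all_coins n)" unfolding all_coins_def by (intro finite_PiE) auto
  from someI_ex[OF cyclic_successor_exists[OF this]]
  show "next_coins n \<sigma> \<in> all_coins n" "\<sigma>' \<in> all_coins n \<Longrightarrow> \<exists>m. (next_coins n ^^ m) \<sigma> = \<sigma>'"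
    unfolding next_coins_def[symmetric] using assms by blast+
qed

lemma card_coin_lists: "card (coin_lists n) = n ^ copies n"
proof -
  have "coin_lists n = {xs. set xs \<subseteq> {..<n} \<and> length xs = copies n}" by (auto simp: coin_lists_def)
  then show ?thesis using card_lists_length_eq[of "{..<n}" "copies n"] by simp
qed

lemma finite_coin_lists [simp]: "finite (coin_lists n)"
proof -
  have "coin_lists n = {xs. set xs \<subseteq> {..<n} \<and> length xs = copies n}" by (auto simp: coin_lists_def)
  then show ?thesis using finite_lists_length_eq[of "{..<n}" "copies n"] by simp
qed

definition memory_bound :: "nat \<Rightarrow> nat \<Rightarrow> nat" where
  "memory_bound n b = private_len n + 5 * block_len n b"

section \<open>Restarts, transcripts and the distribution of runs\<close>

context rfl_input
begin

lemma stored_coins: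
  assumes "inv r \<sigma> K" and "1 \<le> r"
  shows "stored_coins n b K = \<sigma>"
proof
  fix y
  show "stored_coins n b K y = \<sigma> y"
  proof (cases "y < 2 * n * \<kappa>")
    case True
    have "y div \<kappa> < 2 * n" using True by (simp add: less_mult_imp_div_less)
    moreover have "y mod \<kappa> < \<kappa>" using copies_pos by simp
    ultimately show ?thesis using True block0(2)[OF assms, of "y div \<kappa>" "y mod \<kappa>"]
      by (simp add: stored_coins_def)
  next
    case False
    have "\<sigma> \<in> all_coins n" using assms(1) by (simp add: inv_def)
    then have "\<sigma> \<in> extensional {..<2 * n * \<kappa>}" by (simp add: all_coins_def PiE_def)
    then show ?thesis using False by (simp add: stored_coins_def extensional_def)
  qed
qed

text \<open>Dropping blocks 3 and 4 removes the clauses about values computed from the coins; what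
  remains is to replace the coins themselves in block 0.\<close>

lemma inv_restart:
  assumes inv: "inv 5 \<sigma> K"
  shows "inv 3 (next_coins n \<sigma>) (restart n b K)"
proof -
  let ?s = "next_coins n \<sigma>" and ?K = "restart n b K" and ?bl = "block_len n b"
  let ?c = "\<lambda>i. i < ?bl \<and> 5 \<le> i mod mlen \<and> i mod mlen < 5 + \<kappa>"
  have len: "length K = 5 * ?bl" and words: "set K \<subseteq> {..<2 ^ W}" and \<sigma>: "\<sigma> \<in> all_coins n"
    using inv by (simp_all add: inv_def)
  have s: "?s \<in> all_coins n" by (rule next_coins(1)[OF \<sigma>])
  have K: "?K ! i = (if ?c i then ?s (i div mlen * \<kappa> + (i mod mlen - 5)) else K ! i)" if "i < 3 * ?bl" for i
    using that stored_coins[OF inv] by (simp add: restart_def)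
  have len': "length ?K = 3 * ?bl" by (simp add: restart_def)
  have words': "set ?K \<subseteq> {..<2 ^ W}"
  proof
    fix w assume "w \<in> set ?K"
    then obtain i where i: "i < 3 * ?bl" "w = ?K ! i" unfolding in_set_conv_nth len' by blast
    show "w \<in> {..<2 ^ W}"
    proof (cases "?c i")
      case True
      have "i div mlen < 2 * n" using True by (simp add: block_len_def less_mult_imp_div_less)
      moreover have "i mod mlen - 5 < \<kappa>" using True by linarith
      ultimately have "i div mlen * \<kappa> + (i mod mlen - 5) < 2 * n * \<kappa>" by (rule block_index(3))
      then have "w < n" using s K[OF i(1)] i True by (auto simp: all_coins_def)
      then show ?thesis using below_word[of w b n] by simp
    next
      case False
      have "w = K ! i" unfolding i(2) K[OF i(1)] by (rule if_not_P[OF False])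
      moreover have "K ! i \<in> set K" using i len by (intro nth_mem) simp
      ultimately show ?thesis using words by blast
    qed
  qed
  have idx: "r * ?bl + v * mlen + k < 3 * ?bl" if "r < 3" "v < 2 * n" "k < mlen" for r v k
  proof -
    have "v * mlen + k < ?bl" unfolding block_len_def by (rule block_index(3)) fact+
    then show ?thesis using block_index(3)[OF that(1), of "v * mlen + k" ?bl] by (simp add: add.assoc)
  qed
  have later: "R ?K r v k = R K r v k" if "1 \<le> r" "r < 3" "v < 2 * n" "k < mlen" for r v k
  proof -
    let ?i = "r * ?bl + v * mlen + k"
    have "1 * ?bl \<le> r * ?bl" using that(1) by (rule mult_right_mono) simp
    then have "\<not> ?c ?i" by linarith
    then show ?thesis unfolding word_at_def K[OF idx[OF that(2-)]] by (rule if_not_P)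
  qed
  have first: "R ?K 0 v k = (if 5 \<le> k \<and> k < 5 + \<kappa> then ?s (v * \<kappa> + (k - 5)) else R K 0 v k)"
    if "v < 2 * n" "k < mlen" for v k
  proof -
    have "v * mlen + k < ?bl" unfolding block_len_def by (rule block_index(3)) fact+
    then show ?thesis using K[of "v * mlen + k"] block_index(1,2)[OF that] by (simp add: word_at_def)
  qed
  have l: "k < mlen" if "k < 5 + \<kappa>" for k using that le_msg_len(1)[of n b] by linarith
  have F: "v < 2 * n" if "v \<in> F" for v using that V by auto
  have C: "v < 2 * n" if "v \<in> C" for v using that V by auto
  show ?thesis unfolding inv_def
  proof (intro conjI impI allI ballI)
    show "R ?K 0 v k = pw v (4 * n + k)" if "v < 2 * n" "k < 5" for v k
      using first[OF that(1), of k] l[of k] that block0(1)[OF inv _ that] by simp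
    show "R ?K 0 v (5 + c) = ?s (v * \<kappa> + c)" if "v < 2 * n" "c < \<kappa>" for v c
      using first[OF that(1), of "5 + c"] l[of "5 + c"] that by simp
    show "R ?K 1 v 0 = lev v" if "v \<in> F" for v
      using later[of 1 v 0] that F l[of 0] inv by (simp add: inv_def)
    show "R ?K 2 v (2 * g) = a g v" "R ?K 2 v (2 * g + 1) = ch g v"
      if "v \<in> C" "g \<le> L" "A g \<noteq> {}" for v g
      using later[of 2 v "2 * g"] later[of 2 v "2 * g + 1"] that C le_msg_len(2)[of g n b] inv
      by (simp_all add: inv_def)
  qed (use len' words' s in auto)
qed

definition step :: "(nat \<Rightarrow> words) \<Rightarrow> words \<Rightarrow> words" where
  "step cs K = (if accepting n b K then K else extend n b K (exchange cs K))"

definition transcript :: "(nat \<Rightarrow> words) \<Rightarrow> nat \<Rightarrow> words" where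
  "transcript cs t = (step cs ^^ t) []"

definition conf :: "(nat \<Rightarrow> words) \<Rightarrow> words \<Rightarrow> config" where
  "conf cs K v = (if v < 2 * n then pm cs v @ K else [])"

definition coin_space :: "(nat \<Rightarrow> words) set" where
  "coin_space = PiE_dflt {..<2 * n} [] (\<lambda>_. coin_lists n)"

abbreviation "P \<equiv> rfl_protocol n b"

lemma coin_space_lists: "cs \<in> coin_space \<Longrightarrow> v < 2 * n \<Longrightarrow> cs v \<in> coin_lists n"
  by (auto simp: coin_space_def PiE_dflt_def)

lemma finite_coin_space [simp]: "finite coin_space"
  unfolding coin_space_def by (rule finite_PiE_dflt) auto

lemma card_coin_space: "card coin_space = card G.\<Omega> ^ \<kappa>"
  unfolding coin_space_def
  by (simp add: card_PiE_dflt card_coin_lists G.card_Omega power_mult[symmetric] mult.commute)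

lemma coin_space_nonempty: "coin_space \<noteq> {}"
proof -
  have "0 < card coin_space" using card_coin_space G.card_Omega_pos by simp
  then show ?thesis by auto
qed

lemma pm_length: "cs \<in> coin_space \<Longrightarrow> v < 2 * n \<Longrightarrow> length (pm cs v) = private_len n"
  using coin_space_lists by (simp add: private_input_def private_len_def coin_lists_def)

lemma take_drop_conf:
  assumes "cs \<in> coin_space" and "v < 2 * n"
  shows "take (private_len n) (conf cs K v) = pm cs v" and "drop (private_len n) (conf cs K v) = K"
proof -
  have "conf cs K v = pm cs v @ K" using assms(2) by (simp add: conf_def)
  then show "take (private_len n) (conf cs K v) = pm cs v" "drop (private_len n) (conf cs K v) = K"
    using pm_length[OF assms] by (simp_all only: append_eq_conv_conj[symmetric] append_take_drop_id)
       (metis append_eq_conv_conj)+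
qed

lemma output_conf:
  assumes "cs \<in> coin_space" and "v < 2 * n"
  shows "mpc_output P v (conf cs K v) =
    (if accepting n b K then Some (v \<in> fst (solution n b K), v \<in> snd (solution n b K)) else None)"
  by (simp add: rfl_protocol_def take_drop_conf(2)[OF assms] Let_def)

lemma send_conf:
  assumes "cs \<in> coin_space" and "v < 2 * n"
  shows "mpc_send P v (conf cs K v) j = message n b v (pm cs v) K"
  by (simp add: rfl_protocol_def take_drop_conf[OF assms])

lemma halted_conf:
  assumes "cs \<in> coin_space"
  shows "mpc_halted P (2 * n) (conf cs K) \<longleftrightarrow> accepting n b K"
proof -
  have "(0::nat) < 2 * n" using n_pos by simp
  moreover have "mpc_output P v (conf cs K v) \<noteq> None \<longleftrightarrow> accepting n b K" if "v < 2 * n" for v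
    using output_conf[OF assms that] by simp
  ultimately show ?thesis unfolding mpc_halted_def by blast
qed

lemma round_conf:
  assumes "cs \<in> coin_space"
  shows "mpc_round P (2 * n) (conf cs K) = return_pmf (conf cs (step cs K))"
proof (cases "accepting n b K")
  case True
  then show ?thesis using halted_conf[OF assms] by (simp add: mpc_round_def step_def)
next
  case False
  have ex: "(\<lambda>j. if j < 2 * n then mpc_send P j (conf cs K j) v else []) = exchange cs K" for v
    using send_conf[OF assms] by (auto simp: exchange_def)
  have upd: "mpc_update P v (conf cs K v) rcv = return_pmf (pm cs v @ extend n b K rcv)" if "v < 2 * n" for v rcv
    using that by (simp add: rfl_protocol_def take_drop_conf[OF assms])
  have "mpc_round P (2 * n) (conf cs K) =
      Pi_pmf {..<2 * n} [] (\<lambda>v. mpc_update P v (conf cs K v) (exchange cs K))"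
    using False halted_conf[OF assms] by (simp add: mpc_round_def ex)
  also have "\<dots> = Pi_pmf {..<2 * n} [] (\<lambda>v. return_pmf (pm cs v @ extend n b K (exchange cs K)))"
    by (intro Pi_pmf_cong refl) (use upd in auto)
  also have "\<dots> = return_pmf (\<lambda>v. if v \<in> {..<2 * n} then pm cs v @ extend n b K (exchange cs K) else [])"
    by (rule Pi_pmf_return_pmf) simp
  also have "\<dots> = return_pmf (conf cs (step cs K))"
    using False by (intro arg_cong[where f = return_pmf] ext) (simp add: conf_def step_def)
  finally show ?thesis .
qed

text \<open>Randomness enters only at initialisation and every later round is deterministic, so a
  run is the image of the uniform distribution of the private coins, and probabilities become
  counts.\<close>

lemma run_eq:
  "mpc_run P (2 * n) (explicit_input I) t = map_pmf (\<lambda>cs. conf cs (transcript cs t)) (pmf_of_set coin_space)"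
proof (induction t)
  case 0
  have ne: "coin_lists n \<noteq> {}"
    using card_coin_lists[of n] n_pos by (metis card.empty not_one_le_zero power_eq_0_iff)
  have "mpc_run P (2 * n) (explicit_input I) 0 = Pi_pmf {..<2 * n} []
      (\<lambda>v. pmf_of_set (coin_lists n) \<bind> (\<lambda>cs. return_pmf (private_input n b (explicit_input I v) @ cs)))"
    by (simp add: rfl_protocol_def map_pmf_def)
  also have "\<dots> = Pi_pmf {..<2 * n} [] (\<lambda>_. pmf_of_set (coin_lists n)) \<bind>
      (\<lambda>cs. Pi_pmf {..<2 * n} [] (\<lambda>v. return_pmf (pm cs v)))"
    by (rule Pi_pmf_bind) simp
  also have "Pi_pmf {..<2 * n} [] (\<lambda>_. pmf_of_set (coin_lists n)) = pmf_of_set coin_space"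
    unfolding coin_space_def by (rule Pi_pmf_of_set) (use ne in auto)
  also have "(\<lambda>cs. Pi_pmf {..<2 * n} [] (\<lambda>v. return_pmf (pm cs v))) =
      (\<lambda>cs. return_pmf (conf cs (transcript cs 0)))"
    by (rule ext, subst Pi_pmf_return_pmf) (auto simp: conf_def transcript_def)
  finally show ?case by (simp add: map_pmf_def)
next
  case (Suc t)
  have "mpc_run P (2 * n) (explicit_input I) (Suc t) =
      pmf_of_set coin_space \<bind> (\<lambda>cs. mpc_round P (2 * n) (conf cs (transcript cs t)))"
    by (simp add: Suc map_pmf_def bind_assoc_pmf bind_return_pmf)
  also have "\<dots> = pmf_of_set coin_space \<bind> (\<lambda>cs. return_pmf (conf cs (transcript cs (Suc t))))"
    by (intro bind_pmf_cong refl)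
      (use round_conf coin_space_nonempty in \<open>auto simp: transcript_def\<close>)
  finally show ?case by (simp add: map_pmf_def)
qed

lemma transcript_Suc: "transcript cs (Suc t) = step cs (transcript cs t)"
  by (simp add: transcript_def)

lemma step_extend:
  assumes "cs \<in> coin_space" "inv r \<sigma> K" "r < 5" "r = 0 \<Longrightarrow> \<sigma> = coins_of cs"
  shows "inv (Suc r) \<sigma> (step cs K)"
proof -
  have "\<not> accepting n b K" using accepting_iff[OF assms(2)] assms(3) by simp
  then have "step cs K = extend n b K (exchange cs K)" by (simp add: step_def)
  then show ?thesis using inv_extend[OF assms(2,3) coin_space_lists[OF assms(1)] assms(4)] by simp
qed

lemma step_restart:
  assumes "inv 5 \<sigma> K" "\<not> accepting n b K"
  shows "inv 3 (next_coins n \<sigma>) (step cs K)"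
  using inv_restart[OF assms(1)] assms rounds_done_inv[OF assms(1)] by (simp add: step_def extend_def)

lemma transcript_first:
  assumes cs: "cs \<in> coin_space"
  shows "t \<le> 5 \<Longrightarrow> inv t (coins_of cs) (transcript cs t)"
proof (induction t)
  case 0
  have "coins_of cs \<in> all_coins n" by (rule coins_of(1)) (rule coin_space_lists[OF cs])
  then show ?case by (simp add: transcript_def inv_0)
next
  case (Suc t)
  then show ?case unfolding transcript_Suc by (intro step_extend[OF cs]) auto
qed

lemma transcript_inv:
  assumes cs: "cs \<in> coin_space"
  shows "\<exists>r \<sigma>. inv r \<sigma> (transcript cs t) \<and> (r = 0 \<longrightarrow> \<sigma> = coins_of cs)"
proof (induction t)
  case 0
  then show ?case using transcript_first[OF cs, of 0] by blast
next
  case (Suc t)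
  then obtain r \<sigma> where inv: "inv r \<sigma> (transcript cs t)" "r = 0 \<longrightarrow> \<sigma> = coins_of cs" by blast
  have "r \<le> 5" using inv(1) by (simp add: inv_def)
  then consider "r < 5" | "r = 5" "accepting n b (transcript cs t)" | "r = 5" "\<not> accepting n b (transcript cs t)"
    by linarith
  then show ?case
  proof cases
    case 1
    then show ?thesis using step_extend[OF cs inv(1)] inv(2) unfolding transcript_Suc by blast
  next
    case 2
    then have "transcript cs (Suc t) = transcript cs t" by (simp add: transcript_Suc step_def)
    then show ?thesis using inv by metis
  next
    case 3
    then show ?thesis using step_restart inv(1) unfolding transcript_Suc by fastforce
  qed
qed

lemma legal:
  assumes cs: "cs \<in> coin_space"
  shows "mpc_legal P (2 * n) (memory_bound n b) W (conf cs (transcript cs t))"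
proof -
  let ?K = "transcript cs t"
  obtain r \<sigma> where inv: "inv r \<sigma> ?K" using transcript_inv[OF cs] by blast
  have len: "length ?K \<le> 5 * block_len n b" and words: "set ?K \<subseteq> {..<2 ^ W}"
    using inv by (auto simp: inv_def)
  have "length (conf cs ?K v) \<le> memory_bound n b \<and> set (conf cs ?K v) \<subseteq> {..<2 ^ W}" if v: "v < 2 * n" for v
  proof -
    have "set (cs v) \<subseteq> {..<n}" using coin_space_lists[OF cs v] by (simp add: coin_lists_def)
    moreover have "{..<n} \<subseteq> {..<2 ^ W}" using below_word[of n b n] by auto
    ultimately have "set (pm cs v) \<subseteq> {..<2 ^ W}" by (auto simp: private_input_def)
    moreover have "conf cs ?K v = pm cs v @ ?K" using v by (simp add: conf_def)
    ultimately show ?thesis using len words pm_length[OF cs v] by (simp add: memory_bound_def)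
  qed
  moreover have "mpc_send P v (conf cs ?K v) j = message n b v (pm cs v) ?K" if "v < 2 * n" for v j
    using send_conf[OF cs that] .
  moreover have "(\<Sum>j<2 * n. mlen) \<le> memory_bound n b"
    by (simp add: memory_bound_def block_len_def)
  ultimately show ?thesis using message_words message_length
    by (simp add: mpc_legal_def)
qed

lemma halted_approx:
  assumes cs: "cs \<in> coin_space" and "mpc_halted P (2 * n) (conf cs (transcript cs t))"
  shows "approx_solution 1080 I (served_clients P (2 * n) (conf cs (transcript cs t)))
    (open_facilities P (2 * n) (conf cs (transcript cs t)))"
proof -
  let ?K = "transcript cs t"
  have acc: "accepting n b ?K" using assms halted_conf by blast
  obtain r \<sigma> where inv: "inv r \<sigma> ?K" using transcript_inv[OF cs] by blast
  let ?S = "solution n b ?K"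
  have approx: "approx_solution 1080 I (fst ?S) (snd ?S)" by (rule solution_approx[OF inv acc])
  then have "fst ?S \<subseteq> {..<2 * n}" "snd ?S \<subseteq> {..<2 * n}"
    using V by (auto simp: approx_solution_def feasible_def)
  then have "served_clients P (2 * n) (conf cs ?K) = fst ?S" "open_facilities P (2 * n) (conf cs ?K) = snd ?S"
    using output_conf[OF cs] acc by (auto simp: served_clients_def open_facilities_def)
  then show ?thesis using approx by simp
qed

section \<open>The probability of halting\<close>

lemma seed_Omega:
  assumes "\<sigma> \<in> all_coins n" "c < \<kappa>"
  shows "sd \<sigma> c \<in> G.\<Omega>"
  using assms block_index(3)[of _ "2 * n" c \<kappa>] by (auto simp: seed_def G.\<Omega>_def all_coins_def)

text \<open>Transposing the coin lists of the vertices into \<open>\<kappa>\<close> samples is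
  injective. Bad coins are bad in every sample, at most half of all samples are bad, and
  \<open>2 ^ \<kappa>\<close> is at least \<open>n\<close>.\<close>

lemma card_bad_coins:
  "n * card {cs\<in>coin_space. \<not> good_coins (coins_of cs)} \<le> card coin_space" (is "n * card ?B \<le> _")
proof -
  let ?Bad = "{s\<in>G.\<Omega>. \<not> good s}"
  let ?g = "\<lambda>cs. \<lambda>c\<in>{..<\<kappa>}. sd (coins_of cs) c"
  have coin_value: "?g cs c v = cs v ! c" if "cs \<in> coin_space" "c < \<kappa>" "v < 2 * n" for cs c v
    using that coins_of(2)[of cs v c, OF coin_space_lists[OF that(1)] that(3,2)] by (simp add: seed_def)
  have "inj_on ?g ?B"
  proof (rule inj_onI)
    fix cs cs' assume cs: "cs \<in> ?B" "cs' \<in> ?B" and eq: "?g cs = ?g cs'"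
    show "cs = cs'"
    proof
      fix v
      show "cs v = cs' v"
      proof (cases "v < 2 * n")
        case True
        have "length (cs v) = \<kappa>" "length (cs' v) = \<kappa>"
          using coin_space_lists[OF _ True] cs by (auto simp: coin_lists_def)
        moreover have "cs v ! c = cs' v ! c" if "c < \<kappa>" for c
          using coin_value[of cs c v] coin_value[of cs' c v] eq cs True that by simp
        ultimately show ?thesis by (intro nth_equalityI) auto
      next
        case False
        then show ?thesis using cs by (auto simp: coin_space_def PiE_dflt_def)
      qed
    qed
  qed
  moreover have "?g ` ?B \<subseteq> {..<\<kappa>} \<rightarrow>\<^sub>E ?Bad"
  proof (intro image_subsetI PiE_I)
    fix cs c assume cs: "cs \<in> ?B" and c: "c \<in> {..<\<kappa>}"
    have "coins_of cs \<in> all_coins n" by (rule coins_of(1)) (use cs coin_space_lists in auto)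
    then show "?g cs c \<in> ?Bad" using cs c seed_Omega by (auto simp: good_coins_def)
  qed auto
  moreover have "finite ({..<\<kappa>} \<rightarrow>\<^sub>E ?Bad)" by (intro finite_PiE) auto
  ultimately have "card ?B \<le> card ({..<\<kappa>} \<rightarrow>\<^sub>E ?Bad)" by (rule card_inj_on_le)
  then have "card ?B \<le> card ?Bad ^ \<kappa>" by (simp add: card_PiE)
  then have "2 ^ \<kappa> * card ?B \<le> (2 * card ?Bad) ^ \<kappa>" by (simp add: power_mult_distrib)
  also have "\<dots> \<le> card G.\<Omega> ^ \<kappa>" by (rule power_mono[OF card_not_good_le]) simp
  finally have le: "2 ^ \<kappa> * card ?B \<le> card coin_space" by (simp only: card_coin_space)
  have "n \<le> 2 ^ \<kappa>" using n_le_two_power_copies[of n] by linarith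
  then have "n * card ?B \<le> 2 ^ \<kappa> * card ?B" by (rule mult_right_mono) simp
  then show ?thesis using le by linarith
qed

lemma halted_prob:
  "measure_pmf.prob (mpc_run P (2 * n) (explicit_input I) t) {c. mpc_halted P (2 * n) c} =
    real (card {cs\<in>coin_space. accepting n b (transcript cs t)}) / real (card coin_space)"
proof -
  have "measure_pmf.prob (mpc_run P (2 * n) (explicit_input I) t) {c. mpc_halted P (2 * n) c} =
      measure_pmf.prob (pmf_of_set coin_space) {cs. mpc_halted P (2 * n) (conf cs (transcript cs t))}"
    unfolding run_eq by (simp add: vimage_def)
  also have "\<dots> = real (card (coin_space \<inter> {cs. mpc_halted P (2 * n) (conf cs (transcript cs t))})) / real (card coin_space)"
    using coin_space_nonempty by (simp add: measure_pmf_of_set)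
  also have "coin_space \<inter> {cs. mpc_halted P (2 * n) (conf cs (transcript cs t))} =
      {cs\<in>coin_space. accepting n b (transcript cs t)}"
    using halted_conf by auto
  finally show ?thesis .
qed

lemma halted_prob_5:
  "1 - 1 / real n \<le> measure_pmf.prob (mpc_run P (2 * n) (explicit_input I) 5) {c. mpc_halted P (2 * n) c}"
proof -
  let ?B = "{cs\<in>coin_space. \<not> good_coins (coins_of cs)}"
  have "accepting n b (transcript cs 5) \<longleftrightarrow> good_coins (coins_of cs)" if "cs \<in> coin_space" for cs
    using accepting_iff[OF transcript_first[OF that, of 5]] by simp
  then have eq: "{cs\<in>coin_space. accepting n b (transcript cs 5)} = coin_space - ?B" by auto
  have "card (coin_space - ?B) = card coin_space - card ?B" by (rule card_Diff_subset) auto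
  moreover have le: "card ?B \<le> card coin_space" by (rule card_mono) auto
  ultimately have card: "real (card (coin_space - ?B)) = real (card coin_space) - real (card ?B)"
    by (simp add: of_nat_diff)
  have pos: "0 < real (card coin_space)" using coin_space_nonempty by (simp add: card_gt_0_iff)
  have "real n * real (card ?B) \<le> real (card coin_space)"
    using card_bad_coins by (metis of_nat_le_iff of_nat_mult)
  then have "real (card ?B) / real (card coin_space) \<le> 1 / real n"
    using pos n_pos by (simp add: field_simps)
  then show ?thesis unfolding halted_prob eq card using pos coin_space_nonempty by (simp add: diff_divide_distrib)
qed

lemma good_coins_exist: "\<exists>\<sigma>\<in>all_coins n. good_coins \<sigma>"
proof -
  have "card {s\<in>G.\<Omega>. \<not> good s} < card G.\<Omega>" using card_not_good_le G.card_Omega_pos by linarith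
  then have "{s\<in>G.\<Omega>. \<not> good s} \<noteq> G.\<Omega>" by auto
  then obtain s where s: "s \<in> G.\<Omega>" "good s" by blast
  \<comment> \<open>The same good sample in every column; column 0 then serves as witness.\<close>
  let ?\<sigma> = "\<lambda>y\<in>{..<2 * n * \<kappa>}. s (y div \<kappa>)"
  have "s v < n" if "v < 2 * n" for v
    using s(1) that by (simp add: G.\<Omega>_def PiE_iff)
  then have "?\<sigma> \<in> all_coins n"
    unfolding all_coins_def by (intro restrict_PiE_iff[THEN iffD2]) (simp add: less_mult_imp_div_less)
  have "sd ?\<sigma> 0 = s"
  proof
    fix v
    show "sd ?\<sigma> 0 v = s v"
    proof (cases "v < 2 * n")
      case True
      then show ?thesis using block_index[OF True copies_pos[of n]] by (simp add: seed_def)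
    next
      case False
      have "s \<in> extensional {..<2 * n}" using s(1) by (simp add: G.\<Omega>_def PiE_def)
      then show ?thesis using False by (simp add: seed_def extensional_def)
    qed
  qed
  then have "good_coins ?\<sigma>" unfolding good_coins_def using s(2) copies_pos[of n]
    by (intro exI[of _ 0]) simp
  then show ?thesis using \<open>?\<sigma> \<in> all_coins n\<close> by blast
qed

text \<open>Every failure advances the coins by one step of the cycle within three rounds, so a good
  table is reached, and accepting is permanent.\<close>

lemma eventually_accepting:
  assumes cs: "cs \<in> coin_space"
  shows "\<exists>t. \<forall>t'\<ge>t. accepting n b (transcript cs t')"
proof -
  have stay: "accepting n b (transcript cs (t + k))" if "accepting n b (transcript cs t)" for t k
    using that by (induction k) (auto simp: transcript_Suc step_def)
  have iter: "\<exists>t. accepting n b (transcript cs t) \<or> inv 5 ((next_coins n ^^ m) (coins_of cs)) (transcript cs t)" for m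
  proof (induction m)
    case 0
    then show ?case using transcript_first[OF cs, of 5] by auto
  next
    case (Suc m)
    then obtain t where t: "accepting n b (transcript cs t) \<or> inv 5 ((next_coins n ^^ m) (coins_of cs)) (transcript cs t)"
      by blast
    show ?case
    proof (cases "accepting n b (transcript cs t)")
      case False
      let ?\<sigma> = "next_coins n ((next_coins n ^^ m) (coins_of cs))"
      have "inv 3 ?\<sigma> (transcript cs (Suc t))"
        using step_restart t False unfolding transcript_Suc by blast
      then have "inv 4 ?\<sigma> (transcript cs (Suc (Suc t)))"
        using step_extend[OF cs, of 3] unfolding transcript_Suc by simp
      then have "inv 5 ?\<sigma> (transcript cs (Suc (Suc (Suc t))))"
        using step_extend[OF cs, of 4] unfolding transcript_Suc by simp
      then show ?thesis by (intro exI[of _ "Suc (Suc (Suc t))"]) simp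
    qed blast
  qed
  obtain \<sigma> where \<sigma>: "\<sigma> \<in> all_coins n" "good_coins \<sigma>" using good_coins_exist by blast
  have "coins_of cs \<in> all_coins n" by (rule coins_of(1)) (rule coin_space_lists[OF cs])
  from next_coins(2)[OF this \<sigma>(1)] obtain m where "(next_coins n ^^ m) (coins_of cs) = \<sigma>" by blast
  then obtain t where "accepting n b (transcript cs t)"
    using iter[of m] accepting_iff \<sigma>(2) by auto
  then have "\<forall>t'\<ge>t. accepting n b (transcript cs t')" using stay by (metis le_add_diff_inverse)
  then show ?thesis by blast
qed

text \<open>The coin space is finite, so one time serves all coins and the probability is eventually
  equal to 1.\<close>

lemma halted_tendsto:
  "(\<lambda>t. measure_pmf.prob (mpc_run P (2 * n) (explicit_input I) t) {c. mpc_halted P (2 * n) c}) \<longlonglongrightarrow> 1"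
proof -
  have "\<forall>\<^sub>F t in sequentially. \<forall>cs\<in>coin_space. accepting n b (transcript cs t)"
    using eventually_accepting unfolding eventually_ball_finite_distrib[OF finite_coin_space] eventually_sequentially
    by blast
  then have "\<forall>\<^sub>F t in sequentially.
      measure_pmf.prob (mpc_run P (2 * n) (explicit_input I) t) {c. mpc_halted P (2 * n) c} = 1"
  proof eventually_elim
    case (elim t)
    then have "{cs\<in>coin_space. accepting n b (transcript cs t)} = coin_space" by blast
    then show ?case unfolding halted_prob using coin_space_nonempty by simp
  qed
  then show ?thesis by (rule tendsto_eventually)
qed

end

section \<open>Asymptotics\<close>

text \<open>From \<open>2 ^ (lg n - 1) < n\<close> and \<open>2 \<le> n\<close> follows
  \<open>2 ^ lg n \<le> n * n\<close>; the crude square costs only the factor 2.\<close>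

lemma lg_le: assumes "n \<ge> 2" shows "real (lg n) \<le> 2 / ln 2 * ln (real n)"
proof -
  have "lg n \<noteq> 0" using le_two_power_lg[of n] assms by (cases "lg n") auto
  then obtain k where k: "lg n = Suc k" using not0_implies_Suc by blast
  then have "\<not> n \<le> 2 ^ k" unfolding lg_def by (intro not_less_Least) simp
  then have "(2::nat) ^ lg n \<le> n * n" using k assms mult_mono[of 2 n "2 ^ k" n] by simp
  then have "(2::real) ^ lg n \<le> real n * real n" by (metis of_nat_le_iff of_nat_mult of_nat_numeral of_nat_power)
  then have "ln (2 ^ lg n) \<le> ln (real n * real n)" using assms by (subst ln_le_cancel_iff) auto
  then have "real (lg n) * ln 2 \<le> 2 * ln (real n)" using assms by (simp add: ln_realpow ln_mult)
  then show ?thesis by (simp add: field_simps)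
qed

lemma lg_bigo: "(\<lambda>n. real (lg n)) \<in> O(\<lambda>n. ln (real n))"
proof (rule bigoI)
  show "\<forall>\<^sub>F n in sequentially. norm (real (lg n)) \<le> 2 / ln 2 * norm (ln (real n))"
    using eventually_ge_at_top[of 2] by eventually_elim (use lg_le in auto)
qed

lemma const_bigo_ln: "(\<lambda>n. c) \<in> O(\<lambda>n::nat. ln (real n) :: real)"
  by real_asymp

context
  fixes B :: "nat \<Rightarrow> nat"
  assumes B: "(\<lambda>n. real (B n)) \<in> O(\<lambda>n. ln (real n))"
begin

lemma max_level_bigo: "(\<lambda>n. real (max_level n (B n))) \<in> O(\<lambda>n. ln (real n))"
  unfolding max_level_def of_nat_add of_nat_mult
  by (intro sum_in_bigo landau_o.big.cmult_in_iff[THEN iffD2] B lg_bigo const_bigo_ln) auto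

lemma word_bits_bigo: "(\<lambda>n. real (word_bits n (B n))) \<in> O(\<lambda>n. ln (real n))"
  unfolding word_bits_def of_nat_add by (intro sum_in_bigo B lg_bigo max_level_bigo const_bigo_ln)

lemma copies_bigo: "(\<lambda>n. real (copies n)) \<in> O(\<lambda>n. ln (real n))"
  unfolding copies_def of_nat_add by (intro sum_in_bigo lg_bigo const_bigo_ln)

lemma msg_len_bigo: "(\<lambda>n. real (msg_len n (B n))) \<in> O(\<lambda>n. ln (real n))"
  unfolding msg_len_def of_nat_add of_nat_mult
  by (intro sum_in_bigo landau_o.big.cmult_in_iff[THEN iffD2] copies_bigo max_level_bigo const_bigo_ln) auto

lemma memory_bound_bigo: "(\<lambda>n. real (memory_bound n (B n))) \<in> O(\<lambda>n. real n * ln (real n))"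
proof -
  have eq: "real (memory_bound n (B n)) =
      4 * real n + 5 + real (copies n) + 10 * (real n * real (msg_len n (B n)))" for n
    by (simp add: memory_bound_def private_len_def block_len_def)
  have "(\<lambda>n. real (copies n)) \<in> O(\<lambda>n. real n * ln (real n))"
    by (rule landau_o.big.trans[OF copies_bigo]) real_asymp
  moreover have "(\<lambda>n. 4 * real n) \<in> O(\<lambda>n. real n * ln (real n))" "(\<lambda>n. 5 :: real) \<in> O(\<lambda>n::nat. real n * ln (real n))"
    by real_asymp+
  moreover have "(\<lambda>n. real n * real (msg_len n (B n))) \<in> O(\<lambda>n. real n * ln (real n))"
    by (intro landau_o.big.mult_left msg_len_bigo)
  ultimately show ?thesis unfolding eq by (intro sum_in_bigo) auto
qed

end

theorem theorem42:
  "\<exists>\<alpha>::real. \<alpha> \<ge> 1 \<and>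
    (\<forall>B :: nat \<Rightarrow> nat. (\<lambda>n. real (B n)) \<in> O(\<lambda>n. ln (real n)) \<longrightarrow>
      (\<exists>(P :: nat \<Rightarrow> rfl_protocol) (M :: nat \<Rightarrow> nat) (S :: nat \<Rightarrow> nat) (W :: nat \<Rightarrow> nat)
          (T :: nat \<Rightarrow> nat) (k :: nat).
        (\<lambda>n. real (M n)) \<in> soft_O (\<lambda>n. real n) \<and>
        (\<lambda>n. real (S n)) \<in> soft_O (\<lambda>n. real n) \<and>
        (\<lambda>n. real (W n)) \<in> O(\<lambda>n. ln (real n)) \<and>
        (\<lambda>n. real (T n)) \<in> O(\<lambda>n. ln (ln (ln (real n)))) \<and>
        k \<ge> 1 \<and>
        (\<forall>n. 2 * n \<le> M n) \<and>
        (\<forall>n\<ge>1. \<forall>I. valid_instance n (B n) I \<longrightarrow>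
          (let run = mpc_run (P n) (M n) (explicit_input I) in
            (\<forall>t. \<forall>c\<in>set_pmf (run t).
               mpc_legal (P n) (M n) (S n) (W n) c \<and>
               (mpc_halted (P n) (M n) c \<longrightarrow>
                  approx_solution \<alpha> I (served_clients (P n) (M n) c)
                    (open_facilities (P n) (M n) c))) \<and>
            (\<lambda>t. measure_pmf.prob (run t) {c. mpc_halted (P n) (M n) c}) \<longlonglongrightarrow> 1 \<and>
            measure_pmf.prob (run (T n)) {c. mpc_halted (P n) (M n) c} \<ge> 1 - 1 / real n ^ k))))"
proof (intro exI[of _ "1080::real"] conjI allI impI)
  fix B :: "nat \<Rightarrow> nat"
  assume B: "(\<lambda>n. real (B n)) \<in> O(\<lambda>n. ln (real n))"
  let ?P = "\<lambda>n. rfl_protocol n (B n)" and ?M = "\<lambda>n. 2 * n" and ?S = "\<lambda>n. memory_bound n (B n)"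
    and ?W = "\<lambda>n. word_bits n (B n)" and ?T = "\<lambda>_. 5 :: nat"
  have M: "(\<lambda>n. real (?M n)) \<in> soft_O (\<lambda>n. real n)"
    unfolding soft_O_def by (intro CollectI exI[of _ 0]) simp
  have S: "(\<lambda>n. real (?S n)) \<in> soft_O (\<lambda>n. real n)"
    unfolding soft_O_def using memory_bound_bigo[OF B] by (intro CollectI exI[of _ 1]) simp
  \<comment> \<open>A constant belongs to the class because the iterated logarithm tends to
    infinity.\<close>
  have T: "(\<lambda>n. real (?T n)) \<in> O(\<lambda>n. ln (ln (ln (real n))))"
    by (simp, real_asymp)
  have correct: "let run = mpc_run (?P n) (?M n) (explicit_input I) in
      (\<forall>t. \<forall>c\<in>set_pmf (run t). mpc_legal (?P n) (?M n) (?S n) (?W n) c \<and>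
         (mpc_halted (?P n) (?M n) c \<longrightarrow>
            approx_solution 1080 I (served_clients (?P n) (?M n) c) (open_facilities (?P n) (?M n) c))) \<and>
      (\<lambda>t. measure_pmf.prob (run t) {c. mpc_halted (?P n) (?M n) c}) \<longlonglongrightarrow> 1 \<and>
      measure_pmf.prob (run (?T n)) {c. mpc_halted (?P n) (?M n) c} \<ge> 1 - 1 / real n ^ 1"
    if n: "n \<ge> 1" and valid: "valid_instance n (B n) I" for n I
  proof -
    interpret rfl_input n "B n" I using n valid by unfold_locales
    have reach: "\<exists>cs\<in>coin_space. c = conf cs (transcript cs t)"
      if "c \<in> set_pmf (mpc_run (?P n) (?M n) (explicit_input I) t)" for t c
      using that coin_space_nonempty unfolding run_eq by auto
    show ?thesis unfolding Let_def power_one_right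
    proof (intro conjI allI ballI impI)
      fix t c assume "c \<in> set_pmf (mpc_run (?P n) (?M n) (explicit_input I) t)"
      then obtain cs where cs: "cs \<in> coin_space" "c = conf cs (transcript cs t)" using reach by blast
      show "mpc_legal (?P n) (?M n) (?S n) (?W n) c" unfolding cs(2) by (rule legal[OF cs(1)])
      assume "mpc_halted (?P n) (?M n) c"
      then show "approx_solution 1080 I (served_clients (?P n) (?M n) c) (open_facilities (?P n) (?M n) c)"
        unfolding cs(2) by (rule halted_approx[OF cs(1)])
    qed (rule halted_tendsto halted_prob_5)+
  qed
  show "\<exists>P M S W T k. (\<lambda>n. real (M n)) \<in> soft_O (\<lambda>n. real n) \<and>
        (\<lambda>n. real (S n)) \<in> soft_O (\<lambda>n. real n) \<and>
        (\<lambda>n. real (W n)) \<in> O(\<lambda>n. ln (real n)) \<and>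
        (\<lambda>n. real (T n)) \<in> O(\<lambda>n. ln (ln (ln (real n)))) \<and>
        k \<ge> 1 \<and>
        (\<forall>n. 2 * n \<le> M n) \<and>
        (\<forall>n\<ge>1. \<forall>I. valid_instance n (B n) I \<longrightarrow>
          (let run = mpc_run (P n) (M n) (explicit_input I) in
            (\<forall>t. \<forall>c\<in>set_pmf (run t).
               mpc_legal (P n) (M n) (S n) (W n) c \<and>
               (mpc_halted (P n) (M n) c \<longrightarrow>
                  approx_solution 1080 I (served_clients (P n) (M n) c)
                    (open_facilities (P n) (M n) c))) \<and>
            (\<lambda>t. measure_pmf.prob (run t) {c. mpc_halted (P n) (M n) c}) \<longlonglongrightarrow> 1 \<and>
            measure_pmf.prob (run (T n)) {c. mpc_halted (P n) (M n) c} \<ge> 1 - 1 / real n ^ k))"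
    by (rule exI[of _ ?P], rule exI[of _ ?M], rule exI[of _ ?S], rule exI[of _ ?W], rule exI[of _ ?T],
        rule exI[of _ 1], intro conjI M S T word_bits_bigo[OF B] allI impI order_refl) (rule correct)
qed simp

end
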